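(* Let $\mathcal M$ be an o-minimal structure in a language $\mathcal L$, with universe $M$, and let $\mathcal N$ be an expansion of $\mathcal M$ such that (a) every open definable set is $\mathcal L$-definable, and (b) $\mathcal N$ admits a dimension function $\dim$ compatible with $\mathcal M$. Let $G$ be a definable group. Then $G$ is definably isomorphic to a group definable in $\mathcal M$ if and only if $G$ is definably isomorphic to a strongly large group.
   Context: "Definable" means definable in $\mathcal N$ with parameters; "$\mathcal L$-definable" means definable in $\mathcal M$ with parameters. A definable group is a group whose universe (a subset of some $M^n$) and group operation are definable; a definable isomorphism is a group isomorphism whose graph is definable. A dimension function compatible with $\mathcal M$ is a map $\dim$ from the class of all definable sets to $\{-\infty\}\cup\mathbb N$ such that for all definable $X,Y\subseteq M^n$ and $a\in M$: (D1) $\dim\{a\}=0$, $\dim M=1$, and $\dim X=-\infty$ iff $X=\emptyset$; (D2) $\dim(X\cup Y)=\max\{\dim X,\dim Y\}$; (D3) if $\{X_t\}_{t\in I}$ is a definable family of pairwise disjoint sets, then (a) for each $d\in\{-\infty\}\cup\mathbb N$ the set $\{t\in I:\dim X_t=d\}$ is definable, and (b) if every $X_t$ has dimension $k$ then $\dim\bigcup_{t\in I}X_t=\dim I+k$; (D4) if $f:X\to Y$ is a definable bijection then $\dim X=\dim Y$; (D5) the dimension of every $\mathcal L$-definable set equals its o-minimal dimension; (D6) every definable map $f:M^n\to M$ agrees with an $\mathcal L$-definable map $F:M^n\to M$ outside a definable set of dimension $<n$. Topology is the order (product) topology; $cl(X)$ denotes topological closure. A definable set $X$ is strongly large if $\dim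 X=\dim cl(X)$ (the latter being the o-minimal dimension of the $\mathcal L$-definable set $cl(X)$); a definable group is strongly large if its universe is. *)

theory Defs
  imports "HOL-Algebra.Group" "HOL-Library.Option_ord"
begin

text \<open>M^n is represented as the set of lists of length n over the universe type 'a.
A structure in the sense of van den Dries (Tame Topology, Ch.1) is a sequence S of
collections of subsets of M^n; S m = the sets definable (with parameters) in M^m.\<close>

definition tuples :: "nat \<Rightarrow> 'a list set" where
  "tuples n = {x. length x = n}"

definition is_structure :: "(nat \<Rightarrow> 'a::linorder list set set) \<Rightarrow> bool" where
  "is_structure S \<longleftrightarrow>
     (\<forall>m. \<forall>A\<in>S m. A \<subseteq> tuples m)
   \<and> (\<forall>m. {} \<in> S m \<and> tuples m \<in> S m)
   \<and> (\<forall>m A B. A \<in> S m \<longrightarrow> B \<in> S m \<longrightarrow> A \<union> B \<in> S m)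
   \<and> (\<forall>m A. A \<in> S m \<longrightarrow> tuples m - A \<in> S m)
   \<and> (\<forall>m A. A \<in> S m \<longrightarrow> {x @ [r] | x r. x \<in> A} \<in> S (Suc m)
                       \<and> {r # x | x r. x \<in> A} \<in> S (Suc m))
   \<and> (\<forall>m i j. i < j \<and> j < m \<longrightarrow> {x \<in> tuples m. x ! i = x ! j} \<in> S m)
   \<and> (\<forall>m A. A \<in> S (Suc m) \<longrightarrow> butlast ` A \<in> S m)
   \<and> (\<forall>a. {[a]} \<in> S 1)
   \<and> {[x, y] | x y. x < y} \<in> S 2"

definition omin_basic :: "'a::linorder set \<Rightarrow> bool" where
  "omin_basic B \<longleftrightarrow> (\<exists>c. B = {c}) \<or> (\<exists>a b. B = {x. a < x \<and> x < b})
     \<or> (\<exists>a. B = {x. a < x}) \<or> (\<exists>b. B = {x. x < b}) \<or> B = UNIV"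

definition o_minimal :: "(nat \<Rightarrow> 'a::linorder list set set) \<Rightarrow> bool" where
  "o_minimal S \<longleftrightarrow> is_structure S \<and>
     (\<forall>A\<in>S 1. \<exists>F. finite F \<and> (\<forall>B\<in>F. omin_basic B) \<and> {a. [a] \<in> A} = \<Union>F)"

definition expansion :: "(nat \<Rightarrow> 'a::linorder list set set) \<Rightarrow> (nat \<Rightarrow> 'a list set set) \<Rightarrow> bool" where
  "expansion SN SM \<longleftrightarrow> is_structure SN \<and> (\<forall>m. SM m \<subseteq> SN m)"

definition box :: "'a::linorder list \<Rightarrow> 'a list \<Rightarrow> 'a list set" where
  "box a b = {x. length x = length a \<and> (\<forall>i<length a. a ! i < x ! i \<and> x ! i < b ! i)}"

definition open_tuples :: "nat \<Rightarrow> 'a::linorder list set \<Rightarrow> bool" where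
  "open_tuples n A \<longleftrightarrow> A \<subseteq> tuples n \<and>
     (\<forall>x\<in>A. \<exists>a b. length a = n \<and> length b = n \<and> x \<in> box a b \<and> box a b \<subseteq> A)"

definition cl :: "nat \<Rightarrow> 'a::linorder list set \<Rightarrow> 'a list set" where
  "cl n X = {x \<in> tuples n. \<forall>a b. length a = n \<and> length b = n \<and> x \<in> box a b
                \<longrightarrow> box a b \<inter> X \<noteq> {}}"

definition has_interior :: "nat \<Rightarrow> 'a::linorder list set \<Rightarrow> bool" where
  "has_interior n A \<longleftrightarrow> (\<exists>x\<in>A. \<exists>a b. length a = n \<and> length b = n \<and> x \<in> box a b \<and> box a b \<subseteq> A)"

text \<open>o-minimal dimension: None stands for -\<infinity>; otherwise the largest d such that
some coordinate projection of A onto M^d has nonempty interior.\<close>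
definition omin_dim :: "nat \<Rightarrow> 'a::linorder list set \<Rightarrow> nat option" where
  "omin_dim n A = (if A = {} then None else Some (Max {length is | is.
      sorted_wrt (<) is \<and> (\<forall>i\<in>set is. i < n) \<and>
      has_interior (length is) ((\<lambda>x. map ((!) x) is) ` A)}))"

definition dimension_function ::
  "(nat \<Rightarrow> 'a::linorder list set set) \<Rightarrow> (nat \<Rightarrow> 'a list set set) \<Rightarrow> ('a list set \<Rightarrow> nat option) \<Rightarrow> bool" where
  "dimension_function SN SM dim \<longleftrightarrow>
     \<comment> \<open>D1\<close>
     (\<forall>a. dim {[a]} = Some 0) \<and> dim (tuples 1) = Some 1
   \<and> (\<forall>n X. X \<in> SN n \<longrightarrow> (dim X = None \<longleftrightarrow> X = {}))
     \<comment> \<open>D2\<close>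
   \<and> (\<forall>n X Y. X \<in> SN n \<longrightarrow> Y \<in> SN n \<longrightarrow> dim (X \<union> Y) = max (dim X) (dim Y))
     \<comment> \<open>D3: family X_t = {x. t @ x \<in> F}, t \<in> I\<close>
   \<and> (\<forall>m n I F. I \<in> SN m \<longrightarrow> F \<in> SN (m + n) \<longrightarrow>
        (let X = (\<lambda>t. {x \<in> tuples n. t @ x \<in> F}) in
          (\<forall>t\<in>I. \<forall>t'\<in>I. t \<noteq> t' \<longrightarrow> X t \<inter> X t' = {}) \<longrightarrow>
          (\<forall>d. {t \<in> I. dim (X t) = d} \<in> SN m)
          \<and> (\<forall>k::nat. (\<forall>t\<in>I. dim (X t) = Some k) \<longrightarrow>
                dim (\<Union>t\<in>I. X t) = map_option (\<lambda>d. d + k) (dim I))))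
     \<comment> \<open>D4\<close>
   \<and> (\<forall>n m X Y f. X \<in> SN n \<longrightarrow> Y \<in> SN m \<longrightarrow> bij_betw f X Y \<longrightarrow>
        {x @ f x | x. x \<in> X} \<in> SN (n + m) \<longrightarrow> dim X = dim Y)
     \<comment> \<open>D5\<close>
   \<and> (\<forall>n A. A \<in> SM n \<longrightarrow> dim A = omin_dim n A)
     \<comment> \<open>D6\<close>
   \<and> (\<forall>n (f :: 'a list \<Rightarrow> 'a). {x @ [f x] | x. x \<in> tuples n} \<in> SN (Suc n) \<longrightarrow>
        (\<exists>F D. {x @ [F x] | x. x \<in> tuples n} \<in> SM (Suc n) \<and> D \<in> SN n \<and> dim D < Some n
             \<and> (\<forall>x \<in> tuples n - D. f x = F x)))"

definition definable_group :: "(nat \<Rightarrow> 'a list set set) \<Rightarrow> nat \<Rightarrow> 'a list monoid \<Rightarrow> bool" where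
  "definable_group S n G \<longleftrightarrow> group G \<and> carrier G \<subseteq> tuples n \<and> carrier G \<in> S n
     \<and> {x @ y @ (x \<otimes>\<^bsub>G\<^esub> y) | x y. x \<in> carrier G \<and> y \<in> carrier G} \<in> S (3 * n)"

definition definably_isomorphic ::
  "(nat \<Rightarrow> 'a list set set) \<Rightarrow> nat \<Rightarrow> 'a list monoid \<Rightarrow> nat \<Rightarrow> 'a list monoid \<Rightarrow> bool" where
  "definably_isomorphic S n G k H \<longleftrightarrow>
     (\<exists>f. f \<in> iso G H \<and> {x @ f x | x. x \<in> carrier G} \<in> S (n + k))"

definition strongly_large :: "('a::linorder list set \<Rightarrow> nat option) \<Rightarrow> nat \<Rightarrow> 'a list set \<Rightarrow> bool" where
  "strongly_large dim n X \<longleftrightarrow> dim X = omin_dim n (cl n X)"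

end

theory Submission
  imports Defs
begin

text \<open>Additivity of \<open>dim\<close> replaces cell decomposition: a family of boxes of full dimension contains a
  uniform box, which yields the frontier inequality and shows that an \<open>SM\<close>-definable set of dimension
  \<open>k\<close> projects injectively to some \<open>k\<close> coordinates near all its points outside a smaller set.  This
  gives one direction.

  Conversely, let \<open>G\<close> be strongly large of dimension \<open>k\<close>.  On the charts just described every definable
  map is generically \<open>SM\<close>-definable, and taking essential closures glues the local approximations:
  the multiplication of \<open>G\<close> agrees with an \<open>SM\<close>-definable partial operation \<open>E\<close> off a set of dimension less
  than \<open>2k\<close>.  Following Weil, an element \<open>a\<close> represents \<open>g \<in> G\<close> if \<open>E a x = g x\<close> for generic \<open>x\<close>.  Generic
  associativity is an \<open>SM\<close>-definable condition on \<open>a\<close> forcing \<open>a\<close> to represent some \<open>g\<close>, almost every element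
  represents itself, and equality of products of represented elements is \<open>SM\<close>-definable because it can
  be tested at generic points.  Finitely many translates of the represented elements cover \<open>G\<close>.\<close>

subsection \<open>Definability\<close>

text \<open>D6 controls a definable function of l variables only off a set of dimension less than l.
  If every \<open>SM\<close>-definable set around \<open>G\<close> has larger dimension than
  \<open>G\<close>, this says nothing about \<open>G\<close>. Strong largeness makes the closure of
  \<open>G\<close> an \<open>SM\<close>-definable set of the same dimension k, so that D6, read
  through k coordinates, determines definable maps at almost all points of \<open>G\<close> and of
  \<open>G \<times> G\<close>.

  Two obstacles shape the second direction. The exceptional sets are only
  \<open>SN\<close>-definable, so the approximation \<open>E\<close> is uncontrolled on a set that
  \<open>SM\<close> cannot recognize; every condition on an element has to be phrased through
  generic quantifiers over an \<open>SM\<close>-definable approximation \<open>W\<close> of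
  \<open>G\<close>. And \<open>SM\<close> offers no definable choice, so several elements
  representing the same group element cannot be replaced by a chosen one: ambiguous representatives
  are discarded, and finitely many translates make up for the loss.\<close>

lemma tuples_0 [simp]: "tuples 0 = {[]}"
  by (auto simp: tuples_def)

lemma mem_tuples: "x \<in> tuples n \<longleftrightarrow> length x = n"
  by (simp add: tuples_def)

text \<open>A formula in n free variables is a predicate on lists of length n, its variables being
  read off by \<open>take\<close>, \<open>drop\<close> and \<open>!\<close>. Closure of definable
  sets under connectives, quantifiers and substitution then becomes a set of introduction rules, the
  collection \<open>defs\<close>, that follow the syntax of the predicate.\<close>

definition defpred :: "(nat \<Rightarrow> 'a list set set) \<Rightarrow> nat \<Rightarrow> ('a list \<Rightarrow> bool) \<Rightarrow> bool" where
  "defpred S n P \<longleftrightarrow> {x \<in> tuples n. P x} \<in> S n"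

definition defmap :: "(nat \<Rightarrow> 'a list set set) \<Rightarrow> nat \<Rightarrow> nat \<Rightarrow> ('a list \<Rightarrow> 'a list) \<Rightarrow> bool" where
  "defmap S n m t \<longleftrightarrow> (\<forall>x\<in>tuples n. t x \<in> tuples m) \<and> defpred S (n + m) (\<lambda>z. drop n z = t (take n z))"

lemma defpred_cong: "(\<And>x. length x = n \<Longrightarrow> P x = Q x) \<Longrightarrow> defpred S n P = defpred S n Q"
  by (auto simp: defpred_def mem_tuples intro!: arg_cong[where f = "\<lambda>X. X \<in> S n"])

lemma defmap_length: "defmap S n m t \<Longrightarrow> length x = n \<Longrightarrow> length (t x) = m"
  by (simp add: defmap_def mem_tuples)

lemma defmap_cong:
  assumes "\<And>x. length x = n \<Longrightarrow> s x = t x"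
  shows "defmap S n m s = defmap S n m t"
proof -
  have "defpred S (n + m) (\<lambda>z. drop n z = s (take n z)) = defpred S (n + m) (\<lambda>z. drop n z = t (take n z))"
    by (rule defpred_cong) (simp add: assms)
  then show ?thesis using assms by (auto simp: defmap_def mem_tuples)
qed

named_theorems defs

locale tame =
  fixes S :: "nat \<Rightarrow> 'a::linorder list set set"
  assumes str: "is_structure S"
begin

lemma S_subset: "A \<in> S m \<Longrightarrow> A \<subseteq> tuples m"
  using str by (simp add: is_structure_def)

lemma S_lengthD: "A \<in> S m \<Longrightarrow> x \<in> A \<Longrightarrow> length x = m"
  using S_subset mem_tuples by blast

lemma S_empty [defs]: "{} \<in> S m"
  using str by (simp add: is_structure_def)

lemma S_tuples [defs]: "tuples m \<in> S m"
  using str by (simp add: is_structure_def)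

lemma S_Un [defs]: "A \<in> S m \<Longrightarrow> B \<in> S m \<Longrightarrow> A \<union> B \<in> S m"
  using str by (simp add: is_structure_def)

lemma S_compl: "A \<in> S m \<Longrightarrow> tuples m - A \<in> S m"
  using str by (simp add: is_structure_def)

lemma S_Int [defs]:
  assumes "A \<in> S m" "B \<in> S m"
  shows "A \<inter> B \<in> S m"
proof -
  have "A \<inter> B = tuples m - ((tuples m - A) \<union> (tuples m - B))"
    using S_subset assms by auto
  then show ?thesis using assms by (simp add: S_compl S_Un)
qed

lemma S_Diff [defs]:
  assumes "A \<in> S m" "B \<in> S m"
  shows "A - B \<in> S m"
proof -
  have "A - B = A \<inter> (tuples m - B)"
    using S_subset[OF assms(1)] by auto
  then show ?thesis using assms by (simp add: S_compl S_Int)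
qed

lemma S_Cons: "A \<in> S m \<Longrightarrow> {r # x | x r. x \<in> A} \<in> S (Suc m)"
  using str by (simp add: is_structure_def)

lemma S_diag: "i < j \<Longrightarrow> j < m \<Longrightarrow> {x \<in> tuples m. x ! i = x ! j} \<in> S m"
  using str by (simp add: is_structure_def)

lemma S_butlast: "A \<in> S (Suc m) \<Longrightarrow> butlast ` A \<in> S m"
  using str by (simp add: is_structure_def)

lemma S_point1: "{[a]} \<in> S 1"
  using str by (simp add: is_structure_def)

lemma S_less: "{[x, y] | x y. x < y} \<in> S 2"
  using str by (simp add: is_structure_def)

lemma S_prefix:
  assumes "A \<in> S m"
  shows "{x @ y | x y. x \<in> tuples n \<and> y \<in> A} \<in> S (n + m)"
proof (induction n)
  case 0
  then show ?case using assms by simp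
next
  case (Suc n)
  have "{x @ y | x y. x \<in> tuples (Suc n) \<and> y \<in> A}
      = {r # z | z r. z \<in> {x @ y | x y. x \<in> tuples n \<and> y \<in> A}}"
    (is "?L = ?R")
  proof (intro equalityI subsetI)
    fix z assume "z \<in> ?L"
    then obtain r x y where "z = r # (x @ y)" "length x = n" "y \<in> A"
      by (auto simp: mem_tuples length_Suc_conv)
    then show "z \<in> ?R" unfolding mem_tuples by blast
  next
    fix z assume "z \<in> ?R"
    then obtain r x y where "z = (r # x) @ y" "length (r # x) = Suc n" "y \<in> A"
      by (auto simp: mem_tuples)
    then show "z \<in> ?L" unfolding mem_tuples by blast
  qed
  then show ?case using S_Cons[OF Suc] by simp
qed

lemma S_take:
  assumes "A \<in> S (n + m)"
  shows "take n ` A \<in> S n"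
  using assms
proof (induction m arbitrary: A)
  case 0
  then have "take n x = x" if "x \<in> A" for x
    using S_lengthD that by simp
  then have "take n ` A = A" by simp
  then show ?case using 0 by simp
next
  case (Suc m)
  then have "butlast ` A \<in> S (n + m)" by (simp add: S_butlast)
  from Suc.IH[OF this] have "take n ` butlast ` A \<in> S n" .
  moreover have "take n ` butlast ` A = take n ` A"
    using S_lengthD[OF Suc.prems] by (auto simp: image_image butlast_conv_take intro!: image_cong)
  ultimately show ?case by simp
qed

lemma defpred_mem_id: "A \<in> S n \<Longrightarrow> defpred S n (\<lambda>x. x \<in> A)"
  using S_subset[of A n] by (simp add: defpred_def Collect_conj_eq Int_absorb1)

lemma defpred_True [defs]: "defpred S n (\<lambda>x. True)"
  by (simp add: defpred_def S_tuples)

lemma defpred_const [defs]: "defpred S n (\<lambda>x. b)"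
  by (cases b) (simp_all add: defpred_def S_tuples S_empty)

lemma defpred_conj [defs]:
  "defpred S n P \<Longrightarrow> defpred S n Q \<Longrightarrow> defpred S n (\<lambda>x. P x \<and> Q x)"
proof -
  assume "defpred S n P" "defpred S n Q"
  moreover have "{x \<in> tuples n. P x \<and> Q x} = {x \<in> tuples n. P x} \<inter> {x \<in> tuples n. Q x}" by auto
  ultimately show ?thesis by (simp add: defpred_def S_Int)
qed

lemma defpred_not [defs]:
  assumes "defpred S n P" shows "defpred S n (\<lambda>x. \<not> P x)"
proof -
  have "{x \<in> tuples n. \<not> P x} = tuples n - {x \<in> tuples n. P x}" by auto
  then show ?thesis using assms S_compl by (simp add: defpred_def)
qed

lemma defpred_disj [defs]:
  "defpred S n P \<Longrightarrow> defpred S n Q \<Longrightarrow> defpred S n (\<lambda>x. P x \<or> Q x)"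
  using defpred_not[OF defpred_conj[OF defpred_not[of n P] defpred_not[of n Q]]] by simp

lemma defpred_imp [defs]:
  "defpred S n P \<Longrightarrow> defpred S n Q \<Longrightarrow> defpred S n (\<lambda>x. P x \<longrightarrow> Q x)"
  unfolding imp_conv_disj by (intro defpred_disj defpred_not)

lemma defpred_ball_fin:
  assumes "finite I" "\<And>i. i \<in> I \<Longrightarrow> defpred S n (P i)"
  shows "defpred S n (\<lambda>x. \<forall>i\<in>I. P i x)"
  using assms by (induction I) (auto intro: defpred_True defpred_conj)

lemma defpred_bex_fin:
  assumes "finite I" "\<And>i. i \<in> I \<Longrightarrow> defpred S n (P i)"
  shows "defpred S n (\<lambda>x. \<exists>i\<in>I. P i x)"
  using assms by (induction I) (auto intro: defpred_const defpred_disj)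

lemma defpred_all_less [defs]: "(\<And>i. i < (r::nat) \<Longrightarrow> defpred S n (P i)) \<Longrightarrow> defpred S n (\<lambda>x. \<forall>i<r. P i x)"
  using defpred_ball_fin[of "{..<r}" n P] by (simp add: Ball_def)

lemma defpred_ex_less [defs]: "(\<And>i. i < (r::nat) \<Longrightarrow> defpred S n (P i)) \<Longrightarrow> defpred S n (\<lambda>x. \<exists>i<r. P i x)"
  using defpred_bex_fin[of "{..<r}" n P] by (simp add: Bex_def)

text \<open>Quantification is projection: the bound tuple is stored behind the free ones, so that
  under the quantifier \<open>take n z\<close> stands for x and \<open>drop n z\<close> for
  y.\<close>

lemma defpred_ex [defs]:
  assumes "defpred S (n + m) (\<lambda>z. P (take n z) (drop n z))"
  shows "defpred S n (\<lambda>x. \<exists>y\<in>tuples m. P x y)"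
proof -
  have "take n ` {z \<in> tuples (n + m). P (take n z) (drop n z)} = {x \<in> tuples n. \<exists>y\<in>tuples m. P x y}"
  proof (intro equalityI subsetI)
    fix x assume "x \<in> {x \<in> tuples n. \<exists>y\<in>tuples m. P x y}"
    then obtain y where "length x = n" "length y = m" "P x y" by (auto simp: mem_tuples)
    then show "x \<in> take n ` {z \<in> tuples (n + m). P (take n z) (drop n z)}"
      by (intro image_eqI[of _ _ "x @ y"]) (auto simp: mem_tuples)
  qed (auto simp: mem_tuples)
  then show ?thesis using S_take[OF assms[unfolded defpred_def]] by (simp add: defpred_def)
qed

lemma defpred_all [defs]:
  assumes "defpred S (n + m) (\<lambda>z. P (take n z) (drop n z))"
  shows "defpred S n (\<lambda>x. \<forall>y\<in>tuples m. P x y)"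
  using defpred_not[OF defpred_ex[OF defpred_not[OF assms]]] by simp

lemma defpred_diag: "i < n \<Longrightarrow> j < n \<Longrightarrow> defpred S n (\<lambda>z. z ! i = z ! j)"
proof (cases i j rule: linorder_cases)
  case less
  assume "j < n" then show ?thesis using S_diag[OF less] by (simp add: defpred_def)
next
  case greater
  assume "i < n" then show ?thesis using S_diag[OF greater] by (simp add: defpred_def eq_commute)
qed (simp add: defpred_True)

text \<open>Only equations between coordinates are involved. Permuting, repeating and forgetting
  variables all come from this map; of these operations the axioms of a structure offer only adding
  a coordinate at either end and removing the last one.\<close>

lemma defmap_nths:
  assumes "set js \<subseteq> {..<n}"
  shows "defmap S n (length js) (\<lambda>z. map ((!) z) js)"
proof -
  have "defpred S (n + length js) (\<lambda>z. \<forall>j<length js. z ! (n + j) = z ! (js ! j))"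
    using assms by (intro defpred_all_less defpred_diag) (auto dest!: nth_mem)
  moreover have "defpred S (n + length js) (\<lambda>z. \<forall>j<length js. z ! (n + j) = z ! (js ! j)) =
    defpred S (n + length js) (\<lambda>z. drop n z = map ((!) (take n z)) js)"
  proof (rule defpred_cong)
    fix z :: "'a list" assume z: "length z = n + length js"
    have e: "map ((!) (take n z)) js = map ((!) z) js" using assms by auto
    show "(\<forall>j<length js. z ! (n + j) = z ! (js ! j)) = (drop n z = map ((!) (take n z)) js)"
      unfolding e by (subst list_eq_iff_nth_eq) (use z in simp)
  qed
  ultimately show ?thesis by (simp add: defmap_def mem_tuples)
qed

text \<open>Substituting a definable map costs one quantifier: some y satisfies
  \<open>y = t x\<close> and lies in \<open>A\<close>.\<close>

lemma defpred_mem [defs]: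
  assumes A: "A \<in> S m" and t: "defmap S n m t"
  shows "defpred S n (\<lambda>x. t x \<in> A)"
proof -
  have "{x @ y |x y. x \<in> tuples n \<and> y \<in> A} = {z \<in> tuples (n + m). drop n z \<in> A}"
    (is "?L = ?R")
  proof (intro equalityI subsetI)
    fix z assume "z \<in> ?R"
    then have "z = take n z @ drop n z" "length (take n z) = n" "drop n z \<in> A"
      by (auto simp: mem_tuples)
    then show "z \<in> ?L" unfolding mem_tuples by blast
  qed (use S_lengthD[OF A] in \<open>auto simp: mem_tuples\<close>)
  then have "defpred S (n + m) (\<lambda>z. drop n z \<in> A)"
    using S_prefix[OF A, of n] by (simp add: defpred_def)
  then have "defpred S (n + m) (\<lambda>z. drop n z = t (take n z) \<and> drop n z \<in> A)"
    using t by (intro defpred_conj) (auto simp: defmap_def)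
  from defpred_ex[OF this] have "defpred S n (\<lambda>x. \<exists>y\<in>tuples m. y = t x \<and> y \<in> A)" .
  moreover have "defpred S n (\<lambda>x. \<exists>y\<in>tuples m. y = t x \<and> y \<in> A) = defpred S n (\<lambda>x. t x \<in> A)"
    using S_lengthD[OF A] by (intro defpred_cong) (auto simp: mem_tuples)
  ultimately show ?thesis by simp
qed

lemma defpred_subst: "defpred S m P \<Longrightarrow> defmap S n m t \<Longrightarrow> defpred S n (\<lambda>x. P (t x))"
  using defpred_mem[of "{x \<in> tuples m. P x}" m n t] defpred_cong[of n "\<lambda>x. t x \<in> {x \<in> tuples m. P x}" "\<lambda>x. P (t x)"]
  by (auto simp: defpred_def mem_tuples defmap_length)

lemma defpred_nths:
  assumes "defpred S m P" "set js \<subseteq> {..<n}" "length js = m"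
    "\<And>z. length z = n \<Longrightarrow> Q z = P (map ((!) z) js)"
  shows "defpred S n Q"
  using defpred_subst[OF assms(1) defmap_nths[OF assms(2), unfolded assms(3)]]
    defpred_cong[of n Q "\<lambda>z. P (map ((!) z) js)"] assms(4) by simp

lemma map_nth_upt: "b \<le> length z \<Longrightarrow> map ((!) z) [a..<b] = drop a (take b z)"
  by (auto simp: list_eq_iff_nth_eq)

lemma defmap_comp:
  assumes "defmap S n k t" "defmap S k l s"
  shows "defmap S n l (\<lambda>x. s (t x))"
proof -
  have 1: "defpred S (n + l + k) (\<lambda>w. drop (n + l) w = t (take n w))"
    by (rule defpred_nths[OF assms(1)[unfolded defmap_def, THEN conjunct2], of "[0..<n] @ [n+l..<n+l+k]"])
      (auto simp: map_nth_upt)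
  have 2: "defpred S (n + l + k) (\<lambda>w. drop n (take (n + l) w) = s (drop (n + l) w))"
    by (rule defpred_nths[OF assms(2)[unfolded defmap_def, THEN conjunct2], of "[n+l..<n+l+k] @ [n..<n+l]"])
      (auto simp: map_nth_upt)
  have "defpred S (n + l) (\<lambda>z. \<exists>y\<in>tuples k. y = t (take n z) \<and> drop n z = s y)"
    by (intro defpred_ex defpred_conj) (use 1 2 in simp_all)
  moreover have "defpred S (n + l) (\<lambda>z. \<exists>y\<in>tuples k. y = t (take n z) \<and> drop n z = s y)
     = defpred S (n + l) (\<lambda>z. drop n z = s (t (take n z)))"
    using assms by (intro defpred_cong) (auto simp: mem_tuples defmap_length)
  ultimately show ?thesis using assms by (auto simp: defmap_def)
qed

lemma defmap_id [defs]: "defmap S n n (\<lambda>z. z)"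
proof -
  have "defmap S n (length [0..<n]) (\<lambda>z. map ((!) z) [0..<n])"
    by (rule defmap_nths) auto
  then have "defmap S n n (\<lambda>z. map ((!) z) [0..<n])" by simp
  then show ?thesis
    by (rule defmap_cong[THEN iffD1, rotated]) (use map_nth in auto)
qed

lemma defmap_take0 [defs]: "defmap S (n + m) n (take n)"
proof -
  have "defmap S (n + m) (length [0..<n]) (\<lambda>z. map ((!) z) [0..<n])"
    by (rule defmap_nths) auto
  then have "defmap S (n + m) n (\<lambda>z. map ((!) z) [0..<n])" by simp
  then show ?thesis
    by (rule defmap_cong[THEN iffD1, rotated]) (simp add: map_nth_upt)
qed

lemma defmap_drop [defs]: "defmap S (n + m) m (\<lambda>z. drop n z)"
proof -
  have "defmap S (n + m) (length [n..<n + m]) (\<lambda>z. map ((!) z) [n..<n + m])"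
    by (rule defmap_nths) auto
  then have "defmap S (n + m) m (\<lambda>z. map ((!) z) [n..<n + m])" by simp
  then show ?thesis
    by (rule defmap_cong[THEN iffD1, rotated]) (simp add: map_nth_upt)
qed

lemma defmap_take [defs]: "defmap S n k t \<Longrightarrow> defmap S (n + m) k (\<lambda>z. t (take n z))"
  by (rule defmap_comp[OF defmap_take0])

lemma defmap_map_nth [defs]:
  "defmap S n k t \<Longrightarrow> set js \<subseteq> {..<k} \<Longrightarrow> defmap S n (length js) (\<lambda>z. map ((!) (t z)) js)"
  using defmap_comp[of n k t "length js" "\<lambda>z. map ((!) z) js"] defmap_nths by blast

lemma defmap_append [defs]:
  assumes "defmap S n k s" "defmap S n l t"
  shows "defmap S n (k + l) (\<lambda>z. s z @ t z)"
proof -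
  have "defpred S (n + (k + l)) (\<lambda>w. drop n (take (n + k) w) = s (take n w))"
    by (rule defpred_nths[OF assms(1)[unfolded defmap_def, THEN conjunct2], of "[0..<n+k]"])
      (auto simp: map_nth_upt)
  moreover have "defpred S (n + (k + l)) (\<lambda>w. drop (n + k) w = t (take n w))"
    by (rule defpred_nths[OF assms(2)[unfolded defmap_def, THEN conjunct2], of "[0..<n] @ [n+k..<n+k+l]"])
      (auto simp: map_nth_upt)
  ultimately have "defpred S (n + (k + l)) (\<lambda>w. drop n (take (n + k) w) = s (take n w) \<and> drop (n + k) w = t (take n w))"
    by (rule defpred_conj)
  moreover have "defpred S (n + (k + l)) (\<lambda>w. drop n (take (n + k) w) = s (take n w) \<and> drop (n + k) w = t (take n w))
    = defpred S (n + (k + l)) (\<lambda>w. drop n w = s (take n w) @ t (take n w))"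
  proof (rule defpred_cong)
    fix w :: "'a list" assume w: "length w = n + (k + l)"
    have "drop n w = drop n (take (n + k) w) @ drop (n + k) w"
      by (metis add.commute append_take_drop_id drop_drop drop_take add_diff_cancel_left')
    moreover have "length (drop n (take (n + k) w)) = length (s (take n w))"
      using w assms(1) by (simp add: defmap_length)
    ultimately show "(drop n (take (n + k) w) = s (take n w) \<and> drop (n + k) w = t (take n w)) =
      (drop n w = s (take n w) @ t (take n w))" by simp
  qed
  ultimately show ?thesis using assms by (auto simp: defmap_def mem_tuples)
qed

lemma defpred_eq [defs]:
  assumes "defmap S n k s" "defmap S n k t"
  shows "defpred S n (\<lambda>z. s z = t z)"
proof -
  have "defpred S (k + k) (\<lambda>z. drop k z = take k z)"
    using defmap_id[of k] by (simp add: defmap_def)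
  from defpred_subst[OF this defmap_append[OF assms(2) assms(1)]]
  have "defpred S n (\<lambda>x. drop k (t x @ s x) = take k (t x @ s x))" .
  then show ?thesis using assms defpred_cong[of n "\<lambda>x. drop k (t x @ s x) = take k (t x @ s x)" "\<lambda>x. s x = t x"]
    by (simp add: defmap_length)
qed

lemma defpred_less: "i < n \<Longrightarrow> j < n \<Longrightarrow> defpred S n (\<lambda>z. z ! i < z ! j)"
proof -
  assume "i < n" "j < n"
  moreover have "defpred S 2 (\<lambda>z. z \<in> {[x, y] | x y. x < y})"
    using defpred_mem_id[OF S_less] .
  ultimately show ?thesis by (elim defpred_nths[where js = "[i, j]"]) auto
qed

lemma defmap_const [defs]:
  assumes "length c = m" shows "defmap S n m (\<lambda>z. c)"
proof -
  have "defpred S (n + m) (\<lambda>z. \<forall>j<m. [z ! (n + j)] \<in> {[c ! j]})"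
  proof (rule defpred_all_less)
    fix j assume "j < m"
    have "defpred S 1 (\<lambda>z. z \<in> {[c ! j]})" by (rule defpred_mem_id[OF S_point1])
    then show "defpred S (n + m) (\<lambda>z. [z ! (n + j)] \<in> {[c ! j]})"
      by (rule defpred_nths[where js = "[n + j]"]) (use \<open>j < m\<close> in auto)
  qed
  moreover have "defpred S (n + m) (\<lambda>z. \<forall>j<m. [z ! (n + j)] \<in> {[c ! j]}) = defpred S (n + m) (\<lambda>z. drop n z = c)"
    using assms by (intro defpred_cong) (simp add: list_eq_iff_nth_eq)
  ultimately show ?thesis using assms by (simp add: defmap_def mem_tuples)
qed

lemma S_box_graph: "defpred S (m + m + m) (\<lambda>z. drop (m + m) z \<in> box (take m z) (drop m (take (m + m) z)))"
proof -
  have "defpred S (m + m + m) (\<lambda>z. \<forall>i<m. z ! i < z ! (m + m + i) \<and> z ! (m + m + i) < z ! (m + i))"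
    by (intro defpred_all_less defpred_conj defpred_less) auto
  then show ?thesis
    by (rule defpred_cong[THEN iffD1, rotated]) (auto simp: box_def)
qed

lemma defpred_box [defs]:
  assumes "defmap S n m a" "defmap S n m b" "defmap S n m x"
  shows "defpred S n (\<lambda>z. x z \<in> box (a z) (b z))"
  using defpred_subst[OF S_box_graph defmap_append[OF defmap_append[OF assms(1,2)] assms(3)]]
  by (rule defpred_cong[THEN iffD1, rotated]) (use assms in \<open>auto simp: defmap_length\<close>)

lemma defpred_bex [defs]:
  assumes "A \<in> S m" "defpred S (n + m) (\<lambda>z. P (take n z) (drop n z))"
  shows "defpred S n (\<lambda>x. \<exists>y\<in>A. P x y)"
proof -
  have "defpred S n (\<lambda>x. \<exists>y\<in>tuples m. y \<in> A \<and> P x y)"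
    by (rule defpred_ex defpred_conj defpred_mem assms defmap_drop)+
  moreover have "defpred S n (\<lambda>x. \<exists>y\<in>tuples m. y \<in> A \<and> P x y) = defpred S n (\<lambda>x. \<exists>y\<in>A. P x y)"
    using S_subset[OF assms(1)] by (intro defpred_cong) auto
  ultimately show ?thesis by simp
qed

lemma defpred_ball [defs]:
  assumes "A \<in> S m" "defpred S (n + m) (\<lambda>z. P (take n z) (drop n z))"
  shows "defpred S n (\<lambda>x. \<forall>y\<in>A. P x y)"
  using defpred_not[OF defpred_bex[OF assms(1) defpred_not[OF assms(2)]]] by simp

lemma S_Collect [defs]:
  assumes "A \<in> S n" "defpred S n P"
  shows "{x \<in> A. P x} \<in> S n"
proof -
  have "{x \<in> A. P x} = A \<inter> {x \<in> tuples n. P x}"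
    using S_subset[OF assms(1)] by auto
  then show ?thesis using S_Int[OF assms[unfolded defpred_def]] by simp
qed

lemma S_image [defs]:
  assumes "A \<in> S n" "defmap S n m t"
  shows "t ` A \<in> S m"
proof -
  have "defpred S m (\<lambda>y. \<exists>x\<in>A. y = t x)"
    by (rule defpred_bex defpred_eq assms defmap_take0 defmap_comp[OF defmap_drop])+
  moreover have "{y \<in> tuples m. \<exists>x\<in>A. y = t x} = t ` A"
    using S_lengthD[OF assms(1)] defmap_length[OF assms(2)] by (auto simp: mem_tuples)
  ultimately show ?thesis by (simp add: defpred_def)
qed

lemma S_pairs:
  assumes "defpred S (n + m) (\<lambda>z. P (take n z) (drop n z))"
  shows "{x @ y | x y. length x = n \<and> length y = m \<and> P x y} \<in> S (n + m)"
proof -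
  have "{x @ y | x y. length x = n \<and> length y = m \<and> P x y} = {z \<in> tuples (n + m). P (take n z) (drop n z)}"
    (is "?L = ?R")
  proof (intro equalityI subsetI)
    fix z assume "z \<in> ?R"
    then have "z = take n z @ drop n z" "length (take n z) = n" "length (drop n z) = m"
      "P (take n z) (drop n z)" by (auto simp: mem_tuples)
    then show "z \<in> ?L" by blast
  qed (auto simp: mem_tuples)
  then show ?thesis using assms by (simp add: defpred_def)
qed

lemma defmap_take_of [defs]: "defmap S n (k + l) t \<Longrightarrow> defmap S n k (\<lambda>z. take k (t z))"
  by (rule defmap_comp[OF _ defmap_take0])

lemma defmap_drop_of [defs]: "defmap S n (k + l) t \<Longrightarrow> defmap S n l (\<lambda>z. drop k (t z))"
  by (rule defmap_comp[OF _ defmap_drop])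

lemma defpred_subst2:
  assumes "defpred S (n + m) (\<lambda>z. P (take n z) (drop n z))" "defmap S l n s" "defmap S l m t"
  shows "defpred S l (\<lambda>z. P (s z) (t z))"
  using defpred_subst[OF assms(1) defmap_append[OF assms(2,3)]]
  by (rule defpred_cong[THEN iffD1, rotated]) (use assms in \<open>simp add: defmap_length\<close>)

lemma S_fiber:
  assumes "defpred S (n + m) (\<lambda>z. P (take n z) (drop n z))" "length x = n"
  shows "{y \<in> tuples m. P x y} \<in> S m"
proof -
  have "defmap S m (n + m) (\<lambda>y. x @ y)"
    by (rule defs assms)+
  from defpred_subst[OF assms(1) this] show ?thesis
    using assms(2) by (simp add: defpred_def)
qed

lemma S_cl:
  assumes "X \<in> S n" shows "cl n X \<in> S n"
proof -
  have "defpred S n (\<lambda>x. \<forall>a\<in>tuples n. \<forall>b\<in>tuples n. x \<in> box a b \<longrightarrow> (\<exists>y\<in>X. y \<in> box a b))"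
    by (rule defs assms)+
  moreover have "{x \<in> tuples n. \<forall>a\<in>tuples n. \<forall>b\<in>tuples n. x \<in> box a b \<longrightarrow> (\<exists>y\<in>X. y \<in> box a b)} = cl n X"
    unfolding cl_def tuples_def by blast
  ultimately show ?thesis by (simp add: defpred_def)
qed

lemma S_box [defs]: "length a = n \<Longrightarrow> length b = n \<Longrightarrow> box a b \<in> S n"
proof -
  assume ab: "length a = n" "length b = n"
  have "defpred S n (\<lambda>y. y \<in> box a b)"
    by (rule defpred_box defmap_const ab defmap_id)+
  moreover have "{y \<in> tuples n. y \<in> box a b} = box a b" using ab by (auto simp: mem_tuples box_def)
  ultimately show ?thesis by (simp add: defpred_def)
qed

end

subsection \<open>Boxes\<close>

definition nhd :: "nat \<Rightarrow> 'a::linorder list \<Rightarrow> 'a list set \<Rightarrow> bool" where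
  "nhd n x U \<longleftrightarrow> (\<exists>a b. length a = n \<and> length b = n \<and> x \<in> box a b \<and> box a b \<subseteq> U)"

lemma mem_box: "x \<in> box a b \<longleftrightarrow> length x = length a \<and> (\<forall>i<length a. a ! i < x ! i \<and> x ! i < b ! i)"
  by (simp add: box_def)

lemma nhd_mono: "nhd n x U \<Longrightarrow> U \<subseteq> V \<Longrightarrow> nhd n x V"
  unfolding nhd_def by blast

lemma nhd_box: "length a = n \<Longrightarrow> length b = n \<Longrightarrow> x \<in> box a b \<Longrightarrow> nhd n x (box a b)"
  unfolding nhd_def by blast

lemma nhd_Int: "nhd n x U \<Longrightarrow> nhd n x V \<Longrightarrow> nhd n x (U \<inter> V)"
proof -
  assume "nhd n x U" "nhd n x V"
  then obtain a b c d where *: "length a = n" "length b = n" "x \<in> box a b" "box a b \<subseteq> U"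
      "length c = n" "length d = n" "x \<in> box c d" "box c d \<subseteq> V"
    unfolding nhd_def by blast
  let ?p = "map2 max a c" and ?q = "map2 min b d"
  have "x \<in> box ?p ?q" "box ?p ?q \<subseteq> box a b" "box ?p ?q \<subseteq> box c d" "length ?p = n" "length ?q = n"
    using * by (auto simp: mem_box)
  then show ?thesis using * unfolding nhd_def by blast
qed

lemma nhd_point_mem: "nhd n x U \<Longrightarrow> x \<in> U"
  unfolding nhd_def by blast

lemma nhd_tuples:
  fixes x :: "'a::{linorder, no_top, no_bot} list"
  assumes "length x = n"
  shows "nhd n x (tuples n)"
proof -
  have "x \<in> box (map (\<lambda>u. SOME v. v < u) x) (map (\<lambda>u. SOME v. u < v) x)"
    by (auto simp: mem_box intro: someI_ex lt_ex gt_ex)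
  then show ?thesis using assms unfolding nhd_def
    by (intro exI[of _ "map (\<lambda>u. SOME v. v < u) x"] exI[of _ "map (\<lambda>u. SOME v. u < v) x"])
      (auto simp: mem_box mem_tuples)
qed

lemma nhd_all_less:
  fixes x :: "'a::{linorder, no_top, no_bot} list"
  assumes "length x = n" "\<And>j. j < (r::nat) \<Longrightarrow> nhd n x (U j)"
  shows "nhd n x {y \<in> tuples n. \<forall>j<r. y \<in> U j}"
  using assms(2)
proof (induction r)
  case 0
  then show ?case using nhd_tuples[OF assms(1)] by simp
next
  case (Suc r)
  then have "nhd n x ({y \<in> tuples n. \<forall>j<r. y \<in> U j} \<inter> U r)" by (intro nhd_Int) auto
  then show ?case by (rule nhd_mono) (auto simp: less_Suc_eq)
qed

lemma nhd_nth_greater: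
  fixes x :: "'a::{linorder, no_top, no_bot} list"
  assumes "length x = n" "i < n" "c < x ! i"
  shows "nhd n x {y. c < y ! i}"
proof -
  obtain a b where ab: "length a = n" "length b = n" "x \<in> box a b"
    using nhd_tuples[OF assms(1)] by (auto simp: nhd_def)
  then have "x \<in> box (a[i := c]) b" using assms by (auto simp: mem_box nth_list_update)
  moreover have "box (a[i := c]) b \<subseteq> {y. c < y ! i}"
    using ab assms by (auto simp: mem_box dest!: spec[of _ i])
  ultimately show ?thesis using ab unfolding nhd_def by (metis length_list_update)
qed

lemma nhd_nth_less:
  fixes x :: "'a::{linorder, no_top, no_bot} list"
  assumes "length x = n" "i < n" "x ! i < c"
  shows "nhd n x {y. y ! i < c}"
proof -
  obtain a b where ab: "length a = n" "length b = n" "x \<in> box a b"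
    using nhd_tuples[OF assms(1)] by (auto simp: nhd_def)
  then have "x \<in> box a (b[i := c])" using assms by (auto simp: mem_box nth_list_update)
  moreover have "box a (b[i := c]) \<subseteq> {y. y ! i < c}"
    using ab assms by (auto simp: mem_box dest!: spec[of _ i])
  ultimately show ?thesis using ab unfolding nhd_def by (metis length_list_update)
qed

lemma nhd_map_nth:
  fixes x :: "'a::{linorder, no_top, no_bot} list"
  assumes "length x = n" "set js \<subseteq> {..<n}" "map ((!) x) js \<in> box p q"
  shows "nhd n x {y. map ((!) y) js \<in> box p q}"
proof -
  have "nhd n x ({y. p ! j < y ! (js ! j)} \<inter> {y. y ! (js ! j) < q ! j})" if "j < length js" for j
  proof -
    have "js ! j < n" using assms(2) that nth_mem by blast
    moreover have "p ! j < x ! (js ! j)" "x ! (js ! j) < q ! j"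
      using assms(3) that by (auto simp: mem_box)
    ultimately show ?thesis using assms(1) by (intro nhd_Int nhd_nth_less nhd_nth_greater) auto
  qed
  then have "nhd n x {y \<in> tuples n. \<forall>j<length js. y \<in> {y. p ! j < y ! (js ! j)} \<inter> {y. y ! (js ! j) < q ! j}}"
    by (rule nhd_all_less[OF assms(1)])
  then show ?thesis using assms(3) by (elim nhd_mono) (auto simp: mem_box)
qed

lemma nhd_separate:
  fixes x :: "'a::{linorder, no_top, no_bot} list"
  assumes "finite F" "length x = n"
  shows "nhd n x {y. y \<in> F \<longrightarrow> y = x}"
  using assms(1)
proof induction
  case empty
  then show ?case using nhd_mono[OF nhd_tuples[OF assms(2)]] by auto
next
  case (insert w F)
  have "nhd n x {y. y = w \<longrightarrow> y = x}"
  proof (cases "length w = n \<and> w \<noteq> x")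
    case True
    then obtain i where i: "i < n" "w ! i \<noteq> x ! i" using assms(2) by (metis nth_equalityI)
    then consider "w ! i < x ! i" | "x ! i < w ! i" by fastforce
    then show ?thesis
    proof cases
      case 1
      show ?thesis by (rule nhd_mono[OF nhd_nth_greater[OF assms(2) i(1) 1]]) auto
    next
      case 2
      show ?thesis by (rule nhd_mono[OF nhd_nth_less[OF assms(2) i(1) 2]]) auto
    qed
  next
    case False
    show ?thesis by (rule nhd_mono[OF nhd_tuples[OF assms(2)]]) (use False in \<open>auto simp: mem_tuples\<close>)
  qed
  from nhd_Int[OF this insert.IH] show ?case by (rule nhd_mono) auto
qed

lemma box_append:
  assumes "length x = length a" "length b = length a"
  shows "x @ y \<in> box (a @ c) (b @ d) \<longleftrightarrow> x \<in> box a b \<and> y \<in> box c d"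
proof
  assume *: "x @ y \<in> box (a @ c) (b @ d)"
  then have 1: "(a @ c) ! i < (x @ y) ! i \<and> (x @ y) ! i < (b @ d) ! i" if "i < length a + length c" for i
    using that by (simp add: mem_box)
  have "a ! i < x ! i \<and> x ! i < b ! i" if "i < length a" for i
    using 1[of i] that assms by (simp add: nth_append)
  then have "x \<in> box a b" using assms by (simp add: mem_box)
  moreover have "c ! i < y ! i \<and> y ! i < d ! i" if "i < length c" for i
    using 1[of "length a + i"] that assms by (simp add: nth_append)
  then have "y \<in> box c d" using * assms by (simp add: mem_box)
  ultimately show "x \<in> box a b \<and> y \<in> box c d" ..
qed (use assms in \<open>auto simp: mem_box nth_append\<close>)

lemma box_appendE:
  assumes "length a = n + m" "length b = n + m"
  obtains a1 a2 b1 b2 where "a = a1 @ a2" "b = b1 @ b2" "length a1 = n" "length b1 = n"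
    "length a2 = m" "length b2 = m"
proof
  show "a = take n a @ drop n a" "b = take n b @ drop n b" by simp_all
qed (use assms in auto)

lemma has_interior_iff_nhd: "has_interior n A \<longleftrightarrow> (\<exists>x\<in>A. nhd n x A)"
  unfolding has_interior_def nhd_def by blast

lemma has_interior_mono: "has_interior n A \<Longrightarrow> A \<subseteq> B \<Longrightarrow> has_interior n B"
  unfolding has_interior_iff_nhd using nhd_mono by blast

lemma has_interior_box: "length a = n \<Longrightarrow> length b = n \<Longrightarrow> x \<in> box a b \<Longrightarrow> has_interior n (box a b)"
  unfolding has_interior_def by blast

lemma open_tuples_iff_nhd: "open_tuples n A \<longleftrightarrow> A \<subseteq> tuples n \<and> (\<forall>x\<in>A. nhd n x A)"
  unfolding open_tuples_def nhd_def ..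

lemma mem_cl_iff_nhd: "x \<in> cl n X \<longleftrightarrow> length x = n \<and> (\<forall>U. nhd n x U \<longrightarrow> U \<inter> X \<noteq> {})"
  unfolding cl_def nhd_def mem_tuples[symmetric] by blast

lemma subset_cl: "X \<subseteq> tuples n \<Longrightarrow> X \<subseteq> cl n X"
  using mem_cl_iff_nhd nhd_point_mem by (fastforce simp: mem_tuples)

subsection \<open>The o-minimal dimension\<close>

definition idx :: "nat \<Rightarrow> nat list set" where
  "idx n = {js. sorted_wrt (<) js \<and> set js \<subseteq> {..<n}}"

lemma idx_length: "js \<in> idx n \<Longrightarrow> length js \<le> n"
proof -
  assume "js \<in> idx n"
  then have "distinct js" "set js \<subseteq> {..<n}" by (auto simp: idx_def strict_sorted_iff)
  then show ?thesis by (metis card_lessThan card_mono distinct_card finite_lessThan)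
qed

lemma finite_idx: "finite (idx n)"
proof (rule finite_subset)
  show "idx n \<subseteq> {js. set js \<subseteq> {..<n} \<and> length js \<le> n}"
    using idx_length by (auto simp: idx_def)
qed (simp add: finite_lists_length_le)

lemma idx_full: "js \<in> idx n \<Longrightarrow> length js = n \<Longrightarrow> js = [0..<n]"
proof -
  assume *: "js \<in> idx n" "length js = n"
  then have "distinct js" "sorted js" "set js \<subseteq> {..<n}" by (auto simp: idx_def strict_sorted_iff)
  then have "set js = {..<n}" using * by (metis card_lessThan card_subset_eq distinct_card finite_lessThan)
  then have "js = sorted_list_of_set {0..<n}"
    using \<open>distinct js\<close> \<open>sorted js\<close> by (metis lessThan_atLeast0 sorted_list_of_set.idem_if_sorted_distinct)
  then show ?thesis by simp
qed

lemma omin_dim_alt: "omin_dim n A = (if A = {} then None else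
  Some (Max (length ` {js \<in> idx n. has_interior (length js) ((\<lambda>x. map ((!) x) js) ` A)})))"
  unfolding omin_dim_def idx_def
  by (auto intro!: arg_cong[where f = Max])

lemma has_interior_0: "has_interior 0 {[]}"
  by (auto simp: has_interior_def mem_box box_def)

lemma omin_dim_ge:
  assumes "js \<in> idx n" "has_interior (length js) ((\<lambda>x. map ((!) x) js) ` A)"
  shows "Some (length js) \<le> omin_dim n A"
proof -
  have "A \<noteq> {}" using assms(2) by (auto simp: has_interior_def)
  then show ?thesis unfolding omin_dim_alt using assms finite_idx[of n] by (auto intro!: Max_ge)
qed

lemma omin_dim_attained:
  assumes "omin_dim n A = Some d"
  obtains js where "js \<in> idx n" "length js = d" "has_interior d ((\<lambda>x. map ((!) x) js) ` A)"
proof -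
  let ?L = "length ` {js \<in> idx n. has_interior (length js) ((\<lambda>x. map ((!) x) js) ` A)}"
  have A: "A \<noteq> {}" using assms by (auto simp: omin_dim_alt)
  \<comment> \<open>The projection to no coordinates has image \<open>{[]}\<close>, which has
    interior in M^0; hence \<open>Max\<close> is taken over a nonempty set.\<close>
  then have "[] \<in> idx n" "(\<lambda>x. map ((!) x) []) ` A = {[]}" by (auto simp: idx_def)
  then have "0 \<in> ?L" using has_interior_0 by (force simp: image_iff)
  then have "Max ?L \<in> ?L" using finite_idx[of n] by (intro Max_in) auto
  moreover have "Max ?L = d" using assms A by (simp add: omin_dim_alt)
  ultimately show thesis using that by auto
qed

lemma omin_dim_full: 
  assumes "A \<subseteq> tuples n" 
  shows "Some n \<le> omin_dim n A \<longleftrightarrow> has_interior n A"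
proof -
  have id: "(\<lambda>x. map ((!) x) [0..<n]) ` A = A"
    using assms by (force simp: mem_tuples map_nth image_iff subset_iff)
  show ?thesis
  proof
    assume "Some n \<le> omin_dim n A"
    then obtain d where d: "omin_dim n A = Some d" "n \<le> d" by (cases "omin_dim n A") auto
    then obtain js where js: "js \<in> idx n" "length js = d" "has_interior d ((\<lambda>x. map ((!) x) js) ` A)"
      using omin_dim_attained by blast
    then show "has_interior n A" using idx_full[of js n] idx_length[of js n] d id by auto
  next
    assume "has_interior n A"
    moreover have "[0..<n] \<in> idx n" by (auto simp: idx_def)
    ultimately show "Some n \<le> omin_dim n A" using omin_dim_ge[of "[0..<n]" n A] id by simp
  qed
qed

lemma omin_dim_less_iff:
  "omin_dim n A < Some d \<longleftrightarrow> (\<forall>js\<in>idx n. d \<le> length js \<longrightarrow> \<not> has_interior (length js) ((\<lambda>x. map ((!) x) js) ` A))"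
proof
  assume "omin_dim n A < Some d"
  then show "\<forall>js\<in>idx n. d \<le> length js \<longrightarrow> \<not> has_interior (length js) ((\<lambda>x. map ((!) x) js) ` A)"
    using omin_dim_ge by (metis leD less_eq_option_Some order_less_le_trans)
next
  assume *: "\<forall>js\<in>idx n. d \<le> length js \<longrightarrow> \<not> has_interior (length js) ((\<lambda>x. map ((!) x) js) ` A)"
  show "omin_dim n A < Some d"
  proof (cases "omin_dim n A")
    case (Some e)
    then show ?thesis using omin_dim_attained[OF Some] * by (metis less_option_Some not_le)
  qed simp
qed

subsection \<open>Additivity of dimension\<close>

locale tame_pair =
  fixes SM SN :: "nat \<Rightarrow> 'a::{dense_linorder, no_top, no_bot} list set set"
    and dim :: "'a list set \<Rightarrow> nat option"
  assumes omin: "o_minimal SM"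
    and expan: "expansion SN SM"
    and open_SM: "\<forall>m A. A \<in> SN m \<and> open_tuples m A \<longrightarrow> A \<in> SM m"
    and dimf: "dimension_function SN SM dim"
begin

sublocale M: tame SM
  using omin by unfold_locales (simp add: o_minimal_def)

sublocale N: tame SN
  using expan by unfold_locales (simp add: expansion_def)

lemma SN_I: "A \<in> SM n \<Longrightarrow> A \<in> SN n"
  using expan by (auto simp: expansion_def)

lemma dim_point1: "dim {[a]} = Some 0"
  using dimf unfolding dimension_function_def by (elim conjE) auto

lemma dim_None: "X \<in> SN n \<Longrightarrow> dim X = None \<longleftrightarrow> X = {}"
  using dimf unfolding dimension_function_def by (elim conjE) auto

lemma dim_empty [simp]: "dim {} = None"
  using dim_None[OF N.S_empty] by simp

lemma dim_Un: "X \<in> SN n \<Longrightarrow> Y \<in> SN n \<Longrightarrow> dim (X \<union> Y) = max (dim X) (dim Y)"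
  using dimf unfolding dimension_function_def by (elim conjE) blast

lemma dim_family:
  assumes "I \<in> SN m" "F \<in> SN (m + n)"
    and "\<And>t t'. t \<in> I \<Longrightarrow> t' \<in> I \<Longrightarrow> t \<noteq> t' \<Longrightarrow> {x \<in> tuples n. t @ x \<in> F} \<inter> {x \<in> tuples n. t' @ x \<in> F} = {}"
  shows "{t \<in> I. dim {x \<in> tuples n. t @ x \<in> F} = d} \<in> SN m"
    and "(\<And>t. t \<in> I \<Longrightarrow> dim {x \<in> tuples n. t @ x \<in> F} = Some k) \<Longrightarrow>
      dim (\<Union>t\<in>I. {x \<in> tuples n. t @ x \<in> F}) = map_option (\<lambda>d. d + k) (dim I)"
proof -
  have "\<forall>m n I F. I \<in> SN m \<longrightarrow> F \<in> SN (m + n) \<longrightarrow>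
        (let X = (\<lambda>t. {x \<in> tuples n. t @ x \<in> F}) in
          (\<forall>t\<in>I. \<forall>t'\<in>I. t \<noteq> t' \<longrightarrow> X t \<inter> X t' = {}) \<longrightarrow>
          (\<forall>d. {t \<in> I. dim (X t) = d} \<in> SN m)
          \<and> (\<forall>k::nat. (\<forall>t\<in>I. dim (X t) = Some k) \<longrightarrow>
                dim (\<Union>t\<in>I. X t) = map_option (\<lambda>d. d + k) (dim I)))"
    using dimf unfolding dimension_function_def by (elim conjE)
  from this[rule_format, OF assms(1,2), unfolded Let_def] assms(3)
  have *: "(\<forall>d. {t \<in> I. dim {x \<in> tuples n. t @ x \<in> F} = d} \<in> SN m) \<and>
    (\<forall>k. (\<forall>t\<in>I. dim {x \<in> tuples n. t @ x \<in> F} = Some k) \<longrightarrow>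
      dim (\<Union>t\<in>I. {x \<in> tuples n. t @ x \<in> F}) = map_option (\<lambda>d. d + k) (dim I))"
    by blast
  show "{t \<in> I. dim {x \<in> tuples n. t @ x \<in> F} = d} \<in> SN m" using * by blast
  show "dim (\<Union>t\<in>I. {x \<in> tuples n. t @ x \<in> F}) = map_option (\<lambda>d. d + k) (dim I)"
    if "\<And>t. t \<in> I \<Longrightarrow> dim {x \<in> tuples n. t @ x \<in> F} = Some k"
    using * that by blast
qed

lemma dim_bij: "X \<in> SN n \<Longrightarrow> Y \<in> SN m \<Longrightarrow> bij_betw f X Y \<Longrightarrow> {x @ f x | x. x \<in> X} \<in> SN (n + m) \<Longrightarrow> dim X = dim Y"
proof -
  have "\<forall>n m X Y f. X \<in> SN n \<longrightarrow> Y \<in> SN m \<longrightarrow> bij_betw f X Y \<longrightarrow>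
        {x @ f x | x. x \<in> X} \<in> SN (n + m) \<longrightarrow> dim X = dim Y"
    using dimf unfolding dimension_function_def by (elim conjE)
  then show "X \<in> SN n \<Longrightarrow> Y \<in> SN m \<Longrightarrow> bij_betw f X Y \<Longrightarrow> {x @ f x | x. x \<in> X} \<in> SN (n + m) \<Longrightarrow> dim X = dim Y"
    by (elim allE impE)
qed

lemma dim_SM: "A \<in> SM n \<Longrightarrow> dim A = omin_dim n A"
  using dimf unfolding dimension_function_def by (elim conjE) simp

lemma generic_SM: "{x @ [f x] | x. x \<in> tuples n} \<in> SN (Suc n) \<Longrightarrow>
        \<exists>F D. {x @ [F x] | x. x \<in> tuples n} \<in> SM (Suc n) \<and> D \<in> SN n \<and> dim D < Some n
             \<and> (\<forall>x \<in> tuples n - D. f x = F x)"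
  using dimf unfolding dimension_function_def by (elim conjE) simp

lemma dim_mono: 
  assumes "X \<in> SN n" "Y \<in> SN n" "X \<subseteq> Y" shows "dim X \<le> dim Y"
proof -
  have "dim Y = max (dim X) (dim Y)" using dim_Un[OF assms(1,2)] assms(3) by (simp add: Un_absorb1)
  then show ?thesis by (metis max.cobounded1)
qed

lemma dim_less_mono:
  assumes "Y \<in> SN n" "dim Y < d" "X \<subseteq> Y" "X \<in> SN n" shows "dim X < d"
  using dim_mono[OF assms(4,1,3)] assms(2) by order

lemma dim_less_Un: "X \<in> SN n \<Longrightarrow> Y \<in> SN n \<Longrightarrow> dim X < d \<Longrightarrow> dim Y < d \<Longrightarrow> dim (X \<union> Y) < d"
  by (simp add: dim_Un)

lemma dim_image_inj:
  assumes "X \<in> SN n" "defmap SN n m t" "inj_on t X"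
  shows "dim (t ` X) = dim X"
proof -
  have X: "length x = n" if "x \<in> X" for x using assms(1) that N.S_lengthD by blast
  have "{x @ y | x y. length x = n \<and> length y = m \<and> x \<in> X \<and> y = t x} \<in> SN (n + m)"
    by (rule N.S_pairs) (rule defs assms)+
  moreover have "{x @ y | x y. length x = n \<and> length y = m \<and> x \<in> X \<and> y = t x} = {x @ t x | x. x \<in> X}"
    using X defmap_length[OF assms(2)] by auto
  ultimately have "{x @ t x | x. x \<in> X} \<in> SN (n + m)" by simp
  from dim_bij[OF assms(1) N.S_image[OF assms(1,2)] _ this] assms(3) show ?thesis
    by (simp add: inj_on_imp_bij_betw)
qed

lemma dim_point: 
  assumes "length x = n" shows "dim {x} = Some 0"
proof -
  have "dim ((\<lambda>_. x) ` {[undefined :: 'a]}) = dim {[undefined]}"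
    by (rule dim_image_inj[OF N.S_point1 N.defmap_const[OF assms]]) simp
  then show ?thesis by (simp add: dim_point1)
qed

text \<open>D3 speaks of pairwise disjoint families only. Prefixing each point of the fibre over t
  with t itself makes the fibres disjoint and, by D4, keeps their dimensions; the union of the
  prefixed fibres is the part of \<open>F\<close> over \<open>I\<close>.\<close>

lemma dim_fibers:
  assumes I: "I \<in> SN m" and F: "F \<in> SN (m + n)"
  shows "{t \<in> I. dim {x \<in> tuples n. t @ x \<in> F} = d} \<in> SN m"
    and "(\<And>t. t \<in> I \<Longrightarrow> dim {x \<in> tuples n. t @ x \<in> F} = Some k) \<Longrightarrow>
      dim {z \<in> F. take m z \<in> I} = map_option (\<lambda>d. d + k) (dim I)"
proof -
  define F' where "F' = {t @ y | t y. length t = m \<and> length y = m + n \<and> y \<in> F \<and> take m y = t}"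
  have F': "F' \<in> SN (m + (m + n))"
    unfolding F'_def by (rule N.S_pairs) (rule defs F)+
  have lenI: "length t = m" if "t \<in> I" for t using I that N.S_lengthD by blast
  have lenF: "length y = m + n" if "y \<in> F" for y using F that N.S_lengthD by blast
  have X: "{y \<in> tuples (m + n). t @ y \<in> F'} = {y \<in> F. take m y = t}" if "t \<in> I" for t
    using lenI[OF that] lenF by (fastforce simp: F'_def mem_tuples)
  have dX: "dim {y \<in> tuples (m + n). t @ y \<in> F'} = dim {x \<in> tuples n. t @ x \<in> F}" if "t \<in> I" for t
  proof -
    have "{x \<in> tuples n. t @ x \<in> F} \<in> SN n"
      by (rule N.S_Collect) (rule defs F lenI that)+
    moreover have "defmap SN n (m + n) (\<lambda>x. t @ x)"
      by (rule defs lenI that)+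
    ultimately have "dim ((\<lambda>x. t @ x) ` {x \<in> tuples n. t @ x \<in> F}) = dim {x \<in> tuples n. t @ x \<in> F}"
      by (rule dim_image_inj) (auto simp: inj_on_def)
    moreover have "(\<lambda>x. t @ x) ` {x \<in> tuples n. t @ x \<in> F} = {y \<in> F. take m y = t}"
    proof (intro equalityI subsetI)
      fix y assume "y \<in> {y \<in> F. take m y = t}"
      then have "y = t @ drop m y" "drop m y \<in> tuples n" "y \<in> F"
        using lenF by (auto simp: mem_tuples)
      then show "y \<in> (\<lambda>x. t @ x) ` {x \<in> tuples n. t @ x \<in> F}" by (metis (mono_tags, lifting) image_eqI mem_Collect_eq)
    qed (use lenI[OF that] in auto)
    ultimately show ?thesis using X[OF that] by simp
  qed
  have disj: "{y \<in> tuples (m + n). t @ y \<in> F'} \<inter> {y \<in> tuples (m + n). t' @ y \<in> F'} = {}"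
    if "t \<in> I" "t' \<in> I" "t \<noteq> t'" for t t'
    unfolding X[OF that(1)] X[OF that(2)] using that(3) by auto
  have "{t \<in> I. dim {y \<in> tuples (m + n). t @ y \<in> F'} = d} \<in> SN m"
    by (rule dim_family(1)[OF I F' disj])
  moreover have "{t \<in> I. dim {y \<in> tuples (m + n). t @ y \<in> F'} = d} = {t \<in> I. dim {x \<in> tuples n. t @ x \<in> F} = d}"
    using dX by auto
  ultimately show "{t \<in> I. dim {x \<in> tuples n. t @ x \<in> F} = d} \<in> SN m" by simp
  assume k: "\<And>t. t \<in> I \<Longrightarrow> dim {x \<in> tuples n. t @ x \<in> F} = Some k"
  have "dim (\<Union>t\<in>I. {y \<in> tuples (m + n). t @ y \<in> F'}) = map_option (\<lambda>d. d + k) (dim I)"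
    by (rule dim_family(2)[OF I F' disj]) (auto simp: dX k)
  moreover have "(\<Union>t\<in>I. {y \<in> tuples (m + n). t @ y \<in> F'}) = {z \<in> F. take m z \<in> I}"
    by (auto simp: X)
  ultimately show "dim {z \<in> F. take m z \<in> I} = map_option (\<lambda>d. d + k) (dim I)" by simp
qed

lemma dim_full_iff: "A \<in> SM n \<Longrightarrow> Some n \<le> dim A \<longleftrightarrow> has_interior n A"
  using omin_dim_full[of A n] by (simp add: dim_SM M.S_subset)

lemma omin_dim_le: "omin_dim n A \<le> Some n"
proof (cases "omin_dim n A")
  case (Some d)
  then show ?thesis using omin_dim_attained[OF Some] idx_length by (metis less_eq_option_Some)
qed simp

lemma dim_le: "X \<in> SN n \<Longrightarrow> dim X \<le> Some n"
  using dim_mono[OF _ N.S_tuples N.S_subset, of X n] dim_SM[OF M.S_tuples, of n] omin_dim_le[of n "tuples n"]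
  by (auto intro: order_trans)

lemma dim_box:
  assumes "length a = n" "length b = n" "x \<in> box a b" shows "dim (box a b) = Some n"
  using dim_full_iff[OF M.S_box[OF assms(1,2)]] has_interior_box[OF assms] dim_le[OF N.S_box[OF assms(1,2)]]
  by simp

lemma fiber_SN: "F \<in> SN (m + n) \<Longrightarrow> length t = m \<Longrightarrow> {x \<in> tuples n. t @ x \<in> F} \<in> SN n"
  by (rule N.S_Collect) (rule defs | assumption)+

text \<open>The base is cut into the finitely many sets \<open>J i\<close> over which the fibres
  have dimension exactly i; there D3 gives an equality. Base points with empty fibre belong to no
  \<open>J i\<close>, and D2 is applied by induction because it joins two sets at a time.\<close>

lemma dim_fibers_le:
  assumes I: "I \<in> SN m" and F: "F \<in> SN (m + n)" and FI: "\<And>z. z \<in> F \<Longrightarrow> take m z \<in> I"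
    and d: "dim I \<le> Some d" and j: "\<And>t. t \<in> I \<Longrightarrow> dim {x \<in> tuples n. t @ x \<in> F} \<le> Some j"
  shows "dim F \<le> Some (d + j)"
proof -
  define J where "J i = {t \<in> I. dim {x \<in> tuples n. t @ x \<in> F} = Some i}" for i
  have J: "J i \<in> SN m" for i unfolding J_def by (rule dim_fibers(1)[OF I F])
  have FJ: "{z \<in> F. take m z \<in> J i} \<in> SN (m + n)" for i by (rule N.S_Collect) (rule defs F J)+
  have "dim {z \<in> F. take m z \<in> J i} = map_option (\<lambda>d. d + i) (dim (J i))" for i
    by (rule dim_fibers(2)[OF J F]) (simp add: J_def)
  moreover have "dim (J i) \<le> Some d" for i
    using dim_mono[OF J I, of i] d by (auto simp: J_def intro: order_trans)
  ultimately have le: "dim {z \<in> F. take m z \<in> J i} \<le> Some (d + j)" if "i \<le> j" for i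
    using that by (cases "dim (J i)") (auto simp: add_mono, metis add_mono less_eq_option_Some)
  have 1: "(\<Union>i\<le>(r::nat). {z \<in> F. take m z \<in> J i}) \<in> SN (m + n) \<and>
      (r \<le> j \<longrightarrow> dim (\<Union>i\<le>r. {z \<in> F. take m z \<in> J i}) \<le> Some (d + j))" for r
  proof (induction r)
    case 0
    then show ?case using FJ le by simp
  next
    case (Suc r)
    have "(\<Union>i\<le>Suc r. {z \<in> F. take m z \<in> J i}) = (\<Union>i\<le>r. {z \<in> F. take m z \<in> J i}) \<union> {z \<in> F. take m z \<in> J (Suc r)}"
      by (auto simp: le_Suc_eq)
    moreover have "\<dots> \<in> SN (m + n)" using Suc FJ by (intro N.S_Un) auto
    ultimately show ?case using Suc le[of "Suc r"] dim_Un[OF conjunct1[OF Suc] FJ, of "Suc r"] by auto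
  qed
  have "F = (\<Union>i\<le>j. {z \<in> F. take m z \<in> J i})"
  proof (intro equalityI subsetI)
    fix z assume z: "z \<in> F"
    let ?t = "take m z"
    have l: "length z = m + n" using F z N.S_lengthD by blast
    have t: "?t \<in> I" using FI z by simp
    have "drop m z \<in> {x \<in> tuples n. ?t @ x \<in> F}" using z l by (simp add: mem_tuples)
    moreover have "{x \<in> tuples n. ?t @ x \<in> F} \<in> SN n" using fiber_SN[OF F] l by simp
    ultimately have "dim {x \<in> tuples n. ?t @ x \<in> F} \<noteq> None" using dim_None by blast
    then obtain i where "dim {x \<in> tuples n. ?t @ x \<in> F} = Some i" by blast
    then show "z \<in> (\<Union>i\<le>j. {z \<in> F. take m z \<in> J i})" using z t j[OF t] by (auto simp: J_def)
  qed auto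
  then show ?thesis using conjunct2[OF 1[of j]] by simp
qed

text \<open>The fibres have dimension between j and n, so \<open>I\<close> is a finite union of sets
  \<open>J i\<close>. By D2 one of them has dimension at least d, and the part of \<open>F\<close>
  over it is already large enough.\<close>

lemma dim_fibers_ge:
  assumes I: "I \<in> SN m" and F: "F \<in> SN (m + n)"
    and d: "Some d \<le> dim I" and j: "\<And>t. t \<in> I \<Longrightarrow> Some j \<le> dim {x \<in> tuples n. t @ x \<in> F}"
  shows "Some (d + j) \<le> dim F"
proof -
  define J where "J i = {t \<in> I. dim {x \<in> tuples n. t @ x \<in> F} = Some i}" for i
  have J: "J i \<in> SN m" for i unfolding J_def by (rule dim_fibers(1)[OF I F])
  have FJ: "{z \<in> F. take m z \<in> J i} \<in> SN (m + n)" for i by (rule N.S_Collect) (rule defs F J)+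
  have eq: "dim {z \<in> F. take m z \<in> J i} = map_option (\<lambda>d. d + i) (dim (J i))" for i
    by (rule dim_fibers(2)[OF J F]) (simp add: J_def)
  have 1: "(\<Union>i\<le>r. J i) \<in> SN m \<and> ((\<forall>i\<le>r. j \<le> i \<longrightarrow> dim (J i) < Some d) \<longrightarrow> dim (\<Union>i\<le>r. J i) < Some d)" for r
  proof (induction r)
    case 0
    show ?case
    proof (cases "j = 0")
      case False
      then have "J 0 = {}" using j by (force simp: J_def)
      then show ?thesis using J[of 0] by simp
    qed (use J in auto)
  next
    case (Suc r)
    have *: "(\<Union>i\<le>Suc r. J i) = (\<Union>i\<le>r. J i) \<union> J (Suc r)" by (auto simp: le_Suc_eq)
    moreover have "\<dots> \<in> SN m" using Suc J by (intro N.S_Un) auto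
    moreover have "dim (J (Suc r)) < Some d" if "\<forall>i\<le>Suc r. j \<le> i \<longrightarrow> dim (J i) < Some d"
    proof (cases "j \<le> Suc r")
      case False
      then have "J (Suc r) = {}" using j by (force simp: J_def)
      then show ?thesis by simp
    qed (use that in auto)
    ultimately show ?case using Suc dim_Un[OF conjunct1[OF Suc] J, of "Suc r"] by auto
  qed
  have "I = (\<Union>i\<le>n. J i)"
  proof (intro equalityI subsetI)
    fix t assume t: "t \<in> I"
    have "length t = m" using I t N.S_lengthD by blast
    then have "dim {x \<in> tuples n. t @ x \<in> F} \<le> Some n" using fiber_SN[OF F] dim_le by blast
    moreover have "dim {x \<in> tuples n. t @ x \<in> F} \<noteq> None" using j[OF t] by (cases "dim {x \<in> tuples n. t @ x \<in> F}") auto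
    ultimately show "t \<in> (\<Union>i\<le>n. J i)" using t by (auto simp: J_def)
  qed (auto simp: J_def)
  then have "\<not> dim (\<Union>i\<le>n. J i) < Some d" using d by auto
  then obtain i where i: "i \<le> n" "j \<le> i" "Some d \<le> dim (J i)" using 1[of n] by (meson not_less)
  then obtain e where e: "dim (J i) = Some e" "d \<le> e" by (cases "dim (J i)") auto
  have "Some (d + j) \<le> dim {z \<in> F. take m z \<in> J i}" using eq[of i] e i by (simp add: add_mono)
  also have "\<dots> \<le> dim F" by (rule dim_mono[OF FJ F]) auto
  finally show ?thesis .
qed

end

lemma less_Some_iff: "x < Some (d::nat) \<longleftrightarrow> x = None \<or> (\<exists>i<d. x = Some i)"
  by (cases x) auto

lemma box_left_nonempty:
  fixes z :: "'a::dense_linorder list"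
  assumes "z \<in> box a b" shows "\<exists>c. c \<in> box a z"
proof -
  have "\<forall>i<length a. \<exists>u. a ! i < u \<and> u < z ! i" using assms dense by (auto simp: mem_box)
  then obtain f where "\<forall>i<length a. a ! i < f i \<and> f i < z ! i" by metis
  then have "map f [0..<length a] \<in> box a z" by (simp add: mem_box)
  then show ?thesis ..
qed

lemma box_right_nonempty:
  fixes z :: "'a::dense_linorder list"
  assumes "z \<in> box a b" shows "\<exists>c. c \<in> box z b"
proof -
  have "\<forall>i<length z. \<exists>u. z ! i < u \<and> u < b ! i" using assms dense by (auto simp: mem_box)
  then obtain f where "\<forall>i<length z. z ! i < f i \<and> f i < b ! i" by metis
  then have "map f [0..<length z] \<in> box z b" by (simp add: mem_box)
  then show ?thesis ..
qed

lemma box_sub_box: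
  assumes "a' \<in> box a z" "b' \<in> box z b" "length z = length a"
  shows "z \<in> box a' b'" "box a' b' \<subseteq> box a b"
  using assms by (auto simp: mem_box) (meson order.strict_trans)+

section \<open>Dimension in definable families and its local nature\<close>

context tame_pair
begin

lemma defpred_dim_SN [defs]:
  assumes "defpred SN (n + m) (\<lambda>z. P (take n z) (drop n z))"
  shows "defpred SN n (\<lambda>x. dim {y \<in> tuples m. P x y} < Some d)"
proof -
  define F where "F = {z \<in> tuples (n + m). P (take n z) (drop n z)}"
  have F: "F \<in> SN (n + m)" using assms by (simp add: F_def defpred_def)
  have fib: "{y \<in> tuples m. x @ y \<in> F} = {y \<in> tuples m. P x y}" if "length x = n" for x
    using that by (auto simp: F_def mem_tuples)
  have "defpred SN n (\<lambda>x. dim {y \<in> tuples m. x @ y \<in> F} = e)" for e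
    unfolding defpred_def by (rule dim_fibers(1)[OF N.S_tuples F])
  then have "defpred SN n (\<lambda>x. dim {y \<in> tuples m. x @ y \<in> F} < Some d)"
    unfolding less_Some_iff by (intro N.defpred_disj N.defpred_ex_less)
  then show ?thesis by (rule defpred_cong[THEN iffD1, rotated]) (simp add: fib)
qed

text \<open>D3 would only give \<open>SN\<close>-definability. By D5 the dimension of an
  \<open>SM\<close>-definable fibre is the o-minimal one, and having interior after a coordinate
  projection is a first-order condition on boxes. This is what lets "for generic x" occur inside
  \<open>SM\<close>-definable formulas.\<close>

lemma defpred_dim_SM [defs]:
  assumes P: "defpred SM (n + m) (\<lambda>z. P (take n z) (drop n z))"
  shows "defpred SM n (\<lambda>x. dim {y \<in> tuples m. P x y} < Some d)"
proof -
  let ?A = "\<lambda>x. {y \<in> tuples m. P x y}"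
  have A: "?A x \<in> SM m" if "length x = n" for x
    by (rule M.S_fiber[OF P that])
  have int: "has_interior l ((\<lambda>y. map ((!) y) js) ` ?A x) \<longleftrightarrow>
     (\<exists>u\<in>tuples l. \<exists>a\<in>tuples l. \<exists>b\<in>tuples l. u \<in> box a b \<and>
        (\<forall>v\<in>tuples l. v \<in> box a b \<longrightarrow> (\<exists>y\<in>tuples m. P x y \<and> v = map ((!) y) js)))"
    (is "?L \<longleftrightarrow> ?R") if "length js = l" for js l x
  proof
    assume ?L
    then obtain u a b where *: "length a = l" "length b = l" "u \<in> box a b" "box a b \<subseteq> (\<lambda>y. map ((!) y) js) ` ?A x"
      unfolding has_interior_def by blast
    then have "u \<in> tuples l" "a \<in> tuples l" "b \<in> tuples l" by (auto simp: mem_tuples mem_box)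
    then show ?R using * by blast
  next
    assume ?R
    then obtain u a b where *: "a \<in> tuples l" "b \<in> tuples l" "u \<in> box a b"
      "\<forall>v\<in>tuples l. v \<in> box a b \<longrightarrow> (\<exists>y\<in>tuples m. P x y \<and> v = map ((!) y) js)"
      by blast
    have "v \<in> tuples l" if "v \<in> box a b" for v using that *(1) by (simp add: mem_box mem_tuples)
    then have "box a b \<subseteq> (\<lambda>y. map ((!) y) js) ` ?A x" using *(4) by blast
    moreover have "has_interior l (box a b)" using * by (intro has_interior_box) (auto simp: mem_tuples)
    ultimately show ?L using has_interior_mono by blast
  qed
  have "defpred SM n (\<lambda>x. \<forall>js\<in>{js \<in> idx m. d \<le> length js}.
      \<not> has_interior (length js) ((\<lambda>y. map ((!) y) js) ` ?A x))"
  proof (rule M.defpred_ball_fin)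
    fix js assume "js \<in> {js \<in> idx m. d \<le> length js}"
    then have js: "set js \<subseteq> {..<m}" by (auto simp: idx_def)
    show "defpred SM n (\<lambda>x. \<not> has_interior (length js) ((\<lambda>y. map ((!) y) js) ` ?A x))"
      unfolding int[OF refl] by (rule defs M.defpred_subst2[OF P] js)+
  qed (simp add: finite_idx)
  then show ?thesis
    by (rule defpred_cong[THEN iffD1, rotated]) (auto simp: dim_SM[OF A] omin_dim_less_iff)
qed

lemma swap_SN:
  assumes "F \<in> SN (m + n)"
  obtains F' where "F' \<in> SN (n + m)" "dim F' = dim F"
    "\<And>x y. length x = m \<Longrightarrow> length y = n \<Longrightarrow> y @ x \<in> F' \<longleftrightarrow> x @ y \<in> F"
proof
  let ?t = "\<lambda>z. drop m z @ take m z"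
  have len: "length z = m + n" if "z \<in> F" for z using assms that N.S_lengthD by blast
  have t: "defmap SN (m + n) (n + m) ?t" by (rule defs)+
  show "?t ` F \<in> SN (n + m)" by (rule N.S_image[OF assms t])
  show "dim (?t ` F) = dim F"
  proof (rule dim_image_inj[OF assms t], rule inj_onI)
    fix x y assume "x \<in> F" "y \<in> F" "?t x = ?t y"
    then show "x = y" using len by (metis append_eq_append_conv append_take_drop_id length_drop)
  qed
  fix x y :: "'a list" assume *: "length x = m" "length y = n"
  show "y @ x \<in> ?t ` F \<longleftrightarrow> x @ y \<in> F"
  proof
    assume "y @ x \<in> ?t ` F"
    then obtain z where z: "z \<in> F" "y @ x = drop m z @ take m z" by auto
    then have "y = drop m z" "x = take m z" using len[of z] * by auto
    then show "x @ y \<in> F" using z by simp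
  next
    assume "x @ y \<in> F"
    then show "y @ x \<in> ?t ` F" using * by (intro image_eqI[of _ _ "x @ y"]) auto
  qed
qed

lemma dim_fibers_less:
  assumes I: "I \<in> SN m" and F: "F \<in> SN (m + n)" and FI: "\<And>z. z \<in> F \<Longrightarrow> take m z \<in> I"
    and d: "dim I \<le> Some d" and j: "\<And>t. t \<in> I \<Longrightarrow> dim {x \<in> tuples n. t @ x \<in> F} < Some j"
  shows "dim F < Some (d + j)"
proof (cases j)
  case 0
  have "F = {}"
  proof (rule ccontr)
    assume "F \<noteq> {}"
    then obtain z where z: "z \<in> F" by auto
    then have l: "length z = m + n" using F N.S_lengthD by blast
    have "dim {x \<in> tuples n. take m z @ x \<in> F} = None"
      using j[OF FI[OF z]] 0 by (simp add: less_Some_iff)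
    then have "{x \<in> tuples n. take m z @ x \<in> F} = {}" using dim_None fiber_SN[OF F, of "take m z"] l by simp
    moreover have "drop m z \<in> {x \<in> tuples n. take m z @ x \<in> F}" using z l by (simp add: mem_tuples)
    ultimately show False by blast
  qed
  then show ?thesis by simp
next
  case (Suc i)
  have "dim F \<le> Some (d + i)"
    by (rule dim_fibers_le[OF I F FI d]) (use j Suc in \<open>fastforce simp: less_Some_iff less_Suc_eq_le\<close>)+
  then show ?thesis using Suc by (cases "dim F") auto
qed

lemma dim_base_less:
  assumes I: "I \<in> SN m" and F: "F \<in> SN (m + n)" and FI: "\<And>z. z \<in> F \<Longrightarrow> take m z \<in> I"
    and d: "dim I < Some d" and j: "\<And>t. t \<in> I \<Longrightarrow> dim {x \<in> tuples n. t @ x \<in> F} \<le> Some j"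
  shows "dim F < Some (d + j)"
proof (cases "I = {}")
  case True
  then have "F = {}" using FI by auto
  then show ?thesis by simp
next
  case False
  then obtain i where i: "i < d" "dim I = Some i" using d dim_None[OF I] by (auto simp: less_Some_iff)
  have "dim F \<le> Some (i + j)"
    by (rule dim_fibers_le[OF I F FI _ j]) (use i in auto)
  then show ?thesis using i by (cases "dim F") auto
qed

lemma dim_cofibers_less:
  assumes I: "I \<in> SN n" and F: "F \<in> SN (m + n)" and FI: "\<And>z. z \<in> F \<Longrightarrow> drop m z \<in> I"
    and d: "dim I \<le> Some d" and j: "\<And>t. t \<in> I \<Longrightarrow> dim {x \<in> tuples m. x @ t \<in> F} < Some j"
  shows "dim F < Some (d + j)"
proof -
  obtain F' where F': "F' \<in> SN (n + m)" "dim F' = dim F"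
    "\<And>x y. length x = m \<Longrightarrow> length y = n \<Longrightarrow> y @ x \<in> F' \<longleftrightarrow> x @ y \<in> F"
    using swap_SN[OF F] by blast
  have "dim F' < Some (d + j)"
  proof (rule dim_fibers_less[OF I F'(1) _ d])
    fix z assume z: "z \<in> F'"
    then have l: "length z = n + m" using F' N.S_lengthD by blast
    then have "drop n z @ take n z \<in> F" using F'(3)[of "drop n z" "take n z"] z by simp
    from FI[OF this] show "take n z \<in> I" using l by simp
  next
    fix t assume t: "t \<in> I"
    then have "length t = n" using I N.S_lengthD by blast
    then have "{x \<in> tuples m. t @ x \<in> F'} = {x \<in> tuples m. x @ t \<in> F}" using F'(3) by (auto simp: mem_tuples)
    then show "dim {x \<in> tuples m. t @ x \<in> F'} < Some j" using j[OF t] by simp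
  qed
  then show ?thesis using F'(2) by simp
qed

text \<open>The graph of \<open>R\<close> between \<open>X\<close> and \<open>Y\<close> is measured
  in two ways: its fibres over \<open>X\<close> are nonempty, and those over \<open>Y\<close> have
  at most one point. With a relation in place of a map, a set can be bounded by another one without
  choosing images definably.\<close>

lemma dim_le_rel:
  assumes X: "X \<in> SN n" and Y: "Y \<in> SN m"
    and R: "defpred SN (n + m) (\<lambda>z. R (take n z) (drop n z))"
    and ex: "\<And>x. x \<in> X \<Longrightarrow> \<exists>y\<in>Y. R x y"
    and inj: "\<And>x x' y. x \<in> X \<Longrightarrow> x' \<in> X \<Longrightarrow> y \<in> Y \<Longrightarrow> R x y \<Longrightarrow> R x' y \<Longrightarrow> x = x'"
  shows "dim X \<le> dim Y"
proof (cases "dim X")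
  case (Some d)
  then have "X \<noteq> {}" by auto
  then have "Y \<noteq> {}" using ex by blast
  then obtain e where e: "dim Y = Some e" using dim_None[OF Y] by auto
  have lX: "length x = n" if "x \<in> X" for x using X that N.S_lengthD by blast
  have lY: "length x = m" if "x \<in> Y" for x using Y that N.S_lengthD by blast
  define F where "F = {x @ y | x y. length x = n \<and> length y = m \<and> x \<in> X \<and> y \<in> Y \<and> R x y}"
  have F: "F \<in> SN (n + m)" unfolding F_def by (rule N.S_pairs) (rule defs X Y R)+
  have "Some (d + 0) \<le> dim F"
  proof (rule dim_fibers_ge[OF X F])
    fix t assume t: "t \<in> X"
    then obtain y where y: "y \<in> Y" "R t y" using ex by blast
    then have "y \<in> {x \<in> tuples m. t @ x \<in> F}" using lX lY t by (auto simp: F_def mem_tuples)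
    moreover have "{x \<in> tuples m. t @ x \<in> F} \<in> SN m" by (rule fiber_SN[OF F lX[OF t]])
    ultimately have "dim {x \<in> tuples m. t @ x \<in> F} \<noteq> None" using dim_None by blast
    then show "Some 0 \<le> dim {x \<in> tuples m. t @ x \<in> F}" by (cases "dim {x \<in> tuples m. t @ x \<in> F}") auto
  qed (use Some in simp)
  moreover have "dim F < Some (e + 1)"
  proof (rule dim_cofibers_less[OF Y F])
    fix z assume "z \<in> F" then show "drop n z \<in> Y" by (auto simp: F_def)
  next
    fix y assume y: "y \<in> Y"
    show "dim {x \<in> tuples n. x @ y \<in> F} < Some 1"
    proof (cases "\<exists>x. x \<in> {x \<in> tuples n. x @ y \<in> F}")
      case True
      then obtain x where x: "x \<in> X" "R x y" "length x = n" using lY[OF y] by (auto simp: F_def mem_tuples)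
      have "x' = x" if "x' \<in> {x \<in> tuples n. x @ y \<in> F}" for x'
      proof -
        have "x' \<in> X" "R x' y" using that lY[OF y] by (auto simp: F_def mem_tuples)
        then show ?thesis using inj[OF _ x(1) y _ x(2)] by blast
      qed
      then have "{x \<in> tuples n. x @ y \<in> F} = {x}" using True by auto
      then show ?thesis using dim_point[OF x(3)] by simp
    next
      case False
      then have e: "{x \<in> tuples n. x @ y \<in> F} = {}" by blast
      show ?thesis unfolding e by simp
    qed
  qed (use e in simp)
  ultimately show ?thesis using Some e by (cases "dim F") auto
qed simp

text \<open>In place of a covering argument, the dimension of one set is computed in two ways: the
  set \<open>T\<close> of pairs of a point z of \<open>Y\<close> and a box around z that meets
  \<open>Y\<close> in dimension less than d. Over z the admissible boxes contain an open set of
  corner pairs, of dimension n + n; over a fixed box the points have dimension less than d.\<close>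

lemma dim_less_if_locally:
  assumes Y: "Y \<in> SN n"
    and loc: "\<And>z. z \<in> Y \<Longrightarrow> \<exists>a b. length a = n \<and> length b = n \<and> z \<in> box a b \<and> dim (box a b \<inter> Y) < Some d"
  shows "dim Y < Some d"
proof (rule ccontr)
  assume "\<not> dim Y < Some d"
  then have dY: "Some d \<le> dim Y" by simp
  have lY: "length z = n" if "z \<in> Y" for z using Y that N.S_lengthD by blast
  define T where "T = {z @ v | z v. length z = n \<and> length v = n + n \<and> z \<in> Y \<and> z \<in> box (take n v) (drop n v) \<and>
     dim (box (take n v) (drop n v) \<inter> Y) < Some d}"
  have eq: "box a b \<inter> Y = {x \<in> tuples n. x \<in> box a b \<and> x \<in> Y}" for a b :: "'a list"
    using lY by (auto simp: mem_tuples)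
  have T: "T \<in> SN (n + (n + n))" unfolding T_def eq by (rule N.S_pairs) (rule defs Y)+
  have "Some (d + (n + n)) \<le> dim T"
  proof (rule dim_fibers_ge[OF Y T dY])
    fix z assume z: "z \<in> Y"
    then obtain a b where ab: "length a = n" "length b = n" "z \<in> box a b" "dim (box a b \<inter> Y) < Some d"
      using loc by blast
    have lz: "length z = n" using z lY by simp
    \<comment> \<open>Every box with lower corner in \<open>box a z\<close> and upper corner in
      \<open>box z b\<close> contains z and lies in \<open>box a b\<close>. These corner pairs form
      an open box in M^(n+n), nonempty by density of the order.\<close>
    obtain a' b' where ab': "a' \<in> box a z" "b' \<in> box z b"
      using box_left_nonempty[OF ab(3)] box_right_nonempty[OF ab(3)] by blast
    have la': "length a' = n" using ab' ab by (simp add: mem_box)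
    have "a' @ b' \<in> box (a @ z) (z @ b)" using ab' ab lz la' by (simp add: box_append)
    then have "dim (box (a @ z) (z @ b)) = Some (n + n)" by (intro dim_box) (use ab lz in auto)
    moreover have "box (a @ z) (z @ b) \<subseteq> {v \<in> tuples (n + n). z @ v \<in> T}"
    proof
      fix v assume v: "v \<in> box (a @ z) (z @ b)"
      then have lv: "length v = n + n" using ab lz by (simp add: mem_box)
      have "take n v @ drop n v \<in> box (a @ z) (z @ b)" using v by simp
      then have s: "take n v \<in> box a z" "drop n v \<in> box z b" using ab lz lv by (simp_all add: box_append del: append_take_drop_id)
      have zb: "z \<in> box (take n v) (drop n v)" "box (take n v) (drop n v) \<subseteq> box a b"
        using box_sub_box[OF s] ab lz by auto
      have "dim (box (take n v) (drop n v) \<inter> Y) < Some d"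
      proof (rule dim_less_mono[OF _ ab(4)])
        show "box a b \<inter> Y \<in> SN n" by (rule defs ab Y)+
        show "box (take n v) (drop n v) \<inter> Y \<in> SN n" using lv by (intro N.S_Int N.S_box Y) auto
      qed (use zb in auto)
      then show "v \<in> {v \<in> tuples (n + n). z @ v \<in> T}"
        unfolding T_def mem_Collect_eq using lv lz z zb by (auto simp: mem_tuples)
    qed
    ultimately show "Some (n + n) \<le> dim {v \<in> tuples (n + n). z @ v \<in> T}"
      using dim_mono[OF N.S_box[of "a @ z" "n + n" "z @ b"] fiber_SN[OF T lz]] ab lz by simp
  qed
  moreover have "dim T < Some ((n + n) + d)"
  proof (rule dim_cofibers_less[OF N.S_tuples T _ dim_le[OF N.S_tuples]])
    fix z assume "z \<in> T"
    then show "drop n z \<in> tuples (n + n)" using N.S_lengthD[OF T] by (auto simp: mem_tuples)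
  next
    fix v :: "'a list" assume "v \<in> tuples (n + n)"
    then have lv: "length v = n + n" by (simp add: mem_tuples)
    let ?B = "{z \<in> tuples n. z @ v \<in> T}"
    have B: "?B \<in> SN n" by (rule N.S_Collect) (rule defs T lv)+
    show "dim ?B < Some d"
    proof (cases "?B = {}")
      case False
      then have "dim (box (take n v) (drop n v) \<inter> Y) < Some d" by (auto simp: T_def mem_tuples)
      moreover have "?B \<subseteq> box (take n v) (drop n v) \<inter> Y" by (auto simp: T_def mem_tuples)
      moreover have "box (take n v) (drop n v) \<inter> Y \<in> SN n" using lv by (intro N.S_Int N.S_box Y) auto
      ultimately show ?thesis using dim_less_mono B by blast
    next
      case True
      show ?thesis unfolding True by simp
    qed
  qed
  ultimately show False by (cases "dim T") auto
qed

end

subsection \<open>Frontier and locally injective projections\<close>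

lemma omin_basic_infinite_has_interior:
  fixes B :: "'a::{linorder, no_top, no_bot} set"
  assumes "omin_basic B" "infinite B"
  shows "has_interior 1 {[c] | c. c \<in> B}"
proof -
  obtain c where c: "c \<in> B" using assms(2) by (meson finite.emptyI subsetI finite_subset empty_iff)
  obtain l u where lu: "l < c" "c < u" using lt_ex[of c] gt_ex[of c] by (elim exE)
  obtain p q where pq: "p < c" "c < q" "{x. p < x \<and> x < q} \<subseteq> B"
  proof -
    from assms(1)[unfolded omin_basic_def] show thesis
    proof (elim disjE exE)
      fix e assume "B = {e}" then show thesis using assms(2) by simp
    next
      fix p q assume "B = {x. p < x \<and> x < q}" then show thesis using that[of p q] c by auto
    next
      fix p assume "B = {x. p < x}" then show thesis using that[of p u] c lu by auto
    next
      fix q assume "B = {x. x < q}" then show thesis using that[of l q] c lu by auto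
    next
      assume "B = UNIV" then show thesis using that[of l u] lu by auto
    qed
  qed
  have "box [p] [q] \<subseteq> {[c] | c. c \<in> B}"
    using pq(3) by (auto simp: box_def length_Suc_conv)
  moreover have "has_interior 1 (box [p] [q])"
    using pq by (intro has_interior_box[of _ _ _ "[c]"]) (auto simp: mem_box)
  ultimately show ?thesis using has_interior_mono by blast
qed

context tame_pair
begin

text \<open>An infinite set has an infinite projection to some coordinate; by o-minimality that
  projection contains an interval, so the dimension is at least 1. This is where the description of
  definable subsets of the line enters.\<close>

lemma finite_if_dim_0:
  assumes X: "X \<in> SM n" and d: "dim X < Some 1"
  shows "finite X"
proof -
  have fin: "finite {a. \<exists>x\<in>X. a = x ! i}" if i: "i < n" for i
  proof (rule ccontr)
    assume inf: "infinite {a. \<exists>x\<in>X. a = x ! i}"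
    let ?P = "(\<lambda>x. map ((!) x) [i]) ` X"
    have idx: "[i] \<in> idx n" using i by (simp add: idx_def)
    have "defmap SM n (length [i]) (\<lambda>x. map ((!) x) [i])"
      by (rule M.defmap_nths) (use i in simp)
    then have "?P \<in> SM 1" using M.S_image[OF X] by fastforce
    then obtain F where F: "finite F" "\<forall>B\<in>F. omin_basic B" "{a. [a] \<in> ?P} = \<Union>F"
      using omin unfolding o_minimal_def by blast
    have "{a. [a] \<in> ?P} = {a. \<exists>x\<in>X. a = x ! i}" by auto
    then have "infinite (\<Union>F)" using inf F(3) by simp
    then obtain B where B: "B \<in> F" "infinite B" using F(1) by blast
    then have "has_interior 1 {[c] | c. c \<in> B}" using omin_basic_infinite_has_interior F(2) by blast
    moreover have "{[c] | c. c \<in> B} \<subseteq> ?P" using F(3) B by blast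
    ultimately have "has_interior (length [i]) ?P" using has_interior_mono by fastforce
    then have "Some 1 \<le> dim X" using omin_dim_ge[OF idx] dim_SM[OF X] by simp
    then show False using d by simp
  qed
  let ?A = "\<Union>i<n. {a. \<exists>x\<in>X. a = x ! i}"
  have "X \<subseteq> {x. set x \<subseteq> ?A \<and> length x = n}"
  proof
    fix x assume x: "x \<in> X"
    then have l: "length x = n" using X M.S_lengthD by blast
    have "a \<in> ?A" if "a \<in> set x" for a
    proof -
      from that obtain i where i: "i < length x" "x ! i = a" unfolding in_set_conv_nth by (elim exE conjE)
      show ?thesis by (rule UN_I[of i]) (use i l x in auto)
    qed
    then show "x \<in> {x. set x \<subseteq> ?A \<and> length x = n}" using l by blast
  qed
  moreover have "finite ?A" using fin by blast
  ultimately show ?thesis by (rule finite_subset[OF _ finite_lists_length_eq])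
qed

text \<open>For generic \<open>y\<close> in the projection of \<open>Z\<close>, the fibre of \<open>X\<close> over \<open>y\<close> is finite, so some box around a point
  of \<open>Z\<close> over \<open>y\<close> contains no other point of that fibre.  The set of triples (\<open>y\<close>, corners of such a box)
  therefore has full dimension, hence nonempty interior, so one box works for an open set of \<open>y\<close>.\<close>

lemma uniform_box:
  assumes X: "X \<in> SM n" and Z: "Z \<in> SM n" and dX: "dim X \<le> Some d" and dZ: "dim Z = Some d"
  obtains js a b z where "js \<in> idx n" "length js = d" "length a = n" "length b = n"
    "z \<in> Z" "z \<in> box a b" "X \<inter> box a b \<subseteq> Z" "inj_on (\<lambda>x. map ((!) x) js) (X \<inter> box a b)"
proof -
  obtain js where js: "js \<in> idx n" "length js = d" "has_interior d ((\<lambda>x. map ((!) x) js) ` Z)"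
    using omin_dim_attained dZ dim_SM[OF Z] by metis
  let ?p = "\<lambda>x. map ((!) x) js"
  have jsn: "set js \<subseteq> {..<n}" using js(1) by (simp add: idx_def)
  have pM: "defmap SM n d ?p" using M.defmap_nths[OF jsn] js(2) by simp
  have pM': "defmap SM k d (\<lambda>z. ?p (t z))" if "defmap SM k n t" for k t
    using M.defmap_comp[OF that pM] .
  have pN: "defmap SN n d ?p" using N.defmap_nths[OF jsn] js(2) by simp
  have pN': "defmap SN k d (\<lambda>z. ?p (t z))" if "defmap SN k n t" for k t
    using N.defmap_comp[OF that pN] .
  have lX: "length x = n" if "x \<in> X" for x using X that M.S_lengthD by blast
  have lZ: "length x = n" if "x \<in> Z" for x using Z that M.S_lengthD by blast
  have Y0: "?p ` Z \<in> SM d" by (rule M.S_image[OF Z pM])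
  define Y1 where "Y1 = {y \<in> ?p ` Z. dim {x \<in> tuples n. x \<in> X \<and> ?p x = y} < Some 1}"
  define Y2 where "Y2 = {y \<in> ?p ` Z. \<not> dim {x \<in> tuples n. x \<in> X \<and> ?p x = y} < Some 1}"
  have Y1: "Y1 \<in> SM d" unfolding Y1_def by (rule M.S_Collect) (rule Y0 X pM' defs)+
  have Y2: "Y2 \<in> SM d" unfolding Y2_def by (rule M.S_Collect) (rule Y0 X pM' defs)+
  \<comment> \<open>Fibres of dimension at least 1 over a base of dimension d would give
    \<open>X\<close> dimension at least d + 1.\<close>
  have "dim Y2 < Some d"
  proof (rule ccontr)
    assume "\<not> dim Y2 < Some d"
    then have dY2: "Some d \<le> dim Y2" by simp
    let ?F = "(\<lambda>x. ?p x @ x) ` X"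
    have t: "defmap SN n (d + n) (\<lambda>x. ?p x @ x)" by (rule N.defmap_append pN N.defmap_id)+
    have F: "?F \<in> SN (d + n)" by (rule N.S_image[OF SN_I[OF X] t])
    have "Some (d + 1) \<le> dim ?F"
    proof (rule dim_fibers_ge[OF SN_I[OF Y2] F dY2])
      fix y assume y: "y \<in> Y2"
      then have "length y = d" using Y2 M.S_lengthD by blast
      then have "{x \<in> tuples n. y @ x \<in> ?F} = {x \<in> tuples n. x \<in> X \<and> ?p x = y}"
        using js(2) by (auto simp: append_eq_append_conv)
      then show "Some 1 \<le> dim {x \<in> tuples n. y @ x \<in> ?F}" using y by (simp add: Y2_def not_less)
    qed
    moreover have "dim ?F = dim X"
      by (rule dim_image_inj[OF SN_I[OF X] t]) (use js(2) in \<open>auto simp: inj_on_def\<close>)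
    ultimately have "Some (d + 1) \<le> Some d" using dX by (metis order_trans)
    then show False by simp
  qed
  moreover have "Some d \<le> dim (?p ` Z)" using js(3) dim_full_iff[OF Y0] by simp
  moreover have "?p ` Z = Y1 \<union> Y2" by (auto simp: Y1_def Y2_def)
  ultimately have dY1: "Some d \<le> dim Y1"
    using dim_Un[OF SN_I[OF Y1] SN_I[OF Y2]] by (auto simp: le_max_iff_disj)
  define Q where "Q y a b z \<longleftrightarrow> z \<in> box a b \<and> ?p z = y \<and> (\<forall>x\<in>X. x \<in> box a b \<longrightarrow> ?p x = y \<longrightarrow> x = z)" for y a b z
  define T where "T = {y @ v | y v. length y = d \<and> length v = n + n \<and>
      (\<exists>z\<in>Z. Q y (take n v) (drop n v) z)}"
  have T: "T \<in> SM (d + (n + n))" unfolding T_def Q_def by (rule M.S_pairs) (rule X Z pM' defs)+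
  have "Some (d + (n + n)) \<le> dim T"
  proof (rule dim_fibers_ge[OF SN_I[OF Y1] SN_I[OF T] dY1])
    fix y assume y: "y \<in> Y1"
    then have ly: "length y = d" using Y1 M.S_lengthD by blast
    obtain z where z: "z \<in> Z" "?p z = y" using y by (auto simp: Y1_def)
    have lz: "length z = n" using lZ z by simp
    have "{x \<in> tuples n. x \<in> X \<and> ?p x = y} \<in> SM n" by (rule M.S_Collect) (rule X pM' defs ly)+
    then have "finite {x \<in> tuples n. x \<in> X \<and> ?p x = y}" using y finite_if_dim_0 by (auto simp: Y1_def)
    from nhd_separate[OF this lz] obtain a b where ab: "length a = n" "length b = n" "z \<in> box a b"
      "box a b \<subseteq> {x. x \<in> {x \<in> tuples n. x \<in> X \<and> ?p x = y} \<longrightarrow> x = z}"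
      unfolding nhd_def by blast
    obtain a' b' where ab': "a' \<in> box a z" "b' \<in> box z b"
      using box_left_nonempty[OF ab(3)] box_right_nonempty[OF ab(3)] by blast
    have la': "length a' = n" using ab' ab by (simp add: mem_box)
    have "a' @ b' \<in> box (a @ z) (z @ b)" using ab' ab lz la' by (simp add: box_append)
    then have "dim (box (a @ z) (z @ b)) = Some (n + n)" by (intro dim_box) (use ab lz in auto)
    moreover have "box (a @ z) (z @ b) \<subseteq> {v \<in> tuples (n + n). y @ v \<in> T}"
    proof
      fix v assume v: "v \<in> box (a @ z) (z @ b)"
      then have lv: "length v = n + n" using ab lz by (simp add: mem_box)
      have "take n v @ drop n v \<in> box (a @ z) (z @ b)" using v by simp
      then have s: "take n v \<in> box a z" "drop n v \<in> box z b" using ab lz lv by (simp_all add: box_append del: append_take_drop_id)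
      have zb: "z \<in> box (take n v) (drop n v)" "box (take n v) (drop n v) \<subseteq> box a b"
        using box_sub_box[OF s] ab lz by auto
      have "x = z" if "x \<in> X" "x \<in> box (take n v) (drop n v)" "?p x = y" for x
        using that zb(2) ab(4) lX by (auto simp: mem_tuples)
      then have "Q y (take n v) (drop n v) z" using zb z by (simp add: Q_def)
      then show "v \<in> {v \<in> tuples (n + n). y @ v \<in> T}"
        using lv ly z(1) by (auto simp: T_def mem_tuples)
    qed
    ultimately show "Some (n + n) \<le> dim {v \<in> tuples (n + n). y @ v \<in> T}"
      using dim_mono[OF N.S_box[of "a @ z" "n + n" "z @ b"] fiber_SN[OF SN_I[OF T] ly]] ab lz by simp
  qed
  then have "has_interior (d + (n + n)) T" using dim_full_iff[OF T] by simp
  then obtain w p q where w: "length p = d + (n + n)" "length q = d + (n + n)" "w \<in> box p q" "box p q \<subseteq> T"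
    unfolding has_interior_def by blast
  obtain p1 p2 q1 q2 where pq: "p = p1 @ p2" "q = q1 @ q2" "length p1 = d" "length q1 = d"
    "length p2 = n + n" "length q2 = n + n" using box_appendE[OF w(1,2)] by blast
  define y0 v where "y0 = take d w" and "v = drop d w"
  have lw: "length w = d + (n + n)" using w by (simp add: mem_box)
  then have l: "length y0 = d" "length v = n + n" by (simp_all add: y0_def v_def)
  have "y0 @ v \<in> box (p1 @ p2) (q1 @ q2)" using w pq by (simp add: y0_def v_def)
  then have in_box: "y0 \<in> box p1 q1" "v \<in> box p2 q2" using l pq by (simp_all add: box_append)
  define a b where "a = take n v" and "b = drop n v"
  have lab: "length a = n" "length b = n" using l by (simp_all add: a_def b_def)
  have Qy: "\<exists>z\<in>Z. Q y a b z" if "y \<in> box p1 q1" for y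
  proof -
    have ly: "length y = d" using that pq by (simp add: mem_box)
    then have "y @ v \<in> T" using w(4) that in_box(2) pq by (auto simp: box_append)
    then show ?thesis using ly by (auto simp: T_def a_def b_def)
  qed
  obtain z where z: "z \<in> Z" "Q y0 a b z" using Qy in_box by blast
  \<comment> \<open>The box is shrunk until it projects into \<open>box p1 q1\<close>. Then each
    point of \<open>X\<close> in it lies over some y to which the same a and b apply, and so equals
    the point of \<open>Z\<close> that \<open>Q\<close> provides over y. Both conclusions follow
    from this.\<close>
  have "nhd n z (box a b \<inter> {x. ?p x \<in> box p1 q1})"
    using z in_box lab lZ jsn by (intro nhd_Int nhd_box nhd_map_nth) (auto simp: Q_def)
  then obtain a' b' where ab': "length a' = n" "length b' = n" "z \<in> box a' b'"
    "box a' b' \<subseteq> box a b \<inter> {x. ?p x \<in> box p1 q1}" unfolding nhd_def by blast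
  have key: "x \<in> Z \<and> (\<forall>x'\<in>X \<inter> box a' b'. ?p x' = ?p x \<longrightarrow> x' = x)" if x: "x \<in> X \<inter> box a' b'" for x
  proof -
    obtain z' where z': "z' \<in> Z" "Q (?p x) a b z'" using Qy x ab' by blast
    have "x' = z'" if "x' \<in> X \<inter> box a' b'" "?p x' = ?p x" for x'
      using that z'(2) ab'(4) unfolding Q_def by blast
    then show ?thesis using x z'(1) by metis
  qed
  show thesis
  proof (rule that[OF js(1,2) ab'(1,2) z(1) ab'(3)])
    show "X \<inter> box a' b' \<subseteq> Z" using key by blast
    show "inj_on ?p (X \<inter> box a' b')" using key by (metis (no_types, lifting) inj_onI)
  qed
qed

text \<open>Otherwise the dimension of \<open>Z\<close> is at least that of \<open>X\<close>, and
  \<open>uniform_box\<close> gives a box around a point of \<open>Z\<close> inside which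
  \<open>X\<close> is contained in \<open>Z\<close>. As \<open>Z\<close> avoids \<open>X\<close>,
  this box misses \<open>X\<close>, although it contains a point of the closure.\<close>

lemma dim_frontier_less:
  assumes X: "X \<in> SM n" and Z: "Z \<in> SM n" and sub: "Z \<subseteq> cl n X - X" and k: "dim X \<le> Some k"
  shows "dim Z < Some k"
proof (rule ccontr)
  assume "\<not> dim Z < Some k"
  then obtain d where d: "dim Z = Some d" "k \<le> d" by (cases "dim Z") auto
  have "dim X \<le> Some d" using k d by (metis less_eq_option_Some order_trans)
  then obtain js a b z where *: "length a = n" "length b = n" "z \<in> Z" "z \<in> box a b" "X \<inter> box a b \<subseteq> Z"
    using uniform_box[OF X Z _ d(1)] by metis
  then have "X \<inter> box a b = {}" using sub by blast
  moreover have "z \<in> cl n X" using * sub by blast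
  ultimately show False using *(1,2,4) nhd_box[of a n b z] unfolding mem_cl_iff_nhd by blast
qed

lemma dim_cl:
  assumes "X \<in> SM n" shows "dim (cl n X) = dim X"
proof (cases "X = {}")
  case True
  have "x \<notin> cl n {}" for x :: "'a list" using nhd_tuples[of x n] unfolding mem_cl_iff_nhd by blast
  then have "cl n ({} :: 'a list set) = {}" by blast
  then show ?thesis using True by simp
next
  case False
  then obtain k where k: "dim X = Some k" using dim_None[OF SN_I[OF assms]] by auto
  have c: "cl n X - X \<in> SM n" by (rule M.S_cl assms defs)+
  have "dim (cl n X - X) < Some k" by (rule dim_frontier_less[OF assms c]) (use k in auto)
  moreover have "cl n X = (cl n X - X) \<union> X" using subset_cl[OF M.S_subset[OF assms]] by blast
  ultimately show ?thesis using dim_Un[OF SN_I[OF c] SN_I[OF assms]] k by (metis max.strict_order_iff max.commute)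
qed

text \<open>The points of \<open>C\<close> at which some k coordinates serve as a local chart.
  Injectivity suffices, without openness of the image, because D6 will be applied to functions
  extended to all of M^k.\<close>

definition injective_points :: "nat \<Rightarrow> nat \<Rightarrow> 'a list set \<Rightarrow> 'a list set" where
  "injective_points n k C = {c \<in> C. \<exists>js\<in>{js \<in> idx n. length js = k}. \<exists>a\<in>tuples n. \<exists>b\<in>tuples n. c \<in> box a b \<and>
     (\<forall>x\<in>C. \<forall>y\<in>C. x \<in> box a b \<longrightarrow> y \<in> box a b \<longrightarrow> map ((!) x) js = map ((!) y) js \<longrightarrow> x = y)}"

lemma injective_points_SM:
  assumes "C \<in> SM n" shows "injective_points n k C \<in> SM n"
  unfolding injective_points_def
proof (rule M.S_Collect[OF assms], rule M.defpred_bex_fin)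
  fix js assume "js \<in> {js \<in> idx n. length js = k}"
  then have js: "set js \<subseteq> {..<n}" by (simp add: idx_def)
  show "defpred SM n (\<lambda>c. \<exists>a\<in>tuples n. \<exists>b\<in>tuples n. c \<in> box a b \<and>
     (\<forall>x\<in>C. \<forall>y\<in>C. x \<in> box a b \<longrightarrow> y \<in> box a b \<longrightarrow> map ((!) x) js = map ((!) y) js \<longrightarrow> x = y))"
    by (rule defs assms js)+
qed (simp add: finite_idx)

text \<open>If the exceptions had dimension k, \<open>uniform_box\<close> would find among them a
  point with an injective chart.\<close>

lemma dim_noninjective_points_less:
  assumes C: "C \<in> SM n" and k: "dim C \<le> Some k"
  shows "dim (C - injective_points n k C) < Some k"
proof (rule ccontr)
  let ?Z = "C - injective_points n k C"
  assume "\<not> dim ?Z < Some k"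
  have Z: "?Z \<in> SM n" by (rule defs injective_points_SM C)+
  have "dim ?Z \<le> dim C" by (rule dim_mono[OF SN_I[OF Z] SN_I[OF C]]) auto
  then have "dim ?Z = Some k" using k \<open>\<not> dim ?Z < Some k\<close> by auto
  then obtain js a b z where *: "js \<in> idx n" "length js = k" "length a = n" "length b = n"
    "z \<in> ?Z" "z \<in> box a b" "inj_on (\<lambda>x. map ((!) x) js) (C \<inter> box a b)"
    using uniform_box[OF C Z k] by metis
  have "js \<in> {js \<in> idx n. length js = k}" "a \<in> tuples n" "b \<in> tuples n" "z \<in> C"
    using *(1-5) by (auto simp: mem_tuples)
  moreover have "\<forall>x\<in>C. \<forall>y\<in>C. x \<in> box a b \<longrightarrow> y \<in> box a b \<longrightarrow> map ((!) x) js = map ((!) y) js \<longrightarrow> x = y"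
    using *(7) unfolding inj_on_def by blast
  ultimately have "z \<in> injective_points n k C"
    unfolding injective_points_def using *(6) by blast
  then show False using * by blast
qed

end

subsection \<open>Approximation by SM-definable graphs\<close>

lemma graph_eq_Collect:
  assumes "\<forall>x\<in>tuples n. t x \<in> tuples m"
  shows "{x @ t x | x. x \<in> tuples n} = {z \<in> tuples (n + m). drop n z = t (take n z)}"
proof (intro equalityI subsetI)
  fix z assume "z \<in> {z \<in> tuples (n + m). drop n z = t (take n z)}"
  then have "z = take n z @ t (take n z)" "take n z \<in> tuples n"
    by (metis (mono_tags, lifting) append_take_drop_id mem_Collect_eq) (use \<open>z \<in> _\<close> in \<open>auto simp: mem_tuples\<close>)
  then show "z \<in> {x @ t x | x. x \<in> tuples n}" by blast
qed (use assms in \<open>auto simp: mem_tuples\<close>)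

lemma defmap_iff_graph:
  assumes "\<forall>x\<in>tuples n. t x \<in> tuples m"
  shows "defmap S n m t \<longleftrightarrow> {x @ t x | x. x \<in> tuples n} \<in> S (n + m)"
  using assms by (simp add: graph_eq_Collect defmap_def defpred_def)

context tame_pair
begin

lemma defmap_generic_SM:
  assumes "defmap SN n m f"
  shows "\<exists>F D. defmap SM n m F \<and> D \<in> SN n \<and> dim D < Some n \<and> (\<forall>x\<in>tuples n - D. f x = F x)"
  using assms
proof (induction m arbitrary: f)
  case 0
  have "defmap SM n 0 (\<lambda>_. [])" by (rule M.defmap_const) simp
  moreover have "f x = []" if "x \<in> tuples n" for x
    using that 0 defmap_length by (fastforce simp: mem_tuples)
  ultimately show ?case using N.S_empty by (intro exI[of _ "\<lambda>_. []"] exI[of _ "{}"]) auto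
next
  case (Suc m)
  have f: "defmap SN n (m + 1) f" using Suc.prems by simp
  have lf: "length (f x) = m + 1" if "x \<in> tuples n" for x using defmap_length[OF f] that by (simp add: mem_tuples)
  obtain F1 D1 where 1: "defmap SM n m F1" "D1 \<in> SN n" "dim D1 < Some n" "\<forall>x\<in>tuples n - D1. take m (f x) = F1 x"
    using Suc.IH[OF N.defmap_take_of[OF f]] by blast
  have last: "drop m (f x) = [f x ! m]" if "x \<in> tuples n" for x
    using lf[OF that] by (simp add: Cons_nth_drop_Suc[symmetric])
  have "defmap SN n 1 (\<lambda>x. drop m (f x))" by (rule N.defmap_drop_of[OF f])
  then have "defmap SN n 1 (\<lambda>x. [f x ! m])"
    by (rule defmap_cong[THEN iffD1, rotated]) (use last in \<open>simp add: mem_tuples\<close>)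
  then have "{x @ [f x ! m] | x. x \<in> tuples n} \<in> SN (Suc n)"
    using defmap_iff_graph[of n "\<lambda>x. [f x ! m]" 1 SN] by (simp add: mem_tuples)
  from generic_SM[OF this] obtain F2 D2 where 2: "{x @ [F2 x] | x. x \<in> tuples n} \<in> SM (Suc n)"
    "D2 \<in> SN n" "dim D2 < Some n" "\<forall>x\<in>tuples n - D2. f x ! m = F2 x" by blast
  have "defmap SM n 1 (\<lambda>x. [F2 x])"
    using defmap_iff_graph[of n "\<lambda>x. [F2 x]" 1 SM] 2(1) by (simp add: mem_tuples)
  then have "defmap SM n (Suc m) (\<lambda>x. F1 x @ [F2 x])" using M.defmap_append[OF 1(1)] by fastforce
  moreover have "D1 \<union> D2 \<in> SN n" "dim (D1 \<union> D2) < Some n"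
    using 1 2 by (auto intro: N.S_Un dim_less_Un)
  moreover have "f x = F1 x @ [F2 x]" if "x \<in> tuples n - (D1 \<union> D2)" for x
    using that 1(4) 2(4) last[of x] append_take_drop_id[of m "f x"] by auto
  ultimately show ?case by (intro exI[of _ "\<lambda>x. F1 x @ [F2 x]"] exI[of _ "D1 \<union> D2"]) auto
qed

lemma dim_less_over:
  assumes B: "B \<in> SN (n + m)" and inj: "inj_on (take n) B" and D: "D \<in> SN n" "dim D < d"
    and sub: "take n ` B \<subseteq> D"
  shows "dim B < d"
proof -
  have "dim B \<le> dim D"
    by (rule dim_le_rel[OF B D(1), where R = "\<lambda>z x. take n z = x"])
      ((rule defs)+, use inj sub in \<open>auto simp: inj_on_def\<close>)
  then show ?thesis using D(2) by order
qed

text \<open>D6 applies to total functions, while \<open>\<Gamma>\<close> is the graph of a function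
  on a part of M^k, and this part has to be approximated as well. The extended function
  \<open>f\<close> therefore has one more coordinate recording membership in the domain: p inside, q
  outside. \<open>A\<close> keeps the points where the approximation \<open>F\<close> shows the flag
  p, so both differences lie over the exceptional set \<open>D\<close>.\<close>

lemma approx_open:
  assumes \<Gamma>: "\<Gamma> \<in> SN (k + m)" and inj: "inj_on (take k) \<Gamma>"
  obtains A where "A \<in> SM (k + m)" "inj_on (take k) A" "dim (A - \<Gamma>) < Some k" "dim (\<Gamma> - A) < Some k"
proof -
  obtain p q :: 'a where pq: "p < q" using gt_ex by blast
  define f where "f x = (if \<exists>y\<in>tuples m. x @ y \<in> \<Gamma> then (SOME y. y \<in> tuples m \<and> x @ y \<in> \<Gamma>) @ [p]
     else replicate m p @ [q])" for x
  have f1: "f x = y @ [p]" if "length x = k" "length y = m" "x @ y \<in> \<Gamma>" for x y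
  proof -
    have ex: "\<exists>y. y \<in> tuples m \<and> x @ y \<in> \<Gamma>" using that by (auto simp: mem_tuples)
    define y' where "y' = (SOME y. y \<in> tuples m \<and> x @ y \<in> \<Gamma>)"
    have "y' \<in> tuples m \<and> x @ y' \<in> \<Gamma>" unfolding y'_def by (rule someI_ex[OF ex])
    then have "x @ y' = x @ y" using that inj_onD[OF inj, of "x @ y'" "x @ y"] by simp
    then show ?thesis using ex unfolding f_def y'_def[symmetric] by auto
  qed
  have f2: "f x = replicate m p @ [q]" if "\<not> (\<exists>y\<in>tuples m. x @ y \<in> \<Gamma>)" for x
    using that by (simp add: f_def)
  have iff: "f x = u @ [p] \<longleftrightarrow> x @ u \<in> \<Gamma>" if "length x = k" "length u = m" for x u
  proof (cases "\<exists>y\<in>tuples m. x @ y \<in> \<Gamma>")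
    case True
    then obtain y where y: "length y = m" "x @ y \<in> \<Gamma>" by (auto simp: mem_tuples)
    have "u = y" if "x @ u \<in> \<Gamma>" using inj_onD[OF inj _ that y(2)] \<open>length x = k\<close> by simp
    then show ?thesis using f1[OF that(1) y] y by auto
  next
    case False
    then show ?thesis using f2[OF False] that pq by (auto simp: mem_tuples)
  qed
  have fl: "\<forall>x\<in>tuples k. f x \<in> tuples (m + 1)"
  proof
    fix x :: "'a list" assume x: "x \<in> tuples k"
    show "f x \<in> tuples (m + 1)"
    proof (cases "\<exists>y\<in>tuples m. x @ y \<in> \<Gamma>")
      case True
      then obtain y where y: "length y = m" "x @ y \<in> \<Gamma>" by (auto simp: mem_tuples)
      then show ?thesis using f1[OF _ y] x by (simp add: mem_tuples)
    qed (use f2 in \<open>simp add: mem_tuples\<close>)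
  qed
  have "defmap SN k (m + 1) f"
    unfolding defmap_def
  proof (intro conjI fl)
    have len: "length (replicate m p @ [q]) = m + 1" "length [p] = 1" by simp_all
    have "defpred SN (k + (m + 1)) (\<lambda>z. (take k z @ take m (drop k z) \<in> \<Gamma> \<and> drop m (drop k z) = [p]) \<or>
      ((\<forall>y\<in>tuples m. take k z @ y \<notin> \<Gamma>) \<and> drop k z = replicate m p @ [q]))"
      by (rule N.defmap_const[OF len(1)] N.defmap_const[OF len(2)] \<Gamma> defs)+
    then show "defpred SN (k + (m + 1)) (\<lambda>z. drop k z = f (take k z))"
    proof (rule defpred_cong[THEN iffD1, rotated])
      fix z :: "'a list" assume l: "length z = k + (m + 1)"
      define x v where "x = take k z" and "v = drop k z"
      have lx: "length x = k" "length v = m + 1" using l by (auto simp: x_def v_def)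
      have v: "v = take m v @ drop m v" "length (take m v) = m" using lx by auto
      have "(x @ take m v \<in> \<Gamma> \<and> drop m v = [p] \<or> (\<forall>y\<in>tuples m. x @ y \<notin> \<Gamma>) \<and> v = replicate m p @ [q]) = (v = f x)"
      proof (cases "\<exists>y\<in>tuples m. x @ y \<in> \<Gamma>")
        case True
        then obtain y where y: "length y = m" "x @ y \<in> \<Gamma>" by (auto simp: mem_tuples)
        have "x @ take m v \<in> \<Gamma> \<Longrightarrow> take m v = y" using inj_onD[OF inj _ _ y(2), of "x @ take m v"] lx by simp
        then have "x @ take m v \<in> \<Gamma> \<and> drop m v = [p] \<longleftrightarrow> take m v = y \<and> drop m v = [p]" using y by auto
        also have "\<dots> \<longleftrightarrow> v = y @ [p]" using v y by (metis append_eq_append_conv)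
        finally show ?thesis using True f1[OF lx(1) y] by auto
      next
        case False
        then have "x @ take m v \<notin> \<Gamma>" using v by (auto simp: mem_tuples)
        then show ?thesis using False f2[OF False] by auto
      qed
      then show "(take k z @ take m (drop k z) \<in> \<Gamma> \<and> drop m (drop k z) = [p] \<or>
        (\<forall>y\<in>tuples m. take k z @ y \<notin> \<Gamma>) \<and> drop k z = replicate m p @ [q]) = (drop k z = f (take k z))"
        by (simp add: x_def v_def)
    qed
  qed
  from defmap_generic_SM[OF this] obtain F D where F: "defmap SM k (m + 1) F" and D: "D \<in> SN k" "dim D < Some k"
    and fF: "\<forall>x\<in>tuples k - D. f x = F x" by blast
  define A where "A = {z \<in> tuples (k + m). F (take k z) = drop k z @ [p]}"
  have len: "length [p] = 1" by simp
  have A: "A \<in> SM (k + m)" unfolding A_def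
    by (rule M.S_Collect) (rule F M.defmap_const[OF len] M.defmap_take[OF F] defs)+
  have injA: "inj_on (take k) A"
    by (rule inj_onI) (auto simp: A_def, metis append_take_drop_id)
  have l: "length z = k + m" if "z \<in> A \<union> \<Gamma>" for z
    using that N.S_lengthD[OF \<Gamma>] M.S_lengthD[OF A] by blast
  have in\<Gamma>: "z \<in> \<Gamma> \<longleftrightarrow> f (take k z) = drop k z @ [p]" if "length z = k + m" for z
    using iff[of "take k z" "drop k z"] that by simp
  have "take k z \<in> D" if "z \<in> (A - \<Gamma>) \<union> (\<Gamma> - A)" for z
  proof (rule ccontr)
    assume "take k z \<notin> D"
    moreover have lz: "length z = k + m" using l that by blast
    ultimately have "f (take k z) = F (take k z)" using fF by (simp add: mem_tuples)
    then show False using that in\<Gamma>[OF lz] lz by (auto simp: A_def mem_tuples)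
  qed
  then have "take k ` (A - \<Gamma>) \<subseteq> D" "take k ` (\<Gamma> - A) \<subseteq> D" by blast+
  moreover have "A - \<Gamma> \<in> SN (k + m)" "\<Gamma> - A \<in> SN (k + m)" by (rule defs SN_I[OF A] \<Gamma>)+
  moreover have "inj_on (take k) (A - \<Gamma>)" "inj_on (take k) (\<Gamma> - A)"
    using inj injA by (auto intro: inj_on_diff)
  ultimately have "dim (A - \<Gamma>) < Some k" "dim (\<Gamma> - A) < Some k"
    using dim_less_over[OF _ _ D] by blast+
  then show thesis using that A injA by blast
qed

text \<open>A chart injective on \<open>C\<close> inside the box carries the part of
  \<open>\<Gamma>\<close> over the box to a graph over k coordinates, where
  \<open>approx_open\<close> applies; the approximation is pulled back to \<open>C\<close>. Over the
  box the two sets agree up to dimension less than k, and \<open>A\<close> has no points elsewhere,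
  so \<open>A - \<Gamma>\<close> is small without restriction.\<close>

lemma approx_local:
  assumes \<Gamma>: "\<Gamma> \<in> SN (n + m)" and inj\<Gamma>: "inj_on (take n) \<Gamma>" and sub: "take n ` \<Gamma> \<subseteq> C"
    and C: "C \<in> SM n" and ab: "length a = n" "length b = n"
    and js: "set js \<subseteq> {..<n}" "length js = k"
    and inj: "\<forall>x\<in>C. \<forall>y\<in>C. x \<in> box a b \<longrightarrow> y \<in> box a b \<longrightarrow> map ((!) x) js = map ((!) y) js \<longrightarrow> x = y"
  obtains A where "A \<in> SM (n + m)" "inj_on (take n) A" "take n ` A \<subseteq> C" "dim (A - \<Gamma>) < Some k"
    "dim ({z \<in> \<Gamma>. take n z \<in> box a b} - A) < Some k"
proof -
  let ?p = "\<lambda>x. map ((!) x) js"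
  have pM: "defmap SM l k (\<lambda>z. ?p (t z))" if "defmap SM l n t" for l t
    using M.defmap_map_nth[OF that js(1)] js(2) by simp
  have pN: "defmap SN l k (\<lambda>z. ?p (t z))" if "defmap SN l n t" for l t
    using N.defmap_map_nth[OF that js(1)] js(2) by simp
  have l\<Gamma>: "length z = n + m" if "z \<in> \<Gamma>" for z using that N.S_lengthD[OF \<Gamma>] by blast
  have td: "z = z'" if "take n z = take n z'" "drop n z = drop n z'" for z z' :: "'a list"
    using that by (metis append_take_drop_id)
  define G where "G = {w \<in> tuples (k + m). \<exists>z\<in>\<Gamma>. take n z \<in> box a b \<and> ?p (take n z) = take k w \<and> drop n z = drop k w}"
  have G: "G \<in> SN (k + m)" unfolding G_def
    by (rule N.S_Collect) (rule pN \<Gamma> ab defs)+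
  have inG: "?p (take n z) @ drop n z \<in> G" if "z \<in> \<Gamma>" "take n z \<in> box a b" for z
    using that l\<Gamma>[OF that(1)] js(2) by (auto simp: G_def mem_tuples)
  have injG: "inj_on (take k) G"
  proof (rule inj_onI)
    fix w w' assume w: "w \<in> G" "w' \<in> G" "take k w = take k w'"
    then obtain z z' where z: "z \<in> \<Gamma>" "take n z \<in> box a b" "?p (take n z) = take k w" "drop n z = drop k w"
      "z' \<in> \<Gamma>" "take n z' \<in> box a b" "?p (take n z') = take k w'" "drop n z' = drop k w'"
      unfolding G_def by blast
    then have "take n z = take n z'" using inj sub w(3) by (metis image_subset_iff)
    then have "z = z'" using inj_onD[OF inj\<Gamma>] z by blast
    then show "w = w'" using z w(3) by (metis append_take_drop_id)
  qed
  obtain B where B: "B \<in> SM (k + m)" "inj_on (take k) B" "dim (B - G) < Some k" "dim (G - B) < Some k"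
    using approx_open[OF G injG] by blast
  define A where "A = {z \<in> tuples (n + m). take n z \<in> C \<and> take n z \<in> box a b \<and> ?p (take n z) @ drop n z \<in> B}"
  have A: "A \<in> SM (n + m)" unfolding A_def by (rule M.S_Collect) (rule pM B ab C defs)+
  have AC: "take n ` A \<subseteq> C" by (auto simp: A_def)
  have injA: "inj_on (take n) A"
  proof (rule inj_onI)
    fix z z' assume z: "z \<in> A" "z' \<in> A" "take n z = take n z'"
    then have "?p (take n z) @ drop n z = ?p (take n z') @ drop n z'"
      using js(2) inj_onD[OF B(2), of "?p (take n z) @ drop n z" "?p (take n z') @ drop n z'"] by (simp add: A_def)
    then show "z = z'" using z(3) td by auto
  qed
  have inj2: "z = z'" if "?p (take n z) @ drop n z = ?p (take n z') @ drop n z'"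
    "take n z \<in> C" "take n z' \<in> C" "take n z \<in> box a b" "take n z' \<in> box a b" for z z'
    using that inj td by (metis append_eq_append_conv length_map)
  have A\<Gamma>: "A - \<Gamma> \<in> SN (n + m)" by (rule defs SN_I[OF A] \<Gamma>)+
  have BG: "B - G \<in> SN (k + m)" "G - B \<in> SN (k + m)" by (rule defs SN_I[OF B(1)] G)+
  have R: "defpred SN (n + m + (k + m)) (\<lambda>z. ?p (take n (take (n + m) z)) @ drop n (take (n + m) z) = drop (n + m) z)"
    by (rule pN defs)+
  have "dim (A - \<Gamma>) \<le> dim (B - G)"
  proof (rule dim_le_rel[OF A\<Gamma> BG(1), where R = "\<lambda>z w. ?p (take n z) @ drop n z = w", OF R])
    fix z assume z: "z \<in> A - \<Gamma>"
    have "?p (take n z) @ drop n z \<notin> G"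
    proof
      assume "?p (take n z) @ drop n z \<in> G"
      then obtain z0 where z0: "z0 \<in> \<Gamma>" "take n z0 \<in> box a b" "?p (take n z0) = ?p (take n z)" "drop n z0 = drop n z"
        using js(2) by (auto simp: G_def)
      then have "z0 = z" using inj2[of z0 z] z sub by (auto simp: A_def)
      then show False using z z0 by blast
    qed
    then show "\<exists>w\<in>B - G. ?p (take n z) @ drop n z = w" using z by (auto simp: A_def)
  next
    fix z z' w assume "z \<in> A - \<Gamma>" "z' \<in> A - \<Gamma>" "?p (take n z) @ drop n z = w" "?p (take n z') @ drop n z' = w"
    then show "z = z'" using inj2[of z z'] by (auto simp: A_def)
  qed
  moreover have "{z \<in> \<Gamma>. take n z \<in> box a b} \<in> SN (n + m)" by (rule N.S_Collect) (rule \<Gamma> ab defs)+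
  then have \<Gamma>A: "{z \<in> \<Gamma>. take n z \<in> box a b} - A \<in> SN (n + m)" by (intro N.S_Diff SN_I[OF A])
  have "dim ({z \<in> \<Gamma>. take n z \<in> box a b} - A) \<le> dim (G - B)"
  proof (rule dim_le_rel[OF \<Gamma>A BG(2), where R = "\<lambda>z w. ?p (take n z) @ drop n z = w", OF R])
    fix z assume z: "z \<in> {z \<in> \<Gamma>. take n z \<in> box a b} - A"
    then have "?p (take n z) @ drop n z \<notin> B" using l\<Gamma>[of z] sub by (auto simp: A_def mem_tuples)
    then show "\<exists>w\<in>G - B. ?p (take n z) @ drop n z = w" using inG z by blast
  next
    fix z z' w assume "z \<in> {z \<in> \<Gamma>. take n z \<in> box a b} - A" "z' \<in> {z \<in> \<Gamma>. take n z \<in> box a b} - A"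
      "?p (take n z) @ drop n z = w" "?p (take n z') @ drop n z' = w"
    then show "z = z'" using inj2[of z z'] sub by auto
  qed
  ultimately show thesis using that A injA AC B(3,4) by (meson order.strict_trans1)
qed

lemma drop_in_box_ex:
  fixes z :: "'a list"
  assumes "length z = n + m"
  obtains p q where "length p = m" "length q = m" "drop n z \<in> box p q"
proof -
  have "nhd m (drop n z) (tuples m)" by (rule nhd_tuples) (use assms in simp)
  then show thesis using that unfolding nhd_def by blast
qed

text \<open>The essential closure of \<open>\<Gamma>\<close>, the set of points all of whose neighbourhoods meet \<open>\<Gamma>\<close> in full
  dimension, is closed and hence definable in \<open>SM\<close>.\<close>

theorem approx_SM:
  assumes C: "C \<in> SM n" and k: "dim C \<le> Some k"
    and \<Gamma>: "\<Gamma> \<in> SN (n + m)" and inj\<Gamma>: "inj_on (take n) \<Gamma>" and sub: "take n ` \<Gamma> \<subseteq> C"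
  obtains E where "E \<in> SM (n + m)" "inj_on (take n) E" "dim (E - \<Gamma>) < Some k" "dim (\<Gamma> - E) < Some k"
proof -
  have l\<Gamma>: "length z = n + m" if "z \<in> \<Gamma>" for z using that N.S_lengthD[OF \<Gamma>] by blast
  define C0 where "C0 = injective_points n k C"
  have C0: "C0 \<in> SM n" unfolding C0_def by (rule injective_points_SM[OF C])
  have CC0: "C - C0 \<in> SN n" by (rule defs SN_I C C0)+
  have dC0: "dim (C - C0) < Some k" unfolding C0_def by (rule dim_noninjective_points_less[OF C k])
  define ess where "ess = {z \<in> tuples (n + m). \<forall>a\<in>tuples (n + m). \<forall>b\<in>tuples (n + m). z \<in> box a b \<longrightarrow>
     \<not> dim {x \<in> tuples (n + m). x \<in> box a b \<and> x \<in> \<Gamma>} < Some k}"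
  have eq: "{x \<in> tuples (n + m). x \<in> box a b \<and> x \<in> \<Gamma>} = box a b \<inter> \<Gamma>" for a b
    using l\<Gamma> by (auto simp: mem_tuples)
  have essN: "ess \<in> SN (n + m)" unfolding ess_def by (rule N.S_Collect) (rule \<Gamma> defs)+
  have "open_tuples (n + m) (tuples (n + m) - ess)"
    unfolding open_tuples_iff_nhd
  proof (intro conjI ballI)
    fix z assume z: "z \<in> tuples (n + m) - ess"
    then obtain a b where ab: "length a = n + m" "length b = n + m" "z \<in> box a b"
      "dim {x \<in> tuples (n + m). x \<in> box a b \<and> x \<in> \<Gamma>} < Some k"
      by (auto simp: ess_def mem_tuples)
    have "y \<in> tuples (n + m) - ess" if "y \<in> box a b" for y
    proof -
      have "a \<in> tuples (n + m)" "b \<in> tuples (n + m)" using ab by (simp_all add: mem_tuples)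
      then have "y \<notin> ess" using that ab(4) unfolding ess_def by blast
      moreover have "y \<in> tuples (n + m)" using that ab by (simp add: mem_box mem_tuples)
      ultimately show ?thesis by blast
    qed
    then show "nhd (n + m) z (tuples (n + m) - ess)" using nhd_mono[OF nhd_box[OF ab(1-3)]] by blast
  qed auto
  then have "tuples (n + m) - ess \<in> SM (n + m)" using open_SM N.S_compl[OF essN] by blast
  from M.S_compl[OF this] have ess: "ess \<in> SM (n + m)" by (simp add: ess_def double_diff)
  \<comment> \<open>Local approximations exist only at chart points; the part of
    \<open>\<Gamma>\<close> over the other points of \<open>C\<close> has dimension less than
    k.\<close>
  define E0 where "E0 = {z \<in> ess. take n z \<in> C0}"
  have E0: "E0 \<in> SM (n + m)" unfolding E0_def by (rule M.S_Collect) (rule ess C0 defs)+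
  have E0\<Gamma>: "E0 - \<Gamma> \<in> SN (n + m)" by (rule defs SN_I[OF E0] \<Gamma>)+
  have small1: "dim (\<Gamma> - E0) < Some k"
  proof -
    have 1: "{z \<in> \<Gamma>. take n z \<in> C - C0} \<in> SN (n + m)" by (rule N.S_Collect) (rule \<Gamma> CC0 N.defpred_mem[OF CC0] defs)+
    have 2: "\<Gamma> - ess \<in> SN (n + m)" by (rule defs essN \<Gamma>)+
    have "dim {z \<in> \<Gamma>. take n z \<in> C - C0} < Some k"
      by (rule dim_less_over[OF 1 _ CC0 dC0]) (use inj\<Gamma> in \<open>auto simp: inj_on_def\<close>)
    moreover have "dim (\<Gamma> - ess) < Some k"
    proof (rule dim_less_if_locally[OF 2])
      fix z assume z: "z \<in> \<Gamma> - ess"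
      then obtain a b where ab: "length a = n + m" "length b = n + m" "z \<in> box a b"
        "dim (box a b \<inter> \<Gamma>) < Some k"
        using l\<Gamma>[of z] unfolding ess_def eq by (auto simp: mem_tuples)
      have "dim (box a b \<inter> (\<Gamma> - ess)) < Some k"
        by (rule dim_less_mono[OF _ ab(4)]) ((rule defs ab \<Gamma> essN)+ | blast)+
      then show "\<exists>a b. length a = n + m \<and> length b = n + m \<and> z \<in> box a b \<and> dim (box a b \<inter> (\<Gamma> - ess)) < Some k"
        using ab by blast
    qed
    ultimately have "dim ({z \<in> \<Gamma>. take n z \<in> C - C0} \<union> (\<Gamma> - ess)) < Some k"
      by (rule dim_less_Un[OF 1 2])
    moreover have "\<Gamma> - E0 \<in> SN (n + m)" by (rule defs SN_I[OF E0] \<Gamma>)+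
    ultimately show ?thesis using sub
      by (elim dim_less_mono[OF N.S_Un[OF 1 2], rotated 2]) (auto simp: E0_def)
  qed
  \<comment> \<open>Near a point of \<open>E0\<close> take a local approximation \<open>A\<close> of
    \<open>\<Gamma>\<close>. A neighbourhood of w inside the box that missed \<open>A\<close> would
    meet \<open>\<Gamma>\<close> in dimension less than k, contrary to w being in
    \<open>ess\<close>; so w lies in the closure of \<open>A\<close>. Hence
    \<open>E0 - \<Gamma>\<close> is locally contained in the union of the frontier of
    \<open>A\<close> and \<open>A - \<Gamma>\<close>, both of which are small.\<close>
  have small2: "dim (E0 - \<Gamma>) < Some k"
  proof (rule dim_less_if_locally[OF E0\<Gamma>])
    fix z assume z: "z \<in> E0 - \<Gamma>"
    then have lz: "length z = n + m" using E0 M.S_lengthD by blast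
    obtain js a b where js: "js \<in> idx n" "length js = k" and ab: "length a = n" "length b = n" "take n z \<in> box a b"
      and inj: "\<forall>x\<in>C. \<forall>y\<in>C. x \<in> box a b \<longrightarrow> y \<in> box a b \<longrightarrow> map ((!) x) js = map ((!) y) js \<longrightarrow> x = y"
    proof -
      have "take n z \<in> injective_points n k C" using z by (simp add: E0_def C0_def)
      then show thesis using that unfolding injective_points_def mem_Collect_eq mem_tuples[symmetric] by blast
    qed
    have jsn: "set js \<subseteq> {..<n}" using js by (simp add: idx_def)
    obtain A where A: "A \<in> SM (n + m)" "inj_on (take n) A" "take n ` A \<subseteq> C" "dim (A - \<Gamma>) < Some k"
      "dim ({z \<in> \<Gamma>. take n z \<in> box a b} - A) < Some k"
      using approx_local[OF \<Gamma> inj\<Gamma> sub C ab(1,2) jsn js(2) inj] by blast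
    obtain p q where pq: "length p = m" "length q = m" "drop n z \<in> box p q"
      using drop_in_box_ex[OF lz] by blast
    let ?B = "box (a @ p) (b @ q)"
    have lB: "length (a @ p) = n + m" "length (b @ q) = n + m" using ab pq by auto
    have zB: "z \<in> ?B" using box_append[of "take n z" a b "drop n z" p q] lz ab pq by simp
    have takeB: "take n w \<in> box a b" if "w \<in> ?B" for w
    proof -
      have "length w = n + m" using that lB by (simp add: mem_box)
      then show ?thesis using box_append[of "take n w" a b "drop n w" p q] that ab by simp
    qed
    have dA: "dim A \<le> Some k"
    proof -
      have "dim A \<le> dim C"
        by (rule dim_le_rel[OF SN_I[OF A(1)] SN_I[OF C], where R = "\<lambda>z x. take n z = x"])
          ((rule defs)+, use A(2,3) in \<open>auto simp: inj_on_def\<close>)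
      then show ?thesis using k by order
    qed
    have clA: "cl (n + m) A - A \<in> SM (n + m)" by (rule M.S_cl A defs)+
    have "dim (cl (n + m) A - A) < Some k" by (rule dim_frontier_less[OF A(1) clA _ dA]) auto
    moreover have A\<Gamma>: "A - \<Gamma> \<in> SN (n + m)" by (rule defs SN_I[OF A(1)] \<Gamma>)+
    ultimately have "dim ((cl (n + m) A - A) \<union> (A - \<Gamma>)) < Some k"
      using dim_less_Un[OF SN_I[OF clA] A\<Gamma>] A(4) by blast
    moreover have "?B \<inter> (E0 - \<Gamma>) \<subseteq> (cl (n + m) A - A) \<union> (A - \<Gamma>)"
    proof
      fix w assume w: "w \<in> ?B \<inter> (E0 - \<Gamma>)"
      have "w \<in> cl (n + m) A"
        unfolding mem_cl_iff_nhd
      proof (intro conjI allI impI notI)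
        show "length w = n + m" using w lB by (simp add: mem_box)
        fix U assume "nhd (n + m) w U" and UA: "U \<inter> A = {}"
        then have "nhd (n + m) w (U \<inter> ?B)" using w by (intro nhd_Int nhd_box[OF lB]) auto
        then obtain c d where cd: "length c = n + m" "length d = n + m" "w \<in> box c d" "box c d \<subseteq> U \<inter> ?B"
          unfolding nhd_def by blast
        have "box c d \<inter> \<Gamma> \<subseteq> {z \<in> \<Gamma>. take n z \<in> box a b} - A" using cd(4) UA takeB by blast
        moreover have "box c d \<inter> \<Gamma> \<in> SN (n + m)" by (rule defs cd \<Gamma>)+
        moreover have "{z \<in> \<Gamma>. take n z \<in> box a b} \<in> SN (n + m)" by (rule N.S_Collect) (rule \<Gamma> ab defs)+
        then have "{z \<in> \<Gamma>. take n z \<in> box a b} - A \<in> SN (n + m)" by (rule N.S_Diff[OF _ SN_I[OF A(1)]])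
        ultimately have "dim (box c d \<inter> \<Gamma>) < Some k" using dim_less_mono A(5) by blast
        moreover have "c \<in> tuples (n + m)" "d \<in> tuples (n + m)" using cd by (auto simp: mem_tuples)
        moreover have "w \<in> ess" using w by (simp add: E0_def)
        ultimately show False using cd(3) unfolding ess_def eq by blast
      qed
      then show "w \<in> (cl (n + m) A - A) \<union> (A - \<Gamma>)" using w by blast
    qed
    moreover have "?B \<inter> (E0 - \<Gamma>) \<in> SN (n + m)" by (rule N.S_Int[OF N.S_box[OF lB] E0\<Gamma>])
    ultimately have "dim (?B \<inter> (E0 - \<Gamma>)) < Some k"
      using dim_less_mono[OF N.S_Un[OF SN_I[OF clA] A\<Gamma>]] by blast
    then show "\<exists>a b. length a = n + m \<and> length b = n + m \<and> z \<in> box a b \<and> dim (box a b \<inter> (E0 - \<Gamma>)) < Some k"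
      using lB zB by blast
  qed
  \<comment> \<open>\<open>E0\<close> need not be a graph. Dropping every point that shares its
    first n coordinates with another point of \<open>E0\<close> costs only points of
    \<open>\<Gamma>\<close> accompanied by a point of \<open>E0 - \<Gamma>\<close>, and that set
    bounds their dimension.\<close>
  define E where "E = {z \<in> E0. \<forall>z'\<in>E0. take n z' = take n z \<longrightarrow> z' = z}"
  have E: "E \<in> SM (n + m)" unfolding E_def by (rule M.S_Collect) (rule E0 defs)+
  have "inj_on (take n) E" by (auto simp: inj_on_def E_def)
  moreover have "E - \<Gamma> \<in> SN (n + m)" by (rule N.S_Diff[OF SN_I[OF E] \<Gamma>])
  then have "dim (E - \<Gamma>) < Some k"
    by (rule dim_less_mono[OF E0\<Gamma> small2, rotated]) (auto simp: E_def)
  moreover have "dim (\<Gamma> - E) < Some k"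
  proof -
    let ?R = "{z \<in> \<Gamma>. \<exists>z'\<in>E0 - \<Gamma>. take n z' = take n z}"
    have R: "?R \<in> SN (n + m)" by (rule N.S_Collect[OF \<Gamma>]) (rule N.defpred_bex[OF E0\<Gamma>] defs)+
    have "dim ?R \<le> dim (E0 - \<Gamma>)"
      by (rule dim_le_rel[OF R E0\<Gamma>, where R = "\<lambda>z z'. take n z' = take n z"])
        ((rule defs)+, use inj\<Gamma> in \<open>auto simp: inj_on_def\<close>)
    then have "dim ?R < Some k" using small2 by order
    moreover have G0: "\<Gamma> - E0 \<in> SN (n + m)" by (rule defs SN_I[OF E0] \<Gamma>)+
    ultimately have "dim ((\<Gamma> - E0) \<union> ?R) < Some k" using dim_less_Un[OF G0 R small1] by blast
    moreover have "\<Gamma> - E \<subseteq> (\<Gamma> - E0) \<union> ?R"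
    proof
      fix z assume z: "z \<in> \<Gamma> - E"
      show "z \<in> (\<Gamma> - E0) \<union> ?R"
      proof (cases "z \<in> E0")
        case True
        then obtain z' where z': "z' \<in> E0" "take n z' = take n z" "z' \<noteq> z" using z by (auto simp: E_def)
        then have "z' \<notin> \<Gamma>" using z inj_onD[OF inj\<Gamma>, of z' z] by blast
        then show ?thesis using z z' by blast
      qed (use z in blast)
    qed
    moreover have "\<Gamma> - E \<in> SN (n + m)" by (rule defs SN_I[OF E] \<Gamma>)+
    ultimately show ?thesis using dim_less_mono[OF N.S_Un[OF G0 R]] by blast
  qed
  ultimately show thesis using that E by blast
qed

end

subsection \<open>Generic elements of the group\<close>

locale tame_group = tame_pair SM SN dim
  for SM SN :: "nat \<Rightarrow> 'a::{dense_linorder, no_top, no_bot} list set set" and dim +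
  fixes G :: "'a list monoid" (structure) and n k :: nat and C :: "'a list set"
  assumes defgroup: "definable_group SN n G"
    and C: "C \<in> SM n" and GC: "carrier G \<subseteq> C"
    and dim_C: "dim C = Some k" and dim_G: "dim (carrier G) = Some k"
begin

sublocale group G
  using defgroup by (simp add: definable_group_def)

lemma G_SN: "carrier G \<in> SN n"
  using defgroup by (simp add: definable_group_def)

lemma length_G: "x \<in> carrier G \<Longrightarrow> length x = n"
  using G_SN N.S_lengthD by blast

text \<open>A relation, because \<open>x \<otimes> y\<close> is unspecified outside the carrier and
  so need not be a definable map on all tuples.\<close>

definition Mult :: "'a list \<Rightarrow> 'a list \<Rightarrow> 'a list \<Rightarrow> bool" where
  "Mult x y w \<longleftrightarrow> x \<in> carrier G \<and> y \<in> carrier G \<and> w = x \<otimes> y"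

lemma mult_graph_SN: "{x @ y @ (x \<otimes> y) | x y. x \<in> carrier G \<and> y \<in> carrier G} \<in> SN (n + (n + n))"
  using defgroup by (simp add: definable_group_def numeral_3_eq_3)

lemma mem_mult_graph:
  assumes "length x = n" "length y = n"
  shows "x @ y @ w \<in> {x @ y @ (x \<otimes> y) | x y. x \<in> carrier G \<and> y \<in> carrier G} \<longleftrightarrow> Mult x y w"
proof
  assume "x @ y @ w \<in> {x @ y @ (x \<otimes> y) | x y. x \<in> carrier G \<and> y \<in> carrier G}"
  then obtain x' y' where xy: "x' \<in> carrier G" "y' \<in> carrier G" "x @ y @ w = x' @ y' @ (x' \<otimes> y')" by blast
  then have "x = x'" "y = y'" "w = x' \<otimes> y'" using assms length_G by auto
  then show "Mult x y w" using xy by (simp add: Mult_def)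
qed (auto simp: Mult_def)

lemma defpred_Mult [defs]:
  assumes "defmap SN m n s" "defmap SN m n t" "defmap SN m n u"
  shows "defpred SN m (\<lambda>z. Mult (s z) (t z) (u z))"
proof -
  have "defpred SN m (\<lambda>z. s z @ t z @ u z \<in> {x @ y @ (x \<otimes> y) | x y. x \<in> carrier G \<and> y \<in> carrier G})"
    by (rule N.defpred_mem[OF mult_graph_SN] N.defmap_append assms)+
  then show ?thesis
    by (rule defpred_cong[THEN iffD1, rotated]) (rule mem_mult_graph, use assms in \<open>auto simp: defmap_length\<close>)
qed

text \<open>The filter of sets containing almost all of \<open>G\<close>. Definability is asked of
  the exceptional set \<open>D\<close> and not of \<open>P\<close>, so generic statements can be
  combined by \<open>eventually_elim\<close> without side conditions. That the filter is proper is
  \<open>gen_ex\<close>.\<close>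

definition gen :: "'a list filter" where
  "gen = Abs_filter (\<lambda>P. \<exists>D\<in>SN n. dim D < Some k \<and> (\<forall>x\<in>carrier G - D. P x))"

lemma eventually_gen: "eventually P gen \<longleftrightarrow> (\<exists>D\<in>SN n. dim D < Some k \<and> (\<forall>x\<in>carrier G - D. P x))"
  unfolding gen_def
proof (rule eventually_Abs_filter, rule is_filter.intro)
  show "\<exists>D\<in>SN n. dim D < Some k \<and> (\<forall>x\<in>carrier G - D. True)"
    using N.S_empty by (intro bexI[of _ "{}"]) auto
next
  fix P Q
  assume "\<exists>D\<in>SN n. dim D < Some k \<and> (\<forall>x\<in>carrier G - D. P x)"
    "\<exists>D\<in>SN n. dim D < Some k \<and> (\<forall>x\<in>carrier G - D. Q x)"
  then obtain D D' where "D \<in> SN n" "dim D < Some k" "\<forall>x\<in>carrier G - D. P x"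
    "D' \<in> SN n" "dim D' < Some k" "\<forall>x\<in>carrier G - D'. Q x" by blast
  then show "\<exists>D\<in>SN n. dim D < Some k \<and> (\<forall>x\<in>carrier G - D. P x \<and> Q x)"
    by (intro bexI[of _ "D \<union> D'"]) (auto intro: N.S_Un dim_less_Un)
next
  fix P Q
  assume "\<forall>x. P x \<longrightarrow> Q x" "\<exists>D\<in>SN n. dim D < Some k \<and> (\<forall>x\<in>carrier G - D. P x)"
  then show "\<exists>D\<in>SN n. dim D < Some k \<and> (\<forall>x\<in>carrier G - D. Q x)" by blast
qed

lemma gen_carrier: "eventually (\<lambda>x. x \<in> carrier G) gen"
  unfolding eventually_gen using N.S_empty by (intro bexI[of _ "{}"]) auto

lemma gen_ex:
  assumes "eventually P gen" obtains x where "x \<in> carrier G" "P x"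
proof -
  obtain D where D: "D \<in> SN n" "dim D < Some k" "\<forall>x\<in>carrier G - D. P x"
    using assms unfolding eventually_gen by blast
  have "\<not> carrier G \<subseteq> D" using dim_mono[OF G_SN D(1)] D(2) dim_G by auto
  then show thesis using that D(3) by blast
qed

text \<open>The carrier need not be \<open>SM\<close>-definable. Replacing it by a set
  \<open>W\<close> that differs from it by small sets leaves genericity unchanged, and for an
  \<open>SM\<close>-definable \<open>W\<close> the right-hand side is expressible in
  \<open>SM\<close> whenever \<open>P\<close> is.\<close>

lemma gen_iff_approx:
  assumes W: "W \<in> SN n" and small: "dim (W - carrier G) < Some k" "dim (carrier G - W) < Some k"
    and P: "defpred SN n P"
  shows "eventually P gen \<longleftrightarrow> dim {x \<in> tuples n. x \<in> W \<and> \<not> P x} < Some k"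
proof
  have B: "{x \<in> tuples n. x \<in> W \<and> \<not> P x} \<in> SN n" by (rule N.S_Collect) (rule W P defs)+
  have WG: "W - carrier G \<in> SN n" "carrier G - W \<in> SN n" by (rule defs W G_SN)+
  {
    assume "eventually P gen"
    then obtain D where D: "D \<in> SN n" "dim D < Some k" "\<forall>x\<in>carrier G - D. P x"
      unfolding eventually_gen by blast
    have "dim (D \<union> (W - carrier G)) < Some k" using dim_less_Un[OF D(1) WG(1)] D(2) small(1) by blast
    then show "dim {x \<in> tuples n. x \<in> W \<and> \<not> P x} < Some k"
      by (rule dim_less_mono[OF N.S_Un[OF D(1) WG(1)] _ _ B]) (use D(3) in blast)
  next
    assume "dim {x \<in> tuples n. x \<in> W \<and> \<not> P x} < Some k"
    then have "dim ({x \<in> tuples n. x \<in> W \<and> \<not> P x} \<union> (carrier G - W)) < Some k"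
      using dim_less_Un[OF B WG(2)] small(2) by blast
    then show "eventually P gen" unfolding eventually_gen
      using N.S_Un[OF B WG(2)] length_G
      by (intro bexI[of _ "{x \<in> tuples n. x \<in> W \<and> \<not> P x} \<union> (carrier G - W)"]) (auto simp: mem_tuples)
  }
qed

lemma gen_iff:
  assumes "defpred SN n P"
  shows "eventually P gen \<longleftrightarrow> dim {x \<in> tuples n. x \<in> carrier G \<and> \<not> P x} < Some k"
  by (rule gen_iff_approx[OF G_SN _ _ assms]) auto

text \<open>If \<open>P (h x)\<close> fails, then \<open>h x\<close> lies in the exceptional set of
  \<open>P\<close>, so x lies in a set that \<open>R\<close> carries injectively into it. Describing
  \<open>h\<close> by \<open>R\<close> avoids values of \<open>h\<close> outside the
  carrier.\<close>

lemma gen_map: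
  assumes R: "defpred SN (n + n) (\<lambda>z. R (take n z) (drop n z))"
    and h: "\<And>x. x \<in> carrier G \<Longrightarrow> h x \<in> carrier G \<and> R x (h x)"
    and inj: "\<And>x x' y. x \<in> carrier G \<Longrightarrow> x' \<in> carrier G \<Longrightarrow> R x y \<Longrightarrow> R x' y \<Longrightarrow> x = x'"
    and P: "eventually P gen"
  shows "eventually (\<lambda>x. P (h x)) gen"
proof -
  obtain D where D: "D \<in> SN n" "dim D < Some k" "\<forall>x\<in>carrier G - D. P x"
    using P unfolding eventually_gen by blast
  let ?D = "{x \<in> carrier G. \<exists>y\<in>D. R x y}"
  have D': "?D \<in> SN n" by (rule N.S_Collect) (rule G_SN D R N.defpred_subst2[OF R] defs)+
  have "dim ?D \<le> dim D" by (rule dim_le_rel[OF D' D(1) R]) (use inj in auto)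
  then have "dim ?D < Some k" using D(2) by order
  moreover have "P (h x)" if "x \<in> carrier G - ?D" for x
    using that h[of x] D(3) by blast
  ultimately show ?thesis unfolding eventually_gen using D' by blast
qed

lemma gen_translate:
  assumes g: "g \<in> carrier G" and P: "eventually P gen"
  shows "eventually (\<lambda>x. P (g \<otimes> x)) gen"
proof (rule gen_map[where R = "\<lambda>x y. Mult g x y", OF _ _ _ P])
  show "defpred SN (n + n) (\<lambda>z. Mult g (take n z) (drop n z))"
    by (rule N.defmap_const[OF length_G[OF g]] defs)+
qed (use g in \<open>auto simp: Mult_def\<close>)

lemma gen_inv_mult:
  assumes g: "g \<in> carrier G" and P: "eventually P gen"
  shows "eventually (\<lambda>x. P (inv x \<otimes> g)) gen"
\<comment> \<open>The equation \<open>x \<otimes> y = g\<close> determines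
  \<open>y = inv x \<otimes> g\<close> without mentioning inversion, so the definability of
  inversion does not have to be established.\<close>
proof (rule gen_map[where R = "\<lambda>x y. Mult x y g", OF _ _ _ P])
  show "defpred SN (n + n) (\<lambda>z. Mult (take n z) (drop n z) g)"
    by (rule N.defmap_const[OF length_G[OF g]] defs)+
  fix x assume "x \<in> carrier G"
  then show "inv x \<otimes> g \<in> carrier G \<and> Mult x (inv x \<otimes> g) g"
    using g by (simp add: Mult_def m_assoc[symmetric])
next
  fix x x' y assume "Mult x y g" "Mult x' y g"
  then show "x = x'" by (auto simp: Mult_def)
qed

text \<open>If the x with a k-dimensional fibre of failures had dimension k themselves, the failures
  would have dimension at least k + k.\<close>

lemma gen_fubini:
  assumes P: "defpred SN (n + n) (\<lambda>z. P (take n z) (drop n z))"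
    and small: "dim {z \<in> tuples (n + n). take n z \<in> carrier G \<and> drop n z \<in> carrier G \<and> \<not> P (take n z) (drop n z)} < Some (k + k)"
  shows "eventually (\<lambda>x. eventually (\<lambda>y. P x y) gen) gen"
proof -
  define F where "F = {z \<in> tuples (n + n). take n z \<in> carrier G \<and> drop n z \<in> carrier G \<and> \<not> P (take n z) (drop n z)}"
  have F: "F \<in> SN (n + n)" unfolding F_def by (rule N.S_Collect) (rule G_SN P defs)+
  define D where "D = {x \<in> tuples n. \<not> dim {y \<in> tuples n. x @ y \<in> F} < Some k}"
  have D: "D \<in> SN n" unfolding D_def by (rule N.S_Collect) (rule F defs)+
  have "dim D < Some k"
  proof (rule ccontr)
    assume "\<not> dim D < Some k"
    then have "Some (k + k) \<le> dim F"
      by (intro dim_fibers_ge[OF D F]) (auto simp: D_def not_less)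
    then show False using small unfolding F_def by simp
  qed
  moreover have "eventually (\<lambda>y. P x y) gen" if x: "x \<in> carrier G - D" for x
  proof -
    have "dim {y \<in> tuples n. x @ y \<in> F} < Some k" using x length_G by (auto simp: D_def mem_tuples)
    moreover have "{y \<in> tuples n. x @ y \<in> F} \<in> SN n" using fiber_SN[OF F] length_G x by blast
    moreover have "P x y" if "y \<in> carrier G - {y \<in> tuples n. x @ y \<in> F}" for y
      using that x length_G[of x] length_G[of y] by (auto simp: F_def mem_tuples)
    ultimately show ?thesis unfolding eventually_gen by blast
  qed
  ultimately show ?thesis unfolding eventually_gen using D by blast
qed

text \<open>Induction on the dimension of the part \<open>Y\<close> still uncovered. Consider the
  pairs (g, y) with y in \<open>Y\<close> but not in the translate of \<open>V\<close> by g. For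
  fixed y the elements g are those with \<open>inv g \<otimes> y\<close> outside \<open>V\<close>, a
  set of dimension less than k; so the pairs have dimension less than \<open>d + k\<close>, and some
  g leaves a remainder of dimension less than d.\<close>

lemma finite_translates_cover:
  assumes V: "V \<in> SN n" "V \<subseteq> carrier G" "eventually (\<lambda>x. x \<in> V) gen"
  obtains gs where "set gs \<subseteq> carrier G" "\<And>y. y \<in> carrier G \<Longrightarrow> \<exists>g\<in>set gs. \<exists>v\<in>V. y = g \<otimes> v"
proof -
  have "\<exists>gs. set gs \<subseteq> carrier G \<and> (\<forall>y\<in>Y. \<exists>g\<in>set gs. \<exists>v\<in>V. y = g \<otimes> v)"
    if "Y \<in> SN n" "Y \<subseteq> carrier G" "dim Y < Some d" for Y d
    using that
  proof (induction d arbitrary: Y)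
    case 0
    then have "Y = {}" using dim_None by (auto simp: less_Some_iff)
    then show ?case by (intro exI[of _ "[]"]) simp
  next
    case (Suc d)
    have GY: "carrier G - V \<in> SN n" by (rule defs G_SN V)+
    have smallV: "dim (carrier G - V) < Some k"
    proof -
      have "defpred SN n (\<lambda>x. x \<in> V)" by (rule V defs)+
      then have "dim {x \<in> tuples n. x \<in> carrier G \<and> x \<notin> V} < Some k" using gen_iff V(3) by blast
      moreover have "{x \<in> tuples n. x \<in> carrier G \<and> x \<notin> V} = carrier G - V" using length_G by (auto simp: mem_tuples)
      ultimately show ?thesis by simp
    qed
    define B where "B = {z \<in> tuples (n + n). take n z \<in> carrier G \<and> drop n z \<in> Y \<and> (\<forall>v\<in>V. \<not> Mult (take n z) v (drop n z))}"
    have B: "B \<in> SN (n + n)" unfolding B_def by (rule N.S_Collect) (rule G_SN V Suc.prems defs)+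
    have lY: "length y = n" if "y \<in> Y" for y using that Suc.prems length_G by blast
    have "\<exists>g\<in>carrier G. dim {y \<in> tuples n. g @ y \<in> B} < Some d"
    proof (rule ccontr)
      assume "\<not> (\<exists>g\<in>carrier G. dim {y \<in> tuples n. g @ y \<in> B} < Some d)"
      then have "Some (k + d) \<le> dim B"
        using dim_G by (intro dim_fibers_ge[OF G_SN B]) (auto simp: not_less)
      moreover have dY: "dim Y \<le> Some d" using Suc.prems(3) by (cases "dim Y") auto
      have "dim B < Some (d + k)"
      proof (rule dim_cofibers_less[OF Suc.prems(1) B _ dY])
        fix z assume "z \<in> B" then show "drop n z \<in> Y" by (simp add: B_def)
      next
        fix y assume y: "y \<in> Y"
        let ?F = "{g \<in> tuples n. g @ y \<in> B}"
        have F: "?F \<in> SN n" by (rule N.S_Collect) (rule N.defmap_const[OF lY[OF y]] B defs)+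
        have yG: "y \<in> carrier G" using y Suc.prems by blast
        have "dim ?F \<le> dim (carrier G - V)"
        proof (rule dim_le_rel[OF F GY, where R = "\<lambda>g v. Mult g v y"])
          show "defpred SN (n + n) (\<lambda>z. Mult (take n z) (drop n z) y)"
            by (rule N.defmap_const[OF lY[OF y]] defs)+
        next
          fix g assume "g \<in> ?F"
          then have g: "g \<in> carrier G" "\<forall>v\<in>V. \<not> Mult g v y" by (auto simp: B_def mem_tuples)
          have "Mult g (inv g \<otimes> y) y" using g yG by (simp add: Mult_def m_assoc[symmetric])
          then show "\<exists>v\<in>carrier G - V. Mult g v y" using g yG by blast
        next
          fix g g' v assume "Mult g v y" "Mult g' v y"
          then show "g = g'" by (auto simp: Mult_def)
        qed
        then show "dim ?F < Some k" using smallV by order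
      qed
      ultimately show False by (cases "dim B") auto
    qed
    then obtain g where g: "g \<in> carrier G" "dim {y \<in> tuples n. g @ y \<in> B} < Some d" by blast
    let ?Y = "{y \<in> tuples n. g @ y \<in> B}"
    have Y': "?Y \<in> SN n" by (rule fiber_SN[OF B length_G[OF g(1)]])
    have sub: "?Y \<subseteq> Y" using length_G[OF g(1)] by (auto simp: B_def)
    then obtain gs where gs: "set gs \<subseteq> carrier G" "\<forall>y\<in>?Y. \<exists>g\<in>set gs. \<exists>v\<in>V. y = g \<otimes> v"
      using Suc.IH[OF Y' _ g(2)] Suc.prems by blast
    have "\<exists>h\<in>set (g # gs). \<exists>v\<in>V. y = h \<otimes> v" if yY: "y \<in> Y" for y
    proof (cases "y \<in> ?Y")
      case False
      then obtain v where "v \<in> V" "Mult g v y"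
        using yY g(1) lY[OF yY] length_G[OF g(1)] by (auto simp: B_def mem_tuples)
      then show ?thesis by (auto simp: Mult_def)
    qed (use gs in auto)
    then show ?case using g gs by (intro exI[of _ "g # gs"]) auto
  qed
  from this[OF G_SN, of "Suc k"] show thesis using that dim_G by auto
qed

end

subsection \<open>The group chunk\<close>

lemma inj_on_take_length: "(\<And>x. x \<in> A \<Longrightarrow> length x = n) \<Longrightarrow> inj_on (take n) A"
  by (simp add: inj_on_def)

section \<open>Approximations of the carrier and of the multiplication\<close>

context tame_group
begin

lemma carrier_approx:
  obtains W where "W \<in> SM n" "dim (W - carrier G) < Some k" "dim (carrier G - W) < Some k"
proof -
  have "take n ` carrier G \<subseteq> C" using length_G GC by auto
  moreover have "inj_on (take n) (carrier G)" by (rule inj_on_take_length[OF length_G])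
  \<comment> \<open>With m = 0 a graph over a subset of \<open>C\<close> is just that subset, so the
    approximation theorem applies to the carrier itself.\<close>
  ultimately obtain E where "E \<in> SM (n + 0)" "dim (E - carrier G) < Some k" "dim (carrier G - E) < Some k"
    using approx_SM[OF C, of k "carrier G" 0] dim_C G_SN by auto
  then show thesis using that by simp
qed

definition mult_rel :: "'a list set \<Rightarrow> 'a list \<Rightarrow> 'a list \<Rightarrow> 'a list \<Rightarrow> bool" where
  "mult_rel EE a b c \<longleftrightarrow> length a = n \<and> length b = n \<and> length c = n \<and> a @ b @ c \<in> EE"

lemma defpred_mult_rel_M:
  assumes "EE \<in> SM (n + (n + n))" "defmap SM m n s" "defmap SM m n t" "defmap SM m n u"
  shows "defpred SM m (\<lambda>z. mult_rel EE (s z) (t z) (u z))"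
proof -
  have "defpred SM m (\<lambda>z. s z @ t z @ u z \<in> EE)" by (rule assms defs)+
  then show ?thesis
    by (rule defpred_cong[THEN iffD1, rotated]) (use assms in \<open>auto simp: mult_rel_def defmap_length\<close>)
qed

lemma defpred_mult_rel_N:
  assumes "EE \<in> SN (n + (n + n))" "defmap SN m n s" "defmap SN m n t" "defmap SN m n u"
  shows "defpred SN m (\<lambda>z. mult_rel EE (s z) (t z) (u z))"
proof -
  have "defpred SN m (\<lambda>z. s z @ t z @ u z \<in> EE)" by (rule assms defs)+
  then show ?thesis
    by (rule defpred_cong[THEN iffD1, rotated]) (use assms in \<open>auto simp: mult_rel_def defmap_length\<close>)
qed

lemma dim_square: "{z \<in> tuples (n + n). take n z \<in> C \<and> drop n z \<in> C} \<in> SM (n + n)"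
  "dim {z \<in> tuples (n + n). take n z \<in> C \<and> drop n z \<in> C} \<le> Some (k + k)"
proof -
  let ?F = "{z \<in> tuples (n + n). take n z \<in> C \<and> drop n z \<in> C}"
  show F: "?F \<in> SM (n + n)" by (rule M.S_Collect) (rule C defs)+
  show "dim ?F \<le> Some (k + k)"
  proof (rule dim_fibers_le[OF SN_I[OF C] SN_I[OF F]])
    fix t assume "t \<in> C"
    then have "{x \<in> tuples n. t @ x \<in> ?F} = C" using M.S_lengthD[OF C] by (auto simp: mem_tuples)
    then show "dim {x \<in> tuples n. t @ x \<in> ?F} \<le> Some k" using dim_C by simp
  qed (use dim_C in auto)
qed

text \<open>The multiplication is a graph over \<open>G \<times> G\<close>, which lies in an
  \<open>SM\<close>-definable set of dimension at most k + k, so \<open>approx_SM\<close> applies.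
  The result is pruned so that \<open>EE\<close> is injective in its second argument and takes
  values in \<open>W\<close>; this allows small sets of values to be pulled back along
  \<open>mult_rel EE a\<close> for an arbitrary a.\<close>

lemma mult_approx:
  assumes W: "W \<in> SM n" "dim (W - carrier G) < Some k" "dim (carrier G - W) < Some k"
  obtains EE where "EE \<in> SM (n + (n + n))"
    "\<And>a b c c'. mult_rel EE a b c \<Longrightarrow> mult_rel EE a b c' \<Longrightarrow> c = c'"
    "\<And>a b b' c. mult_rel EE a b c \<Longrightarrow> mult_rel EE a b' c \<Longrightarrow> b = b'"
    "\<And>a b c. mult_rel EE a b c \<Longrightarrow> c \<in> W"
    "eventually (\<lambda>a. eventually (\<lambda>b. mult_rel EE a b (a \<otimes> b)) gen) gen"
proof -
  define \<Gamma> where "\<Gamma> = {x @ y @ (x \<otimes> y) | x y. x \<in> carrier G \<and> y \<in> carrier G}"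
  have assoc: "n + (n + n) = n + n + n" by simp
  have \<Gamma>: "\<Gamma> \<in> SN (n + n + n)" using mult_graph_SN unfolding \<Gamma>_def assoc .
  have take\<Gamma>: "take (n + n) (x @ y @ w) = x @ y" if "x \<in> carrier G" "y \<in> carrier G" for x y w
    using that length_G by simp
  have inj\<Gamma>: "inj_on (take (n + n)) \<Gamma>"
  proof (rule inj_onI)
    fix z z' assume "z \<in> \<Gamma>" "z' \<in> \<Gamma>" "take (n + n) z = take (n + n) z'"
    then show "z = z'" using take\<Gamma> length_G by (auto simp: \<Gamma>_def)
  qed
  have "take (n + n) ` \<Gamma> \<subseteq> {z \<in> tuples (n + n). take n z \<in> C \<and> drop n z \<in> C}"
    using take\<Gamma> length_G GC by (auto simp: \<Gamma>_def mem_tuples)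
  then obtain E1 where E1: "E1 \<in> SM (n + n + n)" "inj_on (take (n + n)) E1"
    "dim (E1 - \<Gamma>) < Some (k + k)" "dim (\<Gamma> - E1) < Some (k + k)"
    using approx_SM[OF dim_square \<Gamma> inj\<Gamma>] by blast
  have E1': "E1 \<in> SM (n + (n + n))" using E1(1) by (simp add: assoc)
  define EE where "EE = {z \<in> E1. drop n (drop n z) \<in> W \<and> 
    (\<forall>b\<in>tuples n. mult_rel E1 (take n z) b (drop n (drop n z)) \<longrightarrow> b = take n (drop n z))}"
  have EE: "EE \<in> SM (n + (n + n))" unfolding EE_def
    by (rule M.S_Collect[OF E1']) (rule W defpred_mult_rel_M[OF E1'] defs)+
  have rel: "mult_rel EE a b c \<longleftrightarrow> mult_rel E1 a b c \<and> c \<in> W \<and> (\<forall>b'\<in>tuples n. mult_rel E1 a b' c \<longrightarrow> b' = b)" for a b c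
    by (auto simp: mult_rel_def EE_def)
  have fun1: "c = c'" if "mult_rel E1 a b c" "mult_rel E1 a b c'" for a b c c'
    using inj_onD[OF E1(2), of "a @ b @ c" "a @ b @ c'"] that by (simp add: mult_rel_def)
  define P where "P a b \<longleftrightarrow> (\<exists>c\<in>tuples n. Mult a b c \<and> mult_rel EE a b c)" for a b
  have P: "defpred SN (n + n) (\<lambda>z. P (take n z) (drop n z))" unfolding P_def
    by (rule defpred_mult_rel_N[OF SN_I[OF EE]] defs)+
  let ?N = "{z \<in> tuples (n + n). take n z \<in> carrier G \<and> drop n z \<in> carrier G \<and> \<not> P (take n z) (drop n z)}"
  \<comment> \<open>A product can be missing from \<open>EE\<close> in three ways: \<open>E1\<close>
    does not record it, its value lies outside \<open>W\<close>, or it was pruned because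
    \<open>E1\<close> assigns the same value to another second argument.\<close>
  let ?N1 = "{z \<in> tuples (n + n). \<exists>c\<in>tuples n. Mult (take n z) (drop n z) c \<and> \<not> mult_rel E1 (take n z) (drop n z) c}"
  let ?N2 = "{z \<in> tuples (n + n). \<exists>c\<in>tuples n. Mult (take n z) (drop n z) c \<and> c \<notin> W}"
  let ?N3 = "{z \<in> tuples (n + n). \<exists>c\<in>tuples n. Mult (take n z) (drop n z) c \<and>
     (\<exists>b\<in>tuples n. mult_rel E1 (take n z) b c \<and> b \<noteq> drop n z)}"
  have E1N: "E1 \<in> SN (n + n + n)" by (rule SN_I[OF E1(1)])
  have WN: "W \<in> SN n" by (rule SN_I[OF W(1)])
  note rules = G_SN defpred_mult_rel_N[OF SN_I[OF E1']] defs
  have N: "?N \<in> SN (n + n)" by (rule N.S_Collect) (rule P rules)+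
  have N1: "?N1 \<in> SN (n + n)" by (rule N.S_Collect) (rule rules)+
  have N2: "?N2 \<in> SN (n + n)" by (rule N.S_Collect) (rule WN rules)+
  have N3: "?N3 \<in> SN (n + n)" by (rule N.S_Collect) (rule rules)+
  have td: "z = z'" if "take n z = take n z'" "drop n z = drop n z'" for z z' :: "'a list"
    using that by (metis append_take_drop_id)
  have MultG: "take n z @ drop n z @ c \<in> \<Gamma>" if "Mult (take n z) (drop n z) c" for z c
    using that by (auto simp: \<Gamma>_def Mult_def simp del: append_take_drop_id append.assoc)
  have sub: "?N \<subseteq> ?N1 \<union> ?N2 \<union> ?N3"
  proof
    fix z assume z: "z \<in> ?N"
    define c where "c = take n z \<otimes> drop n z"
    have c: "Mult (take n z) (drop n z) c" "c \<in> tuples n"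
      using z length_G by (auto simp: Mult_def c_def mem_tuples)
    then have "\<not> mult_rel EE (take n z) (drop n z) c" using z unfolding P_def by blast
    then show "z \<in> ?N1 \<union> ?N2 \<union> ?N3" using z c unfolding rel by blast
  qed
  have d1: "dim ?N1 < Some (k + k)"
  proof -
    have \<Gamma>E: "\<Gamma> - E1 \<in> SN (n + n + n)" by (rule N.S_Diff[OF \<Gamma> E1N])
    have "dim ?N1 \<le> dim (\<Gamma> - E1)"
    proof (rule dim_le_rel[OF N1 \<Gamma>E, where R = "\<lambda>z w. take (n + n) w = z"])
      fix z assume "z \<in> ?N1"
      then obtain c where c: "length z = n + n" "length c = n" "Mult (take n z) (drop n z) c" "\<not> mult_rel E1 (take n z) (drop n z) c"
        by (auto simp: mem_tuples)
      have e: "take n z @ drop n z @ c = z @ c" by (metis append.assoc append_take_drop_id)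
      have "z @ c \<notin> E1" using c(1,2,4) unfolding mult_rel_def e by simp
      then have "z @ c \<in> \<Gamma> - E1" using MultG[OF c(3)] unfolding e by simp
      then show "\<exists>w\<in>\<Gamma> - E1. take (n + n) w = z" using c by (intro bexI[of _ "z @ c"]) auto
    qed ((rule defs)+, auto)
    then show ?thesis using E1(4) by order
  qed
  have d2: "dim ?N2 < Some (k + k)"
  proof -
    \<comment> \<open>A pair (a, b) in \<open>?N2\<close> is determined by
      \<open>a \<otimes> b\<close> and a, the former lying in the small set
      \<open>carrier G - W\<close>.\<close>
    let ?Q = "{w \<in> tuples (n + n). take n w \<in> carrier G - W \<and> drop n w \<in> carrier G}"
    have GW: "carrier G - W \<in> SN n" by (rule N.S_Diff[OF G_SN WN])
    have Q: "?Q \<in> SN (n + n)" by (rule N.S_Collect) (rule N.defpred_mem[OF GW] G_SN defs)+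
    have "dim ?Q < Some (k + k)"
    proof (rule dim_base_less[OF GW Q _ W(3)])
      fix t assume "t \<in> carrier G - W"
      then have "{x \<in> tuples n. t @ x \<in> ?Q} = carrier G" using length_G by (auto simp: mem_tuples)
      then show "dim {x \<in> tuples n. t @ x \<in> ?Q} \<le> Some k" using dim_G by simp
    qed auto
    moreover have "dim ?N2 \<le> dim ?Q"
    proof (rule dim_le_rel[OF N2 Q, where R = "\<lambda>z w. drop n w = take n z \<and> Mult (take n z) (drop n z) (take n w)"])
      fix z assume "z \<in> ?N2"
      then obtain c where c: "length c = n" "Mult (take n z) (drop n z) c" "c \<notin> W" "length z = n + n"
        by (auto simp: mem_tuples)
      then have "c @ take n z \<in> ?Q" using length_G by (auto simp: Mult_def mem_tuples)
      then show "\<exists>w\<in>?Q. drop n w = take n z \<and> Mult (take n z) (drop n z) (take n w)"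
        using c by (intro bexI[of _ "c @ take n z"]) auto
    next
      fix z z' w assume "drop n w = take n z \<and> Mult (take n z) (drop n z) (take n w)"
        "drop n w = take n z' \<and> Mult (take n z') (drop n z') (take n w)"
      then have t: "take n z = take n z'" and "Mult (take n z) (drop n z) (take n w)" "Mult (take n z) (drop n z') (take n w)" by auto
      then have "drop n z = drop n z'" by (auto simp: Mult_def)
      with t show "z = z'" by (rule td)
    qed (rule defs)+
    ultimately show ?thesis by order
  qed
  have d3: "dim ?N3 < Some (k + k)"
  proof -
    \<comment> \<open>A pair (a, b) in \<open>?N3\<close> with product c comes with a triple (a, b',
      c) in \<open>E1\<close>, where b' differs from b. By cancellation this triple is not in
      \<open>\<Gamma>\<close>, and a and c recover b; so \<open>E1 - \<Gamma>\<close> bounds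
      \<open>?N3\<close>.\<close>
    have E\<Gamma>: "E1 - \<Gamma> \<in> SN (n + (n + n))" using N.S_Diff[OF E1N \<Gamma>] by (simp add: assoc)
    have "dim ?N3 \<le> dim (E1 - \<Gamma>)"
    proof (rule dim_le_rel[OF N3 E\<Gamma>, where R = "\<lambda>z w. take n w = take n z \<and> Mult (take n z) (drop n z) (drop n (drop n w))"])
      fix z assume "z \<in> ?N3"
      then obtain c b where c: "Mult (take n z) (drop n z) c" "mult_rel E1 (take n z) b c" "b \<noteq> drop n z"
        by auto
      have "take n z @ b @ c \<notin> \<Gamma>"
      proof
        assume "take n z @ b @ c \<in> \<Gamma>"
        then have "Mult (take n z) b c" using mem_mult_graph[of "take n z" b c] c(2) by (simp add: \<Gamma>_def mult_rel_def)
        then show False using c by (auto simp: Mult_def)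
      qed
      then have "take n z @ b @ c \<in> E1 - \<Gamma>" using c(2) by (simp add: mult_rel_def)
      then show "\<exists>w\<in>E1 - \<Gamma>. take n w = take n z \<and> Mult (take n z) (drop n z) (drop n (drop n w))"
        using c by (intro bexI[of _ "take n z @ b @ c"]) (auto simp: mult_rel_def)
    next
      fix z z' w assume "take n w = take n z \<and> Mult (take n z) (drop n z) (drop n (drop n w))"
        "take n w = take n z' \<and> Mult (take n z') (drop n z') (drop n (drop n w))"
      then have t: "take n z = take n z'" and "Mult (take n z) (drop n z) (drop n (drop n w))" "Mult (take n z) (drop n z') (drop n (drop n w))" by auto
      then have "drop n z = drop n z'" by (auto simp: Mult_def)
      with t show "z = z'" by (rule td)
    qed (rule defs)+
    then show ?thesis using E1(3) by order
  qed
  have "dim (?N1 \<union> ?N2 \<union> ?N3) < Some (k + k)"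
    using dim_less_Un[OF N.S_Un[OF N1 N2] N3 dim_less_Un[OF N1 N2 d1 d2] d3] .
  then have "dim ?N < Some (k + k)"
    by (rule dim_less_mono[OF N.S_Un[OF N.S_Un[OF N1 N2] N3] _ sub N])
  from gen_fubini[OF P this] have "eventually (\<lambda>a. eventually (\<lambda>b. mult_rel EE a b (a \<otimes> b)) gen) gen"
    by (elim eventually_mono) (auto simp: P_def Mult_def)
  then show thesis
    by (rule that[OF EE, rotated 3]) (auto simp: rel mult_rel_def[of EE] mem_tuples fun1 intro: fun1, auto simp: mult_rel_def mem_tuples)
qed

end

section \<open>Elements representing left translations\<close>

locale group_chunk = tame_group SM SN dim G n k C
  for SM SN :: "nat \<Rightarrow> 'a::{dense_linorder, no_top, no_bot} list set set" and dim
    and G :: "'a list monoid" (structure) and n k C +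
  fixes W EE :: "'a list set"
  assumes W: "W \<in> SM n" and W_small: "dim (W - carrier G) < Some k" "dim (carrier G - W) < Some k"
    and EE: "EE \<in> SM (n + (n + n))"
    and E_fun: "mult_rel EE a b c \<Longrightarrow> mult_rel EE a b c' \<Longrightarrow> c = c'"
    and E_inj: "mult_rel EE a b c \<Longrightarrow> mult_rel EE a b' c \<Longrightarrow> b = b'"
    and E_W: "mult_rel EE a b c \<Longrightarrow> c \<in> W"
    and E_gen: "eventually (\<lambda>a. eventually (\<lambda>b. mult_rel EE a b (a \<otimes> b)) gen) gen"
begin

abbreviation E where "E \<equiv> mult_rel EE"

lemmas [defs] = defpred_mult_rel_M[OF EE] defpred_mult_rel_N[OF SN_I[OF EE]]

lemma E_length: "E a b c \<Longrightarrow> length a = n \<and> length b = n \<and> length c = n"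
  by (simp add: mult_rel_def)

lemma gen_iff_W: "defpred SN n P \<Longrightarrow> eventually P gen \<longleftrightarrow> dim {x \<in> tuples n. x \<in> W \<and> \<not> P x} < Some k"
  by (rule gen_iff_approx[OF SN_I[OF W] W_small])

lemma gen_W: "eventually (\<lambda>x. x \<in> W) gen"
  using gen_iff_W[OF N.defpred_mem_id[OF SN_I[OF W]]] by simp

definition rep :: "'a list \<Rightarrow> 'a list \<Rightarrow> bool" where
  "rep a g \<longleftrightarrow> g \<in> carrier G \<and> eventually (\<lambda>x. E a x (g \<otimes> x)) gen"

lemma rep_carrier: "rep a g \<Longrightarrow> g \<in> carrier G"
  by (simp add: rep_def)

lemma rep_unique:
  assumes "rep a g" "rep a g'" shows "g = g'"
proof -
  have "eventually (\<lambda>x. E a x (g \<otimes> x) \<and> E a x (g' \<otimes> x)) gen"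
    using assms unfolding rep_def by (auto intro: eventually_conj)
  then obtain x where "x \<in> carrier G" "E a x (g \<otimes> x)" "E a x (g' \<otimes> x)" by (rule gen_ex) blast
  then show ?thesis using E_fun assms rep_carrier by (metis right_cancel)
qed

lemma defpred_rep [defs]:
  assumes "defmap SN m n s" "defmap SN m n t"
  shows "defpred SN m (\<lambda>z. rep (s z) (t z))"
proof -
  have "rep a g \<longleftrightarrow> g \<in> carrier G \<and> dim {x \<in> tuples n. x \<in> carrier G \<and> \<not> (\<exists>y\<in>tuples n. Mult g x y \<and> E a x y)} < Some k"
    if "length a = n" "length g = n" for a g
  proof -
    have "eventually (\<lambda>x. E a x (g \<otimes> x)) gen \<longleftrightarrow> eventually (\<lambda>x. \<exists>y\<in>tuples n. Mult g x y \<and> E a x y) gen"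
      if g: "g \<in> carrier G"
    proof
      assume "eventually (\<lambda>x. E a x (g \<otimes> x)) gen"
      then show "eventually (\<lambda>x. \<exists>y\<in>tuples n. Mult g x y \<and> E a x y) gen"
        using gen_carrier by eventually_elim (use g E_length in \<open>auto simp: Mult_def mem_tuples\<close>)
    qed (auto elim!: eventually_mono simp: Mult_def)
    moreover have "defpred SN n (\<lambda>x. \<exists>y\<in>tuples n. Mult g x y \<and> E a x y)"
      by (rule N.defmap_const[OF that(1)] N.defmap_const[OF that(2)] defs)+
    ultimately show ?thesis unfolding rep_def using gen_iff by blast
  qed
  moreover have "defpred SN m (\<lambda>z. t z \<in> carrier G \<and>
      dim {x \<in> tuples n. x \<in> carrier G \<and> \<not> (\<exists>y\<in>tuples n. Mult (t z) x y \<and> E (s z) x y)} < Some k)"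
    by (rule G_SN N.defmap_take assms defs)+
  ultimately show ?thesis
    by (elim defpred_cong[THEN iffD2, rotated]) (use assms in \<open>auto simp: defmap_length\<close>)
qed

lemma gen_rep_self: "eventually (\<lambda>a. rep a a) gen"
  using E_gen gen_carrier by eventually_elim (simp add: rep_def)

text \<open>Here a is arbitrary, so \<open>E a\<close> may be unrelated to the group. But its values
  lie in \<open>W\<close>, where almost all elements represent themselves, and it is injective;
  hence few b have a value that does not represent itself.\<close>

lemma gen_image_rep:
  assumes a: "length a = n"
  shows "eventually (\<lambda>b. \<forall>c. E a b c \<longrightarrow> rep c c) gen"
proof -
  let ?B = "{c \<in> tuples n. c \<in> W \<and> \<not> rep c c}"
  let ?D = "{b \<in> tuples n. \<exists>c\<in>?B. E a b c}"
  note a' = N.defmap_const[OF a]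
  have B: "?B \<in> SN n" by (rule N.S_Collect) (rule SN_I[OF W] defs)+
  have D: "?D \<in> SN n" by (rule N.S_Collect) (rule a' N.defpred_bex[OF B] defs)+
  have "defpred SN n (\<lambda>c. rep c c)" by (rule defs)+
  then have "dim ?B < Some k" using gen_iff_W gen_rep_self by blast
  moreover have "dim ?D \<le> dim ?B"
    by (rule dim_le_rel[OF D B, where R = "\<lambda>b c. E a b c"]) ((rule a' defs)+, auto intro: E_inj)
  ultimately have "dim ?D < Some k" by order
  moreover have "rep c c" if "b \<in> carrier G - ?D" "E a b c" for b c
    using that E_length[OF that(2)] E_W[OF that(2)] by (auto simp: mem_tuples)
  ultimately show ?thesis unfolding eventually_gen using D by blast
qed

text \<open>For generic b the value c of \<open>E a b\<close> exists, and for generic x applying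
  \<open>E b\<close> and then \<open>E a\<close> gives the same as \<open>E c\<close>. Both generic
  quantifiers are written as smallness inside \<open>W\<close>, so that neither the carrier nor its
  multiplication occurs.\<close>

definition W1 :: "'a list set" where
  "W1 = {a \<in> tuples n. a \<in> W \<and> dim {b \<in> tuples n. b \<in> W \<and> \<not> (\<exists>c\<in>tuples n. E a b c \<and>
     dim {x \<in> tuples n. x \<in> W \<and> \<not> (\<exists>y\<in>tuples n. \<exists>z\<in>tuples n. E b x y \<and> E a y z \<and> E c x z)} < Some k)} < Some k}"

lemma W1_SM: "W1 \<in> SM n"
  unfolding W1_def by (rule M.S_Collect) (rule W defs)+

lemma W1_iff: "a \<in> W1 \<longleftrightarrow> a \<in> W \<and> eventually (\<lambda>b. \<exists>c. E a b c \<and>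
    eventually (\<lambda>x. \<exists>y z. E b x y \<and> E a y z \<and> E c x z) gen) gen"
proof (cases "length a = n")
  case True
  note a' = N.defmap_const[OF True]
  have inner: "eventually (\<lambda>x. \<exists>y z. E b x y \<and> E a y z \<and> E c x z) gen \<longleftrightarrow>
    dim {x \<in> tuples n. x \<in> W \<and> \<not> (\<exists>y\<in>tuples n. \<exists>z\<in>tuples n. E b x y \<and> E a y z \<and> E c x z)} < Some k"
    if bc: "length b = n" "length c = n" for b c
  proof -
    have "(\<lambda>x. \<exists>y z. E b x y \<and> E a y z \<and> E c x z) = (\<lambda>x. \<exists>y\<in>tuples n. \<exists>z\<in>tuples n. E b x y \<and> E a y z \<and> E c x z)"
      using E_length by (fastforce simp: mem_tuples)
    moreover have "defpred SN n (\<lambda>x. \<exists>y\<in>tuples n. \<exists>z\<in>tuples n. E b x y \<and> E a y z \<and> E c x z)"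
      by (rule a' N.defmap_const[OF bc(1)] N.defmap_const[OF bc(2)] defs)+
    ultimately show ?thesis using gen_iff_W by simp
  qed
  have eq: "(\<lambda>b. \<exists>c. E a b c \<and> eventually (\<lambda>x. \<exists>y z. E b x y \<and> E a y z \<and> E c x z) gen) = (\<lambda>b. \<exists>c\<in>tuples n. E a b c \<and>
     dim {x \<in> tuples n. x \<in> W \<and> \<not> (\<exists>y\<in>tuples n. \<exists>z\<in>tuples n. E b x y \<and> E a y z \<and> E c x z)} < Some k)"
    using E_length inner by (fastforce simp: mem_tuples)
  have d: "defpred SN n (\<lambda>b. \<exists>c\<in>tuples n. E a b c \<and>
     dim {x \<in> tuples n. x \<in> W \<and> \<not> (\<exists>y\<in>tuples n. \<exists>z\<in>tuples n. E b x y \<and> E a y z \<and> E c x z)} < Some k)"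
    by (rule a' SN_I[OF W] defs)+
  show ?thesis unfolding eq gen_iff_W[OF d] W1_def using True by (simp add: mem_tuples)
next
  case False
  then show ?thesis using M.S_lengthD[OF W] M.S_lengthD[OF W1_SM] by blast
qed

text \<open>For generic b, both b and the value c of \<open>E a b\<close> represent themselves.
  Generic associativity then reads \<open>E a (b \<otimes> x) (c \<otimes> x)\<close>, and replacing
  x by \<open>inv b \<otimes> x\<close> shows that a represents
  \<open>c \<otimes> inv b\<close>.\<close>

lemma W1_rep:
  assumes "a \<in> W1" obtains g where "rep a g"
proof -
  have l: "length a = n" using assms M.S_lengthD[OF W1_SM] by blast
  have ev: "eventually (\<lambda>b. \<exists>c. E a b c \<and> eventually (\<lambda>x. \<exists>y z. E b x y \<and> E a y z \<and> E c x z) gen) gen"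
    using assms by (simp add: W1_iff)
  have "eventually (\<lambda>b. (\<exists>c. E a b c \<and> eventually (\<lambda>x. \<exists>y z. E b x y \<and> E a y z \<and> E c x z) gen) \<and>
     rep b b \<and> (\<forall>c. E a b c \<longrightarrow> rep c c)) gen"
    by (rule eventually_conj[OF ev eventually_conj[OF gen_rep_self gen_image_rep[OF l]]])
  then obtain b where b: "b \<in> carrier G" "rep b b" "\<And>c. E a b c \<Longrightarrow> rep c c"
    "\<exists>c. E a b c \<and> eventually (\<lambda>x. \<exists>y z. E b x y \<and> E a y z \<and> E c x z) gen" by (rule gen_ex) blast
  then obtain c where c: "E a b c" "eventually (\<lambda>x. \<exists>y z. E b x y \<and> E a y z \<and> E c x z) gen" by blast
  have cG: "c \<in> carrier G" and ec: "eventually (\<lambda>x. E c x (c \<otimes> x)) gen"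
    and eb: "eventually (\<lambda>x. E b x (b \<otimes> x)) gen"
    using b c by (auto simp: rep_def)
  from c(2) ec eb have "eventually (\<lambda>x. E a (b \<otimes> x) (c \<otimes> x)) gen"
    by eventually_elim (metis E_fun)
  from gen_translate[OF _ this, of "inv b"] have "eventually (\<lambda>x. E a (b \<otimes> (inv b \<otimes> x)) (c \<otimes> (inv b \<otimes> x))) gen"
    using b(1) by simp
  then have "eventually (\<lambda>x. E a x (c \<otimes> inv b \<otimes> x)) gen"
    using gen_carrier by eventually_elim (use b(1) cG in \<open>simp add: m_assoc\<close>, metis b(1) inv_closed l_one m_assoc r_inv)
  then have "rep a (c \<otimes> inv b)" using b(1) cG by (simp add: rep_def)
  then show thesis by (rule that)
qed

lemma gen_W1: "eventually (\<lambda>a. a \<in> W1) gen"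
  using E_gen gen_W gen_carrier gen_rep_self
proof eventually_elim
  case (elim a)
  \<comment> \<open>For generic b the product \<open>a \<otimes> b\<close> is generic too and so
    represents itself; it serves as c.\<close>
  from gen_translate[OF elim(3) gen_rep_self] elim(1) gen_rep_self gen_carrier
  have "eventually (\<lambda>b. \<exists>c. E a b c \<and> eventually (\<lambda>x. \<exists>y z. E b x y \<and> E a y z \<and> E c x z) gen) gen"
  proof eventually_elim
    case (elim b)
    have "eventually (\<lambda>x. E a (b \<otimes> x) (a \<otimes> (b \<otimes> x))) gen"
      using \<open>rep a a\<close> gen_translate[OF elim(4)] by (auto simp: rep_def)
    moreover have "eventually (\<lambda>x. E b x (b \<otimes> x)) gen" "eventually (\<lambda>x. E (a \<otimes> b) x (a \<otimes> b \<otimes> x)) gen"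
      using elim by (auto simp: rep_def)
    ultimately have "eventually (\<lambda>x. \<exists>y z. E b x y \<and> E a y z \<and> E (a \<otimes> b) x z) gen"
      using gen_carrier
    proof eventually_elim
      case (elim x)
      then show ?case using m_assoc[OF \<open>a \<in> carrier G\<close> \<open>b \<in> carrier G\<close> elim(4)] by auto
    qed
    then show ?case using elim(2) by blast
  qed
  then show ?case using elim by (simp add: W1_iff)
qed

section \<open>Words in represented elements\<close>

definition iota :: "'a list \<Rightarrow> 'a list" where
  "iota a = (THE g. rep a g)"

lemma iota_eq: "rep a g \<Longrightarrow> iota a = g"
  unfolding iota_def using rep_unique by blast

lemma rep_iota: "a \<in> W1 \<Longrightarrow> rep a (iota a)"
  using W1_rep iota_eq by metis

lemma iota_closed: "a \<in> W1 \<Longrightarrow> iota a \<in> carrier G"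
  using rep_iota rep_carrier by blast

text \<open>Products are handled as words because a product of represented elements is not known to
  be represented by a single element. The last letter acts first, and the action is partial because
  \<open>E\<close> is.\<close>

primrec act :: "'a list list \<Rightarrow> 'a list \<Rightarrow> 'a list \<Rightarrow> bool" where
  "act [] x y \<longleftrightarrow> x = y"
| "act (a # as) x y \<longleftrightarrow> (\<exists>u\<in>tuples n. act as x u \<and> E a u y)"

primrec iprod :: "'a list list \<Rightarrow> 'a list" where
  "iprod [] = \<one>"
| "iprod (a # as) = iota a \<otimes> iprod as"

lemma iprod_closed: "set as \<subseteq> W1 \<Longrightarrow> iprod as \<in> carrier G"
  by (induction as) (auto simp: iota_closed)

lemma act_fun: "act as x y \<Longrightarrow> act as x y' \<Longrightarrow> y = y'"
  by (induction as arbitrary: y y') (auto, metis E_fun)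

lemma gen_act: "set as \<subseteq> W1 \<Longrightarrow> eventually (\<lambda>x. act as x (iprod as \<otimes> x)) gen"
proof (induction as)
  case Nil
  show ?case by (rule eventually_mono[OF gen_carrier]) simp
next
  case (Cons a as)
  have a: "a \<in> W1" and as: "set as \<subseteq> W1" using Cons.prems by auto
  have "eventually (\<lambda>x. E a x (iota a \<otimes> x)) gen" using rep_iota[OF a] by (simp add: rep_def)
  from gen_translate[OF iprod_closed[OF as] this] Cons.IH[OF as] gen_carrier show ?case
  proof eventually_elim
    case (elim x)
    have "iprod as \<otimes> x \<in> carrier G" using elim(3) iprod_closed[OF as] by simp
    then have "iprod as \<otimes> x \<in> tuples n" using length_G by (simp add: mem_tuples)
    then show ?case using elim iota_closed[OF a] iprod_closed[OF as] by (auto simp: m_assoc)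
  qed
qed

definition eqv :: "'a list list \<Rightarrow> 'a list list \<Rightarrow> bool" where
  "eqv as bs \<longleftrightarrow> dim {x \<in> tuples n. x \<in> W \<and> \<not> (\<exists>y\<in>tuples n. act as x y \<and> act bs x y)} < Some k"

lemma defpred_act:
  assumes "\<And>a. a \<in> set as \<Longrightarrow> length a = n" "defmap SN m n s" "defmap SN m n t"
  shows "defpred SN m (\<lambda>z. act as (s z) (t z))"
  using assms
proof (induction as arbitrary: m s t)
  case (Cons a as)
  have a: "length a = n" using Cons.prems(1) by simp
  have IH: "defpred SN m (\<lambda>z. act as (s z) (t z))" if "defmap SN m n s" "defmap SN m n t" for m s t
    using Cons.IH[OF _ that] Cons.prems(1) by simp
  show ?case unfolding act.simps
    by (rule IH N.defmap_const[OF a] N.defmap_take Cons.prems(2,3) defs)+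
qed (use N.defpred_eq in simp)

text \<open>Generically a word acts as left translation by its product, and two left translations
  that agree at one point are equal. So a comparison at generic points of \<open>W\<close> decides
  equality in \<open>G\<close>.\<close>

lemma eqv_iff:
  assumes as: "set as \<subseteq> W1" and bs: "set bs \<subseteq> W1"
  shows "eqv as bs \<longleftrightarrow> iprod as = iprod bs"
proof -
  have len: "length a = n" if "a \<in> set as \<union> set bs" for a
    using that as bs M.S_lengthD[OF W1_SM] by blast
  have "defpred SN n (\<lambda>x. \<exists>y\<in>tuples n. act as x y \<and> act bs x y)"
    by (rule defpred_act len defs | simp)+
  then have "eqv as bs \<longleftrightarrow> eventually (\<lambda>x. \<exists>y\<in>tuples n. act as x y \<and> act bs x y) gen"
    unfolding eqv_def using gen_iff_W by blast
  also have "\<dots> \<longleftrightarrow> iprod as = iprod bs"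
  proof
    assume "eventually (\<lambda>x. \<exists>y\<in>tuples n. act as x y \<and> act bs x y) gen"
    then have "eventually (\<lambda>x. iprod as \<otimes> x = iprod bs \<otimes> x) gen"
      using gen_act[OF as] gen_act[OF bs] by eventually_elim (metis act_fun)
    then obtain x where "x \<in> carrier G" "iprod as \<otimes> x = iprod bs \<otimes> x" by (rule gen_ex)
    then show "iprod as = iprod bs" using iprod_closed as bs by auto
  next
    assume "iprod as = iprod bs"
    then have "eventually (\<lambda>x. act bs x (iprod as \<otimes> x)) gen" using gen_act[OF bs] by simp
    then show "eventually (\<lambda>x. \<exists>y\<in>tuples n. act as x y \<and> act bs x y) gen"
      using gen_act[OF as] gen_carrier
      by eventually_elim (metis as iprod_closed length_G m_closed mem_tuples)
  qed
  finally show ?thesis .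
qed

text \<open>As no representative can be selected definably among several, only those elements are
  kept that share their group element with no other element of \<open>W1\<close>. This makes
  \<open>iota\<close> injective, and \<open>gen_W2\<close> shows that the loss is small.\<close>

definition W2 :: "'a list set" where
  "W2 = {a \<in> W1. \<forall>b\<in>W1. eqv [b] [a] \<longrightarrow> b = a}"

lemma W2_SM: "W2 \<in> SM n"
  unfolding W2_def eqv_def act.simps by (rule M.S_Collect) (rule W1_SM W defs)+

lemma W2_W1: "a \<in> W2 \<Longrightarrow> a \<in> W1"
  by (simp add: W2_def)

lemma inj_iota_W2: "inj_on iota W2"
  by (rule inj_onI) (auto simp: W2_def eqv_iff iota_closed)

text \<open>Suppose that a represents itself and is also represented by b in \<open>W1\<close>.
  Either b represents itself and equals a, or b is one of the few elements of \<open>W1\<close> that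
  do not. The latter represent few group elements, since each represents at most one.\<close>

lemma gen_W2: "eventually (\<lambda>a. a \<in> W2 \<and> iota a = a) gen"
proof -
  let ?B = "{b \<in> tuples n. b \<in> W1 \<and> \<not> rep b b}"
  let ?D = "{g \<in> tuples n. \<exists>b\<in>?B. rep b g}"
  have B: "?B \<in> SN n" by (rule N.S_Collect) (rule SN_I[OF W1_SM] defs)+
  have D: "?D \<in> SN n" by (rule N.S_Collect) (rule N.defpred_bex[OF B] defs)+
  have B0: "{b \<in> tuples n. b \<in> W \<and> \<not> rep b b} \<in> SN n" by (rule N.S_Collect) (rule SN_I[OF W] defs)+
  have "defpred SN n (\<lambda>c. rep c c)" by (rule defs)+
  then have "dim {b \<in> tuples n. b \<in> W \<and> \<not> rep b b} < Some k" using gen_iff_W gen_rep_self by blast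
  then have "dim ?B < Some k" by (rule dim_less_mono[OF B0 _ _ B]) (auto simp: W1_def)
  moreover have "dim ?D \<le> dim ?B"
    by (rule dim_le_rel[OF D B, where R = "\<lambda>g b. rep b g"]) ((rule defs)+, auto intro: rep_unique)
  ultimately have "dim ?D < Some k" by order
  then have "eventually (\<lambda>a. a \<notin> ?D) gen" unfolding eventually_gen using D by blast
  then show ?thesis using gen_rep_self gen_W1
  proof eventually_elim
    case (elim a)
    have "b = a" if b: "b \<in> W1" "eqv [b] [a]" for b
    proof -
      have "iota b = iota a" using b elim(3) by (simp add: eqv_iff iota_closed)
      then have "rep b a" using rep_iota[OF b(1)] iota_eq[OF elim(2)] by simp
      moreover have l: "length b = n" "length a = n" using b(1) elim(3) M.S_lengthD[OF W1_SM] by blast+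
      ultimately have "rep b b" using elim(1) b(1) by (auto simp: mem_tuples)
      then show ?thesis using rep_unique \<open>rep b a\<close> by blast
    qed
    then show ?case using elim iota_eq by (auto simp: W2_def)
  qed
qed

lemma iota_W2_SN: "iota ` W2 \<in> SN n"
proof -
  have "{g \<in> tuples n. \<exists>a\<in>W2. rep a g} \<in> SN n" by (rule N.S_Collect) (rule SN_I[OF W2_SM] defs)+
  moreover have "{g \<in> tuples n. \<exists>a\<in>W2. rep a g} = iota ` W2"
  proof (intro equalityI subsetI)
    fix g assume "g \<in> {g \<in> tuples n. \<exists>a\<in>W2. rep a g}"
    then show "g \<in> iota ` W2" using iota_eq by blast
  next
    fix g assume "g \<in> iota ` W2"
    then obtain a where a: "a \<in> W2" "g = iota a" by blast
    then have "rep a g" using rep_iota W2_W1 by blast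
    then show "g \<in> {g \<in> tuples n. \<exists>a\<in>W2. rep a g}"
      using a length_G[OF rep_carrier] by (auto simp: mem_tuples)
  qed
  ultimately show ?thesis by simp
qed

lemma gen_iota_W2: "eventually (\<lambda>g. g \<in> iota ` W2) gen"
  using gen_W2 by eventually_elim (metis image_eqI)

text \<open>Both factors of \<open>x \<otimes> (inv x \<otimes> g)\<close> are generic for generic
  x. This turns an arbitrary g, which may lack a representative, into a two-letter word over
  \<open>W2\<close>.\<close>

lemma carrier_splits:
  assumes g: "g \<in> carrier G" obtains a b where "a \<in> W2" "b \<in> W2" "g = iota a \<otimes> iota b"
proof -
  have "eventually (\<lambda>x. x \<in> iota ` W2 \<and> inv x \<otimes> g \<in> iota ` W2) gen"
    using gen_iota_W2 gen_inv_mult[OF g gen_iota_W2] by (rule eventually_conj)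
  then obtain x where x: "x \<in> carrier G" "x \<in> iota ` W2" "inv x \<otimes> g \<in> iota ` W2" by (rule gen_ex) blast
  have "g = x \<otimes> (inv x \<otimes> g)" using x(1) g by (simp add: m_assoc[symmetric])
  then show thesis using x that by auto
qed

end

subsection \<open>The SM-definable group\<close>

lemma transport_group:
  fixes G (structure)
  assumes "group G" and bij: "bij_betw \<phi> B (carrier G)"
    and H: "H = \<lparr>carrier = B, mult = \<lambda>u v. inv_into B \<phi> (\<phi> u \<otimes> \<phi> v), one = inv_into B \<phi> \<one>\<rparr>"
  shows "group H" and "inv_into B \<phi> \<in> iso G H"
proof -
  interpret group G by fact
  let ?\<psi> = "inv_into B \<phi>"
  have \<psi>B: "?\<psi> y \<in> B" and \<phi>\<psi>: "\<phi> (?\<psi> y) = y" if "y \<in> carrier G" for y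
    using that bij by (auto simp: bij_betw_def inv_into_into f_inv_into_f)
  have \<phi>G: "\<phi> u \<in> carrier G" and \<psi>\<phi>: "?\<psi> (\<phi> u) = u" if "u \<in> B" for u
    using that bij by (auto simp: bij_betw_def)
  show "group H"
  proof (rule groupI)
    fix u assume "u \<in> carrier H"
    then have u: "u \<in> B" by (simp add: H)
    show "\<exists>y\<in>carrier H. y \<otimes>\<^bsub>H\<^esub> u = \<one>\<^bsub>H\<^esub>"
      using u by (intro bexI[of _ "?\<psi> (inv (\<phi> u))"]) (simp_all add: H \<phi>G \<psi>B \<phi>\<psi>)
  qed (auto simp: H \<phi>G \<psi>B \<phi>\<psi> \<psi>\<phi> m_assoc)
  have "bij_betw ?\<psi> (carrier G) (carrier H)" using bij_betw_inv_into[OF bij] by (simp add: H)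
  then show "?\<psi> \<in> iso G H" by (auto simp: iso_def hom_def H \<psi>B \<phi>\<psi>)
qed

context group_chunk
begin

text \<open>Finitely many translates of the image of \<open>W2\<close> cover the group, so the group is a disjoint union of
  finitely many copies of \<open>SM\<close>-definable subsets of \<open>W2\<close>; the copies are told apart by an additional
  coordinate.\<close>

theorem isomorphic_to_SM_group: "\<exists>m H. definable_group SM m H \<and> definably_isomorphic SN n G m H"
proof -
  obtain gs where gs: "set gs \<subseteq> carrier G" "\<And>y. y \<in> carrier G \<Longrightarrow> \<exists>g\<in>set gs. \<exists>v\<in>iota ` W2. y = g \<otimes> v"
    using finite_translates_cover[OF iota_W2_SN _ gen_iota_W2] iota_closed W2_W1 by blast
  define r g where "r = length gs" and "g i = gs ! i" for i
  have gG: "g i \<in> carrier G" if "i < r" for i using that gs(1) nth_mem by (auto simp: r_def g_def)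
  have "\<exists>a b. a \<in> W2 \<and> b \<in> W2 \<and> g i = iota a \<otimes> iota b" if "i < r" for i
    using carrier_splits[OF gG[OF that]] by metis
  then obtain p q where pq: "\<And>i. i < r \<Longrightarrow> p i \<in> W2 \<and> q i \<in> W2 \<and> g i = iota (p i) \<otimes> iota (q i)" by metis
  have lW2: "length a = n" if "a \<in> W2" for a using M.S_lengthD[OF W2_SM that] .
  have lp: "length (p i) = n" and lq: "length (q i) = n" if "i < r" for i using pq[OF that] lW2 by blast+
  \<comment> \<open>An order without greatest element is infinite, which provides a distinct tag
    \<open>t i\<close> for each translate.\<close>
  have "infinite (UNIV :: 'a set)" by (rule infinite_growing) (auto intro: gt_ex)
  then obtain t :: "nat \<Rightarrow> 'a" where t: "inj t" using infinite_countable_subset by blast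
  have lt: "length [t i] = 1" for i by simp
  have iprod3: "iprod [p i, q i, a] = g i \<otimes> iota a" if "i < r" "a \<in> W2" for i a
    using pq[OF that(1)] that(2) by (simp add: iota_closed W2_W1 m_assoc)
  have iprod6: "iprod [p i, q i, a, p j, q j, b] = g i \<otimes> iota a \<otimes> (g j \<otimes> iota b)"
    if "i < r" "j < r" "a \<in> W2" "b \<in> W2" for i j a b
    using pq[OF that(1)] pq[OF that(2)] that(3,4) by (simp add: iota_closed W2_W1 m_assoc)
  \<comment> \<open>\<open>P i\<close> keeps the a for which \<open>g i \<otimes> iota a\<close>
    lies in no earlier translate. The test compares three-letter words because \<open>g i\<close> is
    accessible to \<open>SM\<close> only through \<open>p i\<close> and \<open>q i\<close>.\<close>
  define P where "P i = {a \<in> W2. \<forall>j<r. j < i \<longrightarrow> (\<forall>b\<in>W2. \<not> eqv [p i, q i, a] [p j, q j, b])}" for i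
  have P_SM: "P i \<in> SM n" if "i < r" for i
    unfolding P_def eqv_def act.simps
    by (rule M.S_Collect) (rule W2_SM W lp lq defs that | assumption)+
  have P_W2: "a \<in> W2" if "a \<in> P i" for a i using that by (simp add: P_def)
  have P_iff: "a \<in> P i \<longleftrightarrow> a \<in> W2 \<and> (\<forall>j<i. \<forall>b\<in>W2. g i \<otimes> iota a \<noteq> g j \<otimes> iota b)" if "i < r" for i a
  proof -
    have "eqv [p i, q i, a] [p j, q j, b] \<longleftrightarrow> g i \<otimes> iota a = g j \<otimes> iota b" if "j < r" "a \<in> W2" "b \<in> W2" for j b
      using eqv_iff[of "[p i, q i, a]" "[p j, q j, b]"] pq[OF \<open>i < r\<close>] pq[OF that(1)] that(2,3)
        iprod3[OF \<open>i < r\<close> that(2)] iprod3[OF that(1,3)] W2_W1 by simp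
    then show ?thesis using less_trans[OF _ that] unfolding P_def mem_Collect_eq by blast
  qed
  define B where "B = {u \<in> tuples (n + 1). \<exists>i<r. \<exists>a\<in>P i. u = a @ [t i]}"
  have B_SM: "B \<in> SM (n + 1)" unfolding B_def
    by (rule M.S_Collect) (rule P_SM M.defmap_const[OF lt] defs | assumption)+
  have BI: "a @ [t i] \<in> B" if "i < r" "a \<in> P i" for i a
    using that lW2[OF P_W2[OF that(2)]] by (auto simp: B_def mem_tuples)
  have BE: "\<exists>i<r. \<exists>a\<in>P i. u = a @ [t i]" if "u \<in> B" for u using that by (simp add: B_def)
  define \<phi> where "\<phi> u = g (inv_into UNIV t (last u)) \<otimes> iota (butlast u)" for u
  have \<phi>: "\<phi> (a @ [t i]) = g i \<otimes> iota a" for a i using t by (simp add: \<phi>_def)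
  have gi: "g i \<otimes> iota a \<in> carrier G" if "i < r" "a \<in> P i" for i a
    using gG iota_closed W2_W1 P_W2 that by simp
  have bij: "bij_betw \<phi> B (carrier G)"
    unfolding bij_betw_def
  proof
    show "inj_on \<phi> B"
    proof (rule inj_onI)
      fix u v assume uv: "u \<in> B" "v \<in> B" "\<phi> u = \<phi> v"
      obtain i a where u: "i < r" "a \<in> P i" "u = a @ [t i]" using BE[OF uv(1)] by blast
      obtain j b where v: "j < r" "b \<in> P j" "v = b @ [t j]" using BE[OF uv(2)] by blast
      have e: "g i \<otimes> iota a = g j \<otimes> iota b" using uv u v \<phi> by simp
      have "\<not> j < i" using P_iff[OF u(1)] u(2) P_W2[OF v(2)] e by blast
      moreover have "\<not> i < j" using P_iff[OF v(1)] v(2) P_W2[OF u(2)] e by metis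
      ultimately have ij: "i = j" by simp
      then have "iota a = iota b" using e gG[OF u(1)] iota_closed W2_W1 P_W2 u v by simp
      then have "a = b" using inj_onD[OF inj_iota_W2] P_W2 u v by blast
      then show "u = v" using u v ij by simp
    qed
    show "\<phi> ` B = carrier G"
    proof (intro equalityI subsetI)
      fix y assume "y \<in> \<phi> ` B"
      then obtain u where u: "u \<in> B" "y = \<phi> u" by blast
      then obtain i a where "i < r" "a \<in> P i" "u = a @ [t i]" using BE by blast
      then show "y \<in> carrier G" using u \<phi> gi by simp
    next
      fix y assume "y \<in> carrier G"
      then obtain i a where "i < r \<and> a \<in> W2 \<and> y = g i \<otimes> iota a"
        using gs(2)[of y] unfolding r_def g_def by (metis (no_types, lifting) image_iff in_set_conv_nth)
      then have ex: "\<exists>i. i < r \<and> (\<exists>a\<in>W2. y = g i \<otimes> iota a)" by blast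
      define i where "i = (LEAST i. i < r \<and> (\<exists>a\<in>W2. y = g i \<otimes> iota a))"
      have i: "i < r" "\<exists>a\<in>W2. y = g i \<otimes> iota a" using LeastI_ex[OF ex] by (auto simp: i_def)
      then obtain a where a: "a \<in> W2" "y = g i \<otimes> iota a" by blast
      have "g i \<otimes> iota a \<noteq> g j \<otimes> iota b" if "j < i" "b \<in> W2" for j b
        using not_less_Least[of j "\<lambda>i. i < r \<and> (\<exists>a\<in>W2. y = g i \<otimes> iota a)"] that i(1) a(2)
        unfolding i_def[symmetric] by auto
      then have "a \<in> P i" using P_iff[OF i(1)] a(1) by blast
      then show "y \<in> \<phi> ` B" using BI[OF i(1)] \<phi> a(2) by (metis image_eqI)
    qed
  qed
  define H where "H = \<lparr>carrier = B, mult = \<lambda>u v. inv_into B \<phi> (\<phi> u \<otimes> \<phi> v), one = inv_into B \<phi> \<one>\<rparr>"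
  note tr = transport_group[OF is_group bij H_def]
  have \<psi>: "inv_into B \<phi> y = w \<longleftrightarrow> \<phi> w = y" if "y \<in> carrier G" "w \<in> B" for y w
    using that bij by (auto simp: bij_betw_def f_inv_into_f)
  have \<psi>B: "inv_into B \<phi> y \<in> B" if "y \<in> carrier G" for y
    using that bij by (auto simp: bij_betw_def inv_into_into)
  have lB: "length u = n + 1" if "u \<in> B" for u using M.S_lengthD[OF B_SM that] .
  have \<phi>G: "\<phi> u \<in> carrier G" if "u \<in> B" for u using that bij by (auto simp: bij_betw_def)
  let ?N = "n + 1"
  \<comment> \<open>The product of the elements coded by u and v is that of a six-letter word, and
    the element coded by w is that of a three-letter word; \<open>eqv\<close> compares them within
    \<open>SM\<close>.\<close>
  define Q where "Q u v w \<longleftrightarrow> (\<exists>i<r. \<exists>j<r. \<exists>l<r. \<exists>a\<in>P i. \<exists>b\<in>P j. \<exists>c\<in>P l. u = a @ [t i] \<and> v = b @ [t j] \<and> w = c @ [t l] \<and>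
      eqv [p i, q i, a, p j, q j, b] [p l, q l, c])" for u v w
  have Q_iff: "Q u v w \<longleftrightarrow> u \<in> B \<and> v \<in> B \<and> w \<in> B \<and> \<phi> w = \<phi> u \<otimes> \<phi> v" for u v w
  proof -
    have *: "eqv [p i, q i, a, p j, q j, b] [p l, q l, c] \<longleftrightarrow> \<phi> (c @ [t l]) = \<phi> (a @ [t i]) \<otimes> \<phi> (b @ [t j])"
      if "i < r" "j < r" "l < r" "a \<in> P i" "b \<in> P j" "c \<in> P l" for i j l a b c
    proof -
      have "a \<in> W2" "b \<in> W2" "c \<in> W2" using that P_W2 by blast+
      then show ?thesis
        using eqv_iff[of "[p i, q i, a, p j, q j, b]" "[p l, q l, c]"] pq[OF that(1)] pq[OF that(2)] pq[OF that(3)]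
          iprod3[OF that(3)] iprod6[OF that(1,2)] W2_W1 unfolding \<phi> by auto
    qed
    show ?thesis
    proof
      assume "Q u v w"
      then show "u \<in> B \<and> v \<in> B \<and> w \<in> B \<and> \<phi> w = \<phi> u \<otimes> \<phi> v" unfolding Q_def using * BI by blast
    next
      assume uvw: "u \<in> B \<and> v \<in> B \<and> w \<in> B \<and> \<phi> w = \<phi> u \<otimes> \<phi> v"
      then obtain i a j b l c where ijl: "i < r" "j < r" "l < r" and abc: "a \<in> P i" "b \<in> P j" "c \<in> P l"
        and e: "u = a @ [t i]" "v = b @ [t j]" "w = c @ [t l]" using BE by metis
      have "eqv [p i, q i, a, p j, q j, b] [p l, q l, c]" using *[OF ijl abc] uvw e by simp
      then show "Q u v w" unfolding Q_def
        by (intro exI[of _ i] exI[of _ j] exI[of _ l] bexI[of _ a] bexI[of _ b] bexI[of _ c] conjI ijl abc e)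
    qed
  qed
  \<comment> \<open>The letters a, b and c are variables here. As the words have fixed length,
    unfolding \<open>act\<close> yields a finite nest of quantifiers over \<open>E\<close>.\<close>
  have "{z \<in> tuples (?N + (?N + ?N)). Q (take ?N z) (take ?N (drop ?N z)) (drop ?N (drop ?N z))} \<in> SM (?N + (?N + ?N))"
    unfolding Q_def eqv_def act.simps
    by (rule M.S_Collect) (rule P_SM W lp lq M.defmap_const[OF lt] defs | assumption)+
  moreover have "{z \<in> tuples (?N + (?N + ?N)). Q (take ?N z) (take ?N (drop ?N z)) (drop ?N (drop ?N z))} =
     {u @ v @ (u \<otimes>\<^bsub>H\<^esub> v) | u v. u \<in> carrier H \<and> v \<in> carrier H}" (is "?L = ?R")
  proof (intro equalityI subsetI)
    fix z assume z: "z \<in> ?L"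
    define u v w where "u = take ?N z" and "v = take ?N (drop ?N z)" and "w = drop ?N (drop ?N z)"
    have "z = u @ v @ w" unfolding u_def v_def w_def append_take_drop_id ..
    moreover have "u \<in> B" "v \<in> B" "w \<in> B" "\<phi> w = \<phi> u \<otimes> \<phi> v"
      using z Q_iff unfolding u_def v_def w_def by auto
    moreover from this have "w = inv_into B \<phi> (\<phi> u \<otimes> \<phi> v)" using \<psi>[of "\<phi> u \<otimes> \<phi> v" w] \<phi>G by simp
    ultimately show "z \<in> ?R" by (auto simp: H_def)
  next
    fix z assume "z \<in> ?R"
    then obtain u v where uv: "z = u @ v @ inv_into B \<phi> (\<phi> u \<otimes> \<phi> v)" "u \<in> B" "v \<in> B" by (auto simp: H_def)
    define w where "w = inv_into B \<phi> (\<phi> u \<otimes> \<phi> v)"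
    have G: "\<phi> u \<otimes> \<phi> v \<in> carrier G" using \<phi>G uv by simp
    have w: "w \<in> B" "\<phi> w = \<phi> u \<otimes> \<phi> v" using \<psi>B[OF G] \<psi>[OF G, of w] by (auto simp: w_def)
    then have "Q u v w" using Q_iff uv by blast
    then show "z \<in> ?L" using uv w(1) lB by (simp add: mem_tuples w_def[symmetric])
  qed
  moreover have "?N + (?N + ?N) = 3 * ?N" by simp
  ultimately have "{u @ v @ (u \<otimes>\<^bsub>H\<^esub> v) | u v. u \<in> carrier H \<and> v \<in> carrier H} \<in> SM (3 * ?N)" by metis
  then have "definable_group SM ?N H"
    using tr(1) B_SM M.S_subset[OF B_SM] by (simp add: definable_group_def H_def)
  moreover have "definably_isomorphic SN n G ?N H"
    unfolding definably_isomorphic_def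
  proof (intro exI conjI)
    show "inv_into B \<phi> \<in> iso G H" by (rule tr(2))
    have lg: "length (g i) = n" if "i < r" for i using length_G[OF gG[OF that]] .
    have P_SN: "P i \<in> SN n" if "i < r" for i using SN_I[OF P_SM[OF that]] .
    \<comment> \<open>The graph may mention \<open>rep\<close> and the multiplication of
      \<open>G\<close>: unlike \<open>H\<close>, the isomorphism only has to be
      \<open>SN\<close>-definable.\<close>
    have "{z \<in> tuples (n + ?N). \<exists>i<r. \<exists>a\<in>P i. drop n z = a @ [t i] \<and> (\<exists>v\<in>tuples n. rep a v \<and> Mult (g i) v (take n z))} \<in> SN (n + ?N)"
      by (rule N.S_Collect) (rule P_SN lg N.defmap_const[OF lt] defs | assumption)+
    moreover have "{z \<in> tuples (n + ?N). \<exists>i<r. \<exists>a\<in>P i. drop n z = a @ [t i] \<and> (\<exists>v\<in>tuples n. rep a v \<and> Mult (g i) v (take n z))}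
      = {x @ inv_into B \<phi> x | x. x \<in> carrier G}" (is "?L = ?R")
    proof (intro equalityI subsetI)
      fix z assume "z \<in> ?L"
      then obtain i a v where z: "i < r" "a \<in> P i" "drop n z = a @ [t i]" "rep a v" "Mult (g i) v (take n z)" by blast
      then have "take n z = \<phi> (drop n z)" using iota_eq \<phi> by (simp add: Mult_def)
      moreover have "take n z \<in> carrier G" using z(4,5) gG[OF z(1)] rep_carrier by (simp add: Mult_def)
      ultimately have "inv_into B \<phi> (take n z) = drop n z" using \<psi> BI[OF z(1,2)] z(3) by simp
      then have "z = take n z @ inv_into B \<phi> (take n z)" by simp
      then show "z \<in> ?R" using \<open>take n z \<in> carrier G\<close> by blast
    next
      fix z assume "z \<in> ?R"
      then obtain x where x: "x \<in> carrier G" "z = x @ inv_into B \<phi> x" by blast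
      obtain i a where i: "i < r" "a \<in> P i" "inv_into B \<phi> x = a @ [t i]" using BE[OF \<psi>B[OF x(1)]] by blast
      then have xe: "x = g i \<otimes> iota a" using \<psi>[OF x(1) BI[OF i(1,2)]] \<phi> by simp
      have a: "a \<in> W1" using W2_W1 P_W2 i by blast
      have "iota a \<in> tuples n" using length_G[OF iota_closed[OF a]] by (simp add: mem_tuples)
      moreover have "Mult (g i) (iota a) x" using xe gG[OF i(1)] iota_closed[OF a] by (simp add: Mult_def)
      moreover have "take n z = x" "drop n z = a @ [t i]" "z \<in> tuples (n + ?N)"
        using x i length_G[OF x(1)] lB[OF \<psi>B[OF x(1)]] by (auto simp: mem_tuples)
      ultimately show "z \<in> ?L" using i rep_iota[OF a] by blast
    qed
    ultimately show "{x @ inv_into B \<phi> x | x. x \<in> carrier G} \<in> SN (n + ?N)" by simp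
  qed
  ultimately show ?thesis by blast
qed

end

context tame_group
begin

lemma isomorphic_to_SM_group: "\<exists>m H. definable_group SM m H \<and> definably_isomorphic SN n G m H"
proof -
  obtain W where W: "W \<in> SM n" "dim (W - carrier G) < Some k" "dim (carrier G - W) < Some k"
    by (rule carrier_approx)
  obtain EE where EE: "EE \<in> SM (n + (n + n))"
    "\<And>a b c c'. mult_rel EE a b c \<Longrightarrow> mult_rel EE a b c' \<Longrightarrow> c = c'"
    "\<And>a b b' c. mult_rel EE a b c \<Longrightarrow> mult_rel EE a b' c \<Longrightarrow> b = b'"
    "\<And>a b c. mult_rel EE a b c \<Longrightarrow> c \<in> W"
    "eventually (\<lambda>a. eventually (\<lambda>b. mult_rel EE a b (a \<otimes> b)) gen) gen"
    by (rule mult_approx[OF W]) blast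
  interpret group_chunk SM SN dim G n k C W EE
    by unfold_locales (fact W EE)+
  show ?thesis by (rule isomorphic_to_SM_group)
qed

end

section \<open>Assembling the equivalence\<close>

context tame_pair
begin

lemma definably_isomorphic_trans:
  assumes f: "definably_isomorphic SN n G k H" and g: "definably_isomorphic SN k H m K"
    and G: "carrier G \<subseteq> tuples n" and H: "carrier H \<subseteq> tuples k" and K: "carrier K \<subseteq> tuples m"
  shows "definably_isomorphic SN n G m K"
proof -
  obtain f where f: "f \<in> iso G H" "{x @ f x | x. x \<in> carrier G} \<in> SN (n + k)"
    using f by (auto simp: definably_isomorphic_def)
  obtain g where g: "g \<in> iso H K" "{x @ g x | x. x \<in> carrier H} \<in> SN (k + m)"
    using g by (auto simp: definably_isomorphic_def)
  have fH: "f x \<in> carrier H" if "x \<in> carrier G" for x using f(1) that by (auto simp: iso_def hom_def)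
  have gK: "g x \<in> carrier K" if "x \<in> carrier H" for x using g(1) that by (auto simp: iso_def hom_def)
  have gf: "g \<circ> f \<in> iso G K" by (rule Group.iso_set_trans[OF f(1) g(1)])
  have "{z \<in> tuples (n + m). \<exists>y\<in>tuples k. take n z @ y \<in> {x @ f x | x. x \<in> carrier G} \<and>
     y @ drop n z \<in> {x @ g x | x. x \<in> carrier H}} \<in> SN (n + m)"
    by (rule N.S_Collect) (rule N.defpred_mem[OF f(2)] N.defpred_mem[OF g(2)] defs)+
  moreover have "{z \<in> tuples (n + m). \<exists>y\<in>tuples k. take n z @ y \<in> {x @ f x | x. x \<in> carrier G} \<and>
     y @ drop n z \<in> {x @ g x | x. x \<in> carrier H}} = {x @ (g \<circ> f) x | x. x \<in> carrier G}" (is "?L = ?R")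
  proof (intro equalityI subsetI)
    fix z assume "z \<in> ?L"
    then obtain y x x' where *: "length z = n + m" "length y = k" "take n z @ y = x @ f x" "x \<in> carrier G"
      "y @ drop n z = x' @ g x'" "x' \<in> carrier H" by (auto simp: mem_tuples)
    have l: "length x = n" "length x' = k" using subsetD[OF G *(4)] subsetD[OF H *(6)] by (simp_all add: mem_tuples)
    have "take n z = x" "y = f x" using *(1,3) l(1) by simp_all
    moreover have "y = x'" "drop n z = g x'" using *(2,5) l(2) by simp_all
    ultimately have "take n z = x" "y = f x" "y = x'" "drop n z = g x'" by blast+
    then have "z = x @ g (f x)" by (metis append_take_drop_id)
    then show "z \<in> ?R" using *(4) by auto
  next
    fix z assume "z \<in> ?R"
    then obtain x where x: "x \<in> carrier G" "z = x @ g (f x)" by auto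
    have l: "length x = n" "f x \<in> tuples k" "length (g (f x)) = m"
      using subsetD[OF G x(1)] subsetD[OF H fH[OF x(1)]] subsetD[OF K gK[OF fH[OF x(1)]]]
      by (simp_all add: mem_tuples)
    then have "take n z = x" "drop n z = g (f x)" "z \<in> tuples (n + m)" using x by (simp_all add: mem_tuples)
    then show "z \<in> ?L" using l(2) x(1) fH[OF x(1)] by blast
  qed
  ultimately have "{x @ (g \<circ> f) x | x. x \<in> carrier G} \<in> SN (n + m)" by simp
  with gf show ?thesis unfolding definably_isomorphic_def by blast
qed

lemma closure_SM:
  assumes "X \<in> SN n" shows "cl n X \<in> SM n"
proof -
  have "open_tuples n (tuples n - cl n X)"
    unfolding open_tuples_iff_nhd
  proof (intro conjI ballI)
    fix x assume "x \<in> tuples n - cl n X"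
    then obtain a b where ab: "length a = n" "length b = n" "x \<in> box a b" "box a b \<inter> X = {}"
      unfolding cl_def by blast
    have "y \<in> tuples n - cl n X" if "y \<in> box a b" for y
      using ab that by (auto simp: cl_def mem_tuples mem_box)
    then show "nhd n x (tuples n - cl n X)" using nhd_mono[OF nhd_box[OF ab(1-3)]] by blast
  qed auto
  then have "tuples n - cl n X \<in> SM n" using open_SM N.S_compl[OF N.S_cl[OF assms]] by blast
  from M.S_compl[OF this] show ?thesis by (simp add: cl_def double_diff)
qed

end

theorem theorem1p1:
  fixes SM SN :: "nat \<Rightarrow> ('a::{dense_linorder, no_top, no_bot}) list set set"
    and dim :: "'a list set \<Rightarrow> nat option"
    and G :: "'a list monoid" and n :: nat
  assumes "o_minimal SM"
    and "expansion SN SM"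
    and "\<forall>m A. A \<in> SN m \<and> open_tuples m A \<longrightarrow> A \<in> SM m"
    and "dimension_function SN SM dim"
    and "definable_group SN n G"
  shows "(\<exists>k H. definable_group SM k H \<and> definably_isomorphic SN n G k H)
     \<longleftrightarrow> (\<exists>k H. definable_group SN k H \<and> strongly_large dim k (carrier H)
              \<and> definably_isomorphic SN n G k H)"
proof -
  interpret tame_pair SM SN dim using assms(1-4) by unfold_locales
  show ?thesis
  proof
    assume "\<exists>k H. definable_group SM k H \<and> definably_isomorphic SN n G k H"
    then obtain k H where H: "definable_group SM k H" "definably_isomorphic SN n G k H" by blast
    have HM: "carrier H \<in> SM k" using H(1) by (simp add: definable_group_def)
    have "definable_group SN k H" using H(1) SN_I by (auto simp: definable_group_def)
    \<comment> \<open>By the frontier inequality, taking the closure of an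
      \<open>SM\<close>-definable set does not raise its dimension.\<close>
    moreover have "strongly_large dim k (carrier H)"
      unfolding strongly_large_def using dim_cl[OF HM] dim_SM[OF M.S_cl[OF HM]] by simp
    ultimately show "\<exists>k H. definable_group SN k H \<and> strongly_large dim k (carrier H) \<and> definably_isomorphic SN n G k H"
      using H(2) by blast
  next
    assume "\<exists>k H. definable_group SN k H \<and> strongly_large dim k (carrier H) \<and> definably_isomorphic SN n G k H"
    then obtain m H where H: "definable_group SN m H" "strongly_large dim m (carrier H)" "definably_isomorphic SN n G m H"
      by blast
    have HN: "carrier H \<in> SN m" and grp: "group H" using H(1) by (auto simp: definable_group_def)
    have cl: "cl m (carrier H) \<in> SM m" by (rule closure_SM[OF HN])
    have "carrier H \<noteq> {}" using group.is_monoid[OF grp] monoid.one_closed by blast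
    then obtain k where k: "dim (carrier H) = Some k" using dim_None[OF HN] by auto
    \<comment> \<open>The closure of a definable set is always \<open>SM\<close>-definable; strong
      largeness gives it the dimension of the carrier, so it can serve as the set
      \<open>C\<close>.\<close>
    have "dim (cl m (carrier H)) = Some k" using H(2) k dim_SM[OF cl] by (simp add: strongly_large_def)
    then interpret tame_group SM SN dim H m k "cl m (carrier H)"
      using H(1) cl k subset_cl[OF N.S_subset[OF HN]] by unfold_locales
    obtain l K where K: "definable_group SM l K" "definably_isomorphic SN m H l K"
      using isomorphic_to_SM_group by blast
    have "definably_isomorphic SN n G l K"
      by (rule definably_isomorphic_trans[OF H(3) K(2)])
        (use assms(5) H(1) K(1) in \<open>auto simp: definable_group_def\<close>)
    then show "\<exists>k H. definable_group SM k H \<and> definably_isomorphic SN n G k H" using K(1) by blast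
  qed
qed

end
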